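(* Suppose that $\sigma^2=\sigma^2(0,1)<\infty$, that $\alpha_n\vee\beta_n\to 0$ as $n\to\infty$, that the smoothness condition $[A_1]$ (stated in the context) holds, and that $$\limsup_{n\to\infty}\frac{\alpha_n}{|\xi_{\alpha_n}|f(\xi_{\alpha_n})}<\infty,\qquad \limsup_{n\to\infty}\frac{\beta_n}{|\xi_{1-\beta_n}|f(\xi_{1-\beta_n})}<\infty.$$ In addition assume that for every $B>0$, as $n\to\infty$, $$\Psi_{\alpha_n,1/f}(B)=o\bigl((f(\xi_{\alpha_n})\ln k_n)^{-1}\bigr),\qquad \Psi_{1-\beta_n,1/f}(B)=o\bigl((f(\xi_{1-\beta_n})\ln m_n)^{-1}\bigr).$$ Then, as $n\to\infty$, $$\sup_{x\in\mathbb R}\left|F_{T_n}(x)-\Phi(x)\right|=o\Bigl(\frac{1}{\sqrt{k_n}}+\frac{1}{\sqrt{m_n}}\Bigr).$$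
   Context: Setting. $X_1,X_2,\dots$ are i.i.d. real-valued nondegenerate random variables with distribution function $F$; $X_{1:n}\le\dots\le X_{n:n}$ are the order statistics of $X_1,\dots,X_n$. $F^{-1}(u)=\inf\{x:F(x)\ge u\}$ for $0<u\le 1$, $F^{-1}(0)=F^{-1}(0^+)$, and $\xi_\nu=F^{-1}(\nu)$ for $0<\nu<1$. $k_n,m_n$ are sequences of integers with $0\le k_n<n-m_n\le n$ and $\min(k_n,m_n)\to\infty$ as $n\to\infty$; $\alpha_n=k_n/n$, $\beta_n=m_n/n$. The trimmed sum is $T_n=\frac1n\sum_{i=k_n+1}^{n-m_n}X_{i:n}$. Put $\mu(u,1-v)=\int_u^{1-v}F^{-1}(s)\,ds$ and $\sigma^2(u,1-v)=\int_u^{1-v}\int_u^{1-v}(s\wedge t-st)\,dF^{-1}(s)\,dF^{-1}(t)$ for $0\le u<1-v\le 1$; $\sigma^2(0,1)$ equals the variance of $X_1$ whenever $\mathbf EX_1^2<\infty$. We write $s\vee t=\max(s,t)$, $s\wedge t=\min(s,t)$. Winsorized scale: $Q_n(u)=\xi_{\alpha_n}\vee(F^{-1}(u)\wedge\xi_{1-\beta_n})$, $\mu_{W_{(n)}}=\int_0^1Q_n(u)\,du$, $\sigma^2_{W_{(n)}}=\int_0^1(Q_n(u)-\mu_{W_{(n)}})^2du$. $\Phi$ is the standard normal distribution function and $F_{T_n}(x)=\mathbf P\bigl(\sigma_{W_{(n)}}^{-1}n^{1/2}(T_n-\mu(\alpha_n,1-\beta_n))\le x\bigr)$. Let $a_1=\liminf\alpha_n$,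 $a_2=\limsup\alpha_n$, $b_1=\liminf(1-\beta_n)$, $b_2=\limsup(1-\beta_n)$. Standing assumptions: $a_2<b_1$ and $\liminf_{n\to\infty}\sigma_{W_{(n)}}>0$. Condition $[A_1]$ (in the present case $a_1=a_2=0$, $b_1=b_2=1$): there exist two open sets $U_a,U_b\subset(0,1)$ and $0<\varepsilon<1$ such that $U_a\supset(0,\varepsilon)$, $U_b\supset(1-\varepsilon,1)$ and $F^{-1}$ is differentiable in $U=U_a\cup U_b$, i.e. the density $f=F'$ exists and is positive in $F^{-1}(U)$. For a real-valued function $h$ on $F^{-1}(U)$ and $0<B<\infty$ put $\Psi_{\alpha_n,h}(B)=\sup_{|t|\le B}\bigl|h\bigl(F^{-1}(\alpha_n+t\sqrt{\alpha_n\ln k_n/n})\bigr)-h\bigl(F^{-1}(\alpha_n)\bigr)\bigr|$, $\Psi_{1-\beta_n,h}(B)=\sup_{|t|\le B}\bigl|h\bigl(F^{-1}(1-\beta_n+t\sqrt{\beta_n\ln m_n/n})\bigr)-h\bigl(F^{-1}(1-\beta_n)\bigr)\bigr|$; $\Psi_{\cdot,1/f}$ corresponds to $h(x)=1/f(x)$. These quantities are well defined for all sufficiently large $n$. *)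

theory Defs
  imports "HOL-Probability.Probability" "HOL-Library.Landau_Symbols"
begin

definition order_stat :: "(nat \<Rightarrow> 'a \<Rightarrow> real) \<Rightarrow> nat \<Rightarrow> nat \<Rightarrow> 'a \<Rightarrow> real" where
  "order_stat X n i \<omega> = sort (map (\<lambda>j. X j \<omega>) [1..<Suc n]) ! (i - 1)"

definition trimmed_sum :: "(nat \<Rightarrow> 'a \<Rightarrow> real) \<Rightarrow> nat \<Rightarrow> nat \<Rightarrow> nat \<Rightarrow> 'a \<Rightarrow> real" where
  "trimmed_sum X n k m \<omega> = 1 / real n * (\<Sum>i = k + 1..n - m. order_stat X n i \<omega>)"

text \<open>The left-continuous inverse. It is real-valued, so its value carries no information at 1 if
  the support is unbounded above, nor at 0 if the support is unbounded below, nor outside [0, 1].\<close>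

definition quantile :: "(real \<Rightarrow> real) \<Rightarrow> real \<Rightarrow> real" where
  "quantile F u =
     (if u = 0 then Lim (at_right 0) (\<lambda>v. Inf {x. v \<le> F x}) else Inf {x. u \<le> F x})"

definition trimmed_mean :: "(real \<Rightarrow> real) \<Rightarrow> real \<Rightarrow> real \<Rightarrow> real" where
  "trimmed_mean F u w = (LINT s:{u..w}|lborel. quantile F s)"

text \<open>The Lebesgue--Stieltjes measure of the quantile function on (0, 1). As the integrator is
  left-continuous, its increments are the masses of the intervals closed on the left and open on
  the right. The library's \<open>interval_measure\<close> is not applicable: it requires a right-continuous
  integrator that is finite on the whole line.\<close>

definition quantile_measure :: "(real \<Rightarrow> real) \<Rightarrow> real measure" where
  "quantile_measure F =
     extend_measure {0<..<1} {(a, b). 0 < a \<and> a \<le> b \<and> b < 1} (\<lambda>(a, b). {a..<b})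
       (\<lambda>(a, b). ennreal (quantile F b - quantile F a))"

text \<open>The integral of \<open>min s t - s t\<close> against the square of that measure, for arguments between
  \<open>u\<close> and \<open>w\<close>. The integrand is nonnegative, and the value may be infinite.\<close>

definition sigma2 :: "(real \<Rightarrow> real) \<Rightarrow> real \<Rightarrow> real \<Rightarrow> ennreal" where
  "sigma2 F u w =
     (\<integral>\<^sup>+s\<in>{u..<w}. (\<integral>\<^sup>+t\<in>{u..<w}. ennreal (min s t - s * t) \<partial>quantile_measure F)
       \<partial>quantile_measure F)"

text \<open>Below, \<open>a\<close> and \<open>b\<close> are the lower and upper quantile levels of the Winsorization.\<close>

definition winsor_quantile :: "(real \<Rightarrow> real) \<Rightarrow> real \<Rightarrow> real \<Rightarrow> real \<Rightarrow> real" where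
  "winsor_quantile F a b u = max (quantile F a) (min (quantile F u) (quantile F b))"

definition winsor_mean :: "(real \<Rightarrow> real) \<Rightarrow> real \<Rightarrow> real \<Rightarrow> real" where
  "winsor_mean F a b = (LINT u:{0..1}|lborel. winsor_quantile F a b u)"

definition winsor_var :: "(real \<Rightarrow> real) \<Rightarrow> real \<Rightarrow> real \<Rightarrow> real" where
  "winsor_var F a b = (LINT u:{0..1}|lborel. (winsor_quantile F a b u - winsor_mean F a b)\<^sup>2)"

definition winsor_sd :: "(real \<Rightarrow> real) \<Rightarrow> real \<Rightarrow> real \<Rightarrow> real" where
  "winsor_sd F a b = sqrt (winsor_var F a b)"

definition trimmed_cdf ::
    "'a measure \<Rightarrow> (nat \<Rightarrow> 'a \<Rightarrow> real) \<Rightarrow> (real \<Rightarrow> real) \<Rightarrow> nat \<Rightarrow> nat \<Rightarrow> nat \<Rightarrow> real \<Rightarrow> real" where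
  "trimmed_cdf M X F n k m x =
     (let a = real k / real n; b = 1 - real m / real n in
      measure M {\<omega> \<in> space M.
        inverse (winsor_sd F a b) * sqrt (real n) * (trimmed_sum X n k m \<omega> - trimmed_mean F a b)
          \<le> x})"

definition smooth_tails :: "(real \<Rightarrow> real) \<Rightarrow> bool" where
  "smooth_tails F \<longleftrightarrow>
     (\<exists>Ua Ub \<epsilon>. open Ua \<and> open Ub \<and> Ua \<subseteq> {0<..<1} \<and> Ub \<subseteq> {0<..<1} \<and> 0 < \<epsilon> \<and> \<epsilon> < 1 \<and>
        {0<..<\<epsilon>} \<subseteq> Ua \<and> {1 - \<epsilon><..<1} \<subseteq> Ub \<and>
        (\<forall>u\<in>Ua \<union> Ub. quantile F differentiable at u) \<and>
        (\<forall>x\<in>quantile F ` (Ua \<union> Ub). F differentiable at x \<and> 0 < deriv F x))"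

text \<open>The supremum is taken in the extended reals, since it may be infinite. Here \<open>p\<close> is the
  quantile level and \<open>d\<close> the unit in which deviations from it are measured.\<close>

definition Psi :: "(real \<Rightarrow> real) \<Rightarrow> (real \<Rightarrow> real) \<Rightarrow> real \<Rightarrow> real \<Rightarrow> real \<Rightarrow> ereal" where
  "Psi F h p d B =
     (SUP t\<in>{t. \<bar>t\<bar> \<le> B}. ereal \<bar>h (quantile F (p + t * d)) - h (quantile F p)\<bar>)"

text \<open>The relation \<open>o\<close> for an extended-real sequence compared with a real one.\<close>

definition ereal_smallo :: "(nat \<Rightarrow> ereal) \<Rightarrow> (nat \<Rightarrow> real) \<Rightarrow> bool" where
  "ereal_smallo a g \<longleftrightarrow> (\<forall>c>0. \<forall>\<^sub>F n in sequentially. \<bar>a n\<bar> \<le> ereal (c * \<bar>g n\<bar>))"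

lemma quantile_le_iff:
  assumes "real_distribution N" and "0 < u" "u < 1"
  shows "quantile (cdf N) u \<le> x \<longleftrightarrow> u \<le> cdf N x"
proof -
  interpret cdf_distribution N
    using assms(1) by (simp add: cdf_distribution_def)
  show ?thesis
    using pseudoinverse[of u x] assms(2,3) by (simp add: quantile_def)
qed

lemma space_quantile_measure: "space (quantile_measure F) = {0<..<1}"
  unfolding quantile_measure_def by (rule space_extend_measure) auto

lemma sets_quantile_measure:
  "sets (quantile_measure F) = sets (restrict_space borel {0<..<1})"
proof -
  define G :: "real set set" where
    "G = (\<lambda>(a, b). {a..<b}) ` {(a, b). 0 < a \<and> a \<le> b \<and> b < (1::real)}"
  have G: "{a..<b} \<in> G" if "0 < a" "a \<le> b" "b < 1" for a b :: real
    unfolding G_def using that by (auto intro!: image_eqI[of _ _ "(a, b)"])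
  have sub: "G \<subseteq> Pow {0<..<1}"
    by (auto simp: G_def)
  interpret S: sigma_algebra "{0<..<1}" "sigma_sets {0<..<1} G"
    using sub by (rule sigma_algebra_sigma_sets)
  have sets_eq: "sets (quantile_measure F) = sigma_sets {0<..<1} G"
    unfolding quantile_measure_def G_def by (rule sets_extend_measure) auto
  have meas: "(\<lambda>x. x) \<in> borel_measurable (sigma {0<..<1} G)"
  proof (rule borel_measurableI_less)
    fix y :: real
    have "{x \<in> {0<..<1}. x < y} \<in> sigma_sets {0<..<1} G"
    proof -
      have L_eq: "{x \<in> {0<..<1}. x < y}
          = (\<Union>n. \<Union>m. (let a = 1 / real (Suc n); b = min y (1 - 1 / real (Suc m))
                        in if a \<le> b then {a..<b} else {}))" (is "?L = ?R")
      proof (intro equalityI subsetI)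
        fix x assume x: "x \<in> ?L"
        then obtain n where n: "inverse (real (Suc n)) < x"
          using reals_Archimedean[of x] by auto
        from x obtain m where m: "inverse (real (Suc m)) < 1 - x"
          using reals_Archimedean[of "1 - x"] by auto
        have "x \<in> (let a = 1 / real (Suc n); b = min y (1 - 1 / real (Suc m))
                        in if a \<le> b then {a..<b} else {})"
          using x n m by (auto simp: Let_def inverse_eq_divide)
        then show "x \<in> ?R" by blast
      next
        fix x assume "x \<in> ?R"
        then obtain n m where *: "1 / real (Suc n) \<le> x" "x < min y (1 - 1 / real (Suc m))"
          by (auto simp: Let_def split: if_splits)
        have "0 < 1 / real (Suc n)" "0 < 1 / real (Suc m)" by simp_all
        with * have "0 < x" "x < y" "x < 1" by linarith+
        then show "x \<in> ?L" by simp
      qed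
      have "(let a = 1 / real (Suc n); b = min y (1 - 1 / real (Suc m))
                        in if a \<le> b then {a..<b} else {}) \<in> sigma_sets {0<..<1} G" for n m
      proof -
        have "{a..<min y b} \<in> sigma_sets {0<..<1} G" if "a \<le> min y b" "0 < a" "b < 1" for a b
          using that by (intro sigma_sets.Basic G) auto
        then show ?thesis by (auto simp: Let_def sigma_sets.Empty)
      qed
      then have "?R \<in> sigma_sets {0<..<1} G"
        by (intro S.countable_UN image_subsetI) auto
      then show ?thesis by (simp only: L_eq)
    qed
    then show "{x \<in> space (sigma {0<..<1} G). x < y} \<in> sets (sigma {0<..<1} G)"
      using sub by simp
  qed
  show ?thesis
  proof (intro equalityI subsetI)
    fix A assume "A \<in> sets (quantile_measure F)"
    then have "A \<in> sigma_sets {0<..<1} G" by (simp add: sets_eq)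
    moreover have "sigma_sets {0<..<1} G \<subseteq> sets (restrict_space borel {0<..<1})"
      by (rule sets.sigma_sets_subset') (auto simp: G_def sets_restrict_space_iff)
    ultimately show "A \<in> sets (restrict_space borel {0<..<1})" by blast
  next
    fix A :: "real set" assume "A \<in> sets (restrict_space borel {0<..<1})"
    then have A: "A \<in> sets borel" "A \<subseteq> {0<..<1}"
      by (auto simp: sets_restrict_space_iff)
    have "(\<lambda>x. x) -` A \<inter> space (sigma {0<..<1} G) \<in> sets (sigma {0<..<1} G)"
      using meas A(1) by (rule measurable_sets)
    moreover have "(\<lambda>x. x) -` A \<inter> space (sigma {0<..<1} G) = A"
      using A sub by auto
    ultimately show "A \<in> sets (quantile_measure F)"
      using sub by (simp add: sets_eq)
  qed
qed

lemma emeasure_quantile_measure: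
  assumes N: "real_distribution N" and "0 < a" "a \<le> b" "b < 1"
  shows "emeasure (quantile_measure (cdf N)) {a..<b}
           = ennreal (quantile (cdf N) b - quantile (cdf N) a)"
proof -
  interpret cdf_distribution N
    using N by (simp add: cdf_distribution_def)
  let ?D = "distr lborel borel (cdf N)"
  have sub: "sets (quantile_measure (cdf N)) \<subseteq> sets ?D"
    unfolding sets_quantile_measure by (auto simp: sets_restrict_space_iff)
  have eq: "emeasure ?D {a..<b} = ennreal (quantile (cdf N) b - quantile (cdf N) a)"
    if "0 < a" "a \<le> b" "b < 1" for a b
  proof -
    have le: "quantile (cdf N) u \<le> x \<longleftrightarrow> u \<le> cdf N x" if "0 < u" "u < 1" for u x
      using quantile_le_iff[OF N that] .
    have "cdf N -` {a..<b} = {quantile (cdf N) a..<quantile (cdf N) b}"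
      using that le[of a] le[of b] by (auto simp: not_le[symmetric])
    moreover have "quantile (cdf N) a \<le> quantile (cdf N) b"
      using that le[of a] le[of b "quantile (cdf N) b"] by auto
    ultimately show ?thesis
      by (simp add: emeasure_distr)
  qed
  have pos: "positive (sets (quantile_measure (cdf N))) (emeasure ?D)"
    by (simp add: positive_def)
  have ca: "countably_additive (sets (quantile_measure (cdf N))) (emeasure ?D)"
    using sub emeasure_countably_additive[of ?D] unfolding countably_additive_def by blast
  show ?thesis
    by (rule emeasure_extend_measure_Pair[OF quantile_measure_def _ _ pos ca])
       (use eq assms in auto)
qed

end

theory Submission
  imports Defs "HOL-Real_Asymp.Real_Asymp"
begin

text \<open>Replacing every observation by its Winsorized value turns the trimmed sum into a normalised sum
  \<open>W\<close> of independent variables bounded by a multiple of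
  \<open>(\<bar>\<xi>\<^bsub>\<alpha>\<^esub>\<bar> + \<bar>\<xi>\<^bsub>1-\<beta>\<^esub>\<bar>) / \<surd>n\<close>. Finiteness of \<open>\<sigma>\<^sup>2\<close> gives
  \<open>\<xi>\<^bsub>\<alpha>\<^esub> = o(\<alpha>\<^sup>-\<^sup>1\<^sup>/\<^sup>2)\<close>, so this bound is \<open>o(1 / \<surd>k + 1 / \<surd>m)\<close>, and Stein's method
  gives the normal approximation of \<open>W\<close> at this rate.

  The error made on the lower side is at most \<open>\<bar>N - k\<bar>\<close> times the distance from
  \<open>\<xi>\<^bsub>\<alpha>\<^esub>\<close> to the order statistics of rank between \<open>N\<close> and \<open>k\<close>, where \<open>N\<close> counts the
  observations up to \<open>\<xi>\<^bsub>\<alpha>\<^esub>\<close>. Off an event of probability \<open>O(1 / k)\<close>, this distance is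
  \<open>O((\<bar>N - k\<bar> + ln k) / (n f(\<xi>\<^bsub>\<alpha>\<^esub>)))\<close>: the oscillation condition makes \<open>1 / f\<close>
  comparable to its value at \<open>\<xi>\<^bsub>\<alpha>\<^esub>\<close>, and Chernoff bounds show that the interval of that length
  contains \<open>\<bar>N - k\<bar>\<close> observations. Hence the standardised error is at most
  \<open>\<epsilon> (A\<^sup>2 + 1)\<close> with \<open>A = (N - k) / \<surd>k\<close> and
  \<open>\<epsilon> = O(\<bar>\<xi>\<^bsub>\<alpha>\<^esub>\<bar> / \<surd>n) = o(1 / \<surd>k)\<close>. Bounding it
  by \<open>\<epsilon> ln k\<close> would lose a logarithm. Instead a randomized concentration inequality shows
  that \<open>W\<close> is within this random distance of a given point with probability
  \<open>O(\<epsilon>)\<close> only, apart from terms of the order of the bound on the summands.\<close>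

section \<open>Stein's equation for the normal distribution\<close>

text \<open>\<open>W\<close> and the random distance are functions of the same observations, so
  neither can be treated as fixed given the other. The concentration inequality therefore admits a
  width \<open>D\<close> depending on everything, provided that for each \<open>i\<close> there is a
  copy \<open>D' i\<close> free of observation \<open>i\<close>; the price is the sum of the means
  of \<open>\<bar>g i\<bar> * \<bar>D - D' i\<bar>\<close>. For a width quadratic in a sum of
  independent terms this price is bounded by moments, which is why the error is brought into the
  form \<open>\<epsilon> * (A\<^sup>2 + 1)\<close>. The logarithm in the distance is absorbed on the
  way: \<open>4 * ln k \<le> sqrt k\<close> eventually, so the product of
  \<open>\<bar>N - k\<bar>\<close> and \<open>\<bar>N - k\<bar> + 4 * ln k\<close> is at most
  \<open>2 * k * (A\<^sup>2 + 1)\<close>.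

  The rate comes from the identity \<open>\<bar>\<xi>\<bar> / sqrt n = (sqrt \<alpha> *
  \<bar>\<xi>\<bar>) / sqrt k\<close>, valid because \<open>\<alpha> = k / n\<close>: its first
  factor tends to 0, so every term of size \<open>\<bar>\<xi>\<bar> / sqrt n\<close> is
  \<open>o(1 / sqrt k)\<close>, and so is the exceptional probability \<open>4 / k\<close>. The
  upper tail is handled in the same way. The numerical constants are convenient, not
  optimal.\<close>

abbreviation normal_cdf :: "real \<Rightarrow> real" (\<open>\<Phi>\<close>) where
  "\<Phi> \<equiv> cdf std_normal_distribution"

section \<open>Distribution function and tails of the standard normal law\<close>

lemma cdf_std_normal_diff:
  assumes "a \<le> x"
  shows "\<Phi> x
    = \<Phi> a + integral {a..x} std_normal_density"
proof -
  interpret N: real_distribution std_normal_distribution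
    by (rule real_dist_normal_dist)
  have 1: "\<Phi> x - \<Phi> a
      = measure std_normal_distribution {a<..x}" if "a < x"
    using N.cdf_diff_eq[OF that] .
  have "integrable lborel std_normal_density"
    by (rule integrable_normal_density) simp
  then have si: "set_integrable lborel {a..x} std_normal_density"
    unfolding set_integrable_def by (intro integrable_mult_indicator) auto
  have "emeasure std_normal_distribution {a<..x}
      = (\<integral>\<^sup>+y\<in>{a<..x}. ennreal (std_normal_density y) \<partial>lborel)"
    by (intro emeasure_density) auto
  also have "\<dots> = (\<integral>\<^sup>+y\<in>{a..x}. ennreal (std_normal_density y) \<partial>lborel)"
    using AE_lborel_singleton[of a]
    by (intro nn_integral_cong_AE) (auto split: split_indicator)
  also have "\<dots> = ennreal (LINT y:{a..x}|lborel. std_normal_density y)"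
    using \<open>integrable lborel std_normal_density\<close>
    by (intro nn_set_integral_eq_set_integral) auto
  also have "(LINT y:{a..x}|lborel. std_normal_density y) = integral {a..x} std_normal_density"
    by (rule set_borel_integral_eq_integral(2)[OF si])
  finally have "measure std_normal_distribution {a<..x} = integral {a..x} std_normal_density"
    by (simp add: measure_def integral_nonneg set_borel_integral_eq_integral(1)[OF si])
  then show ?thesis using 1 assms by (cases "a = x") auto
qed

lemma cdf_std_normal_deriv:
  "(\<Phi> has_real_derivative std_normal_density x) (at x)"
proof -
  have "((\<lambda>u. integral {x - 1..u} std_normal_density) has_real_derivative std_normal_density x)
     (at x within {x - 1..x + 1})"
    by (rule integral_has_real_derivative)
       (auto simp: normal_density_def intro!: continuous_intros)
  then have "((\<lambda>u. \<Phi> (x - 1) + integral {x - 1..u} std_normal_density)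
      has_real_derivative std_normal_density x) (at x within {x - 1..x + 1})"
    by (auto intro!: derivative_eq_intros)
  then have "(\<Phi> has_real_derivative std_normal_density x)
      (at x within {x - 1..x + 1})"
    by (rule has_field_derivative_transform_within[where d = 1])
       (auto intro!: cdf_std_normal_diff[symmetric])
  moreover have "at x within {x - 1..x + 1} = at x"
    by (rule at_within_interior) (simp add: interior_atLeastAtMost_real)
  ultimately show ?thesis by simp
qed

lemma std_normal_density_deriv:
  "(std_normal_density has_real_derivative (- x * std_normal_density x)) (at x)"
  unfolding normal_density_def
  by (auto intro!: derivative_eq_intros simp: field_simps)

lemma cdf_std_normal_minus: "\<Phi> (- x) = 1 - \<Phi> x"
proof -
  interpret N: real_distribution std_normal_distribution
    by (rule real_dist_normal_dist)
  let ?g = "\<lambda>x. \<Phi> x + \<Phi> (- x)"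
  have "(?g has_real_derivative 0) (at x)" for x
    by (rule derivative_eq_intros cdf_std_normal_deriv
        DERIV_chain2[where g = uminus, OF cdf_std_normal_deriv] refl |
        simp add: normal_density_def)+
  then have const: "?g y = ?g x" for y
    by (rule DERIV_isconst_all[rule_format])
  have "(?g \<longlongrightarrow> 1 + 0) at_top"
    by (intro tendsto_intros N.cdf_lim_at_top_prob
        filterlim_compose[OF N.cdf_lim_at_bot filterlim_uminus_at_bot_at_top])
  moreover have "?g = (\<lambda>_. ?g x)" using const by auto
  ultimately have "((\<lambda>_. ?g x) \<longlongrightarrow> 1) (at_top :: real filter)" by simp
  then have "?g x = 1" by (simp add: tendsto_const_iff)
  then show ?thesis by simp
qed

text \<open>The difference \<open>h\<close> of the two sides, divided by \<open>w\<close>, has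
  derivative \<open>std_normal_density x / x\<^sup>2 > 0\<close> and limit 0 at infinity, hence it
  is nonpositive.\<close>

lemma std_normal_mills:
  assumes "0 < w"
  shows "w * (1 - \<Phi> w) \<le> std_normal_density w"
proof -
  interpret N: real_distribution std_normal_distribution
    by (rule real_dist_normal_dist)
  define h where "h w = 1 - \<Phi> w - std_normal_density w / w" for w
  have der: "(h has_real_derivative std_normal_density x / x\<^sup>2) (at x)" if "0 < x" for x
    unfolding h_def using that
    by (auto intro!: derivative_eq_intros cdf_std_normal_deriv std_normal_density_deriv
        simp: field_simps power2_eq_square)
  have mono: "h x \<le> h y" if "0 < x" "x \<le> y" for x y
    by (rule DERIV_nonneg_imp_nondecreasing[OF that(2)], rule exI, rule conjI[OF der])
       (use that in auto)
  have "(h \<longlongrightarrow> 1 - 1 - 0) at_top"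
    unfolding h_def
  proof (intro tendsto_diff tendsto_const N.cdf_lim_at_top_prob)
    show "((\<lambda>w. std_normal_density w / w) \<longlongrightarrow> 0) at_top"
      unfolding normal_density_def by real_asymp
  qed
  then have "h w \<le> 0"
    by (intro tendsto_lowerbound[of h 0 at_top])
       (auto intro!: eventually_mono[OF eventually_ge_at_top[of w]] mono assms)
  then show ?thesis using assms by (simp add: h_def field_simps)
qed

lemma std_normal_tail_le:
  assumes "0 \<le> w"
  shows "1 - \<Phi> w \<le> 5 * std_normal_density w"
proof -
  interpret N: real_distribution std_normal_distribution
    by (rule real_dist_normal_dist)
  have nn: "std_normal_density w \<ge> 0" "0 \<le> \<Phi> w"
    "\<Phi> w \<le> 1"
    by (simp_all add: N.cdf_nonneg N.cdf_bounded_prob)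
  show ?thesis
  proof (cases "w \<le> 1")
    case True
    have "exp (-(w\<^sup>2)/2) \<ge> exp (-1/2)"
      using True assms by (simp add: power_le_one)
    moreover have "exp (1 / 2) \<le> (7 / 4 :: real)"
      using exp_bound[of "1 / 2"] by (simp add: power2_eq_square)
    then have "exp (-1/2) \<ge> (4 / 7 :: real)" by (simp add: exp_minus field_simps)
    moreover have "sqrt (2 * pi) \<le> 13 / 5"
      by (rule real_le_lsqrt) (use pi_less_4 pi_approx in \<open>auto simp: power2_eq_square\<close>)
    ultimately have "5 * exp (-(w\<^sup>2)/2) \<ge> sqrt (2 * pi)" by linarith
    then have "5 * std_normal_density w \<ge> 1"
      by (simp add: normal_density_def field_simps)
    then show ?thesis using nn by linarith
  next
    case False
    have "1 * (1 - \<Phi> w) \<le> w * (1 - \<Phi> w)"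
      using False nn by (intro mult_right_mono) auto
    also have "\<dots> \<le> std_normal_density w" using False by (intro std_normal_mills) auto
    finally have "1 - \<Phi> w \<le> std_normal_density w" by simp
    also have "\<dots> \<le> 5 * std_normal_density w" using nn(1) by linarith
    finally show ?thesis .
  qed
qed

text \<open>The bounded solution \<open>g\<close> of Stein's equation \<open>g' w - w * g w = indicator {..z} w - \<Phi> z\<close>.\<close>

definition stein_sol :: "real \<Rightarrow> real \<Rightarrow> real" where
  "stein_sol z w =
     (if w \<le> z then \<Phi> w * (1 - \<Phi> z)
      else \<Phi> z * (1 - \<Phi> w))
     / std_normal_density w"

text \<open>Defined by Stein's equation itself rather than as a derivative: the equation then holds
  at every point, also at the kink \<open>w = z\<close>, where this is the left derivative of
  \<open>stein_sol z\<close>.\<close>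

definition stein_deriv :: "real \<Rightarrow> real \<Rightarrow> real" where
  "stein_deriv z w = w * stein_sol z w + indicator {..z} w - \<Phi> z"

text \<open>Multiplied by the density, both branches are at most
  \<open>min (\<Phi> w) (1 - \<Phi> w)\<close>, which by symmetry is at most
  \<open>1 - \<Phi> \<bar>w\<bar>\<close>. The two normal tail bounds at
  \<open>\<bar>w\<bar>\<close> then give estimates uniform in \<open>z\<close>.\<close>

lemma stein_sol_nonneg: "0 \<le> stein_sol z w"
  and stein_sol_le: "stein_sol z w \<le> 5"
  and abs_mult_stein_sol_le: "\<bar>w * stein_sol z w\<bar> \<le> 1"
proof -
  interpret N: real_distribution std_normal_distribution
    by (rule real_dist_normal_dist)
  let ?P = "\<Phi>"
  have nn: "0 \<le> ?P x" "?P x \<le> 1" for x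
    by (simp_all add: N.cdf_nonneg N.cdf_bounded_prob)
  have mono: "x \<le> y \<Longrightarrow> ?P x \<le> ?P y" for x y
    by (rule N.cdf_nondecreasing)
  have pos: "std_normal_density w > 0" by (rule normal_density_pos) simp
  show nonneg: "0 \<le> stein_sol z w"
    unfolding stein_sol_def using nn by auto
  have bd: "stein_sol z w * std_normal_density w \<le> min (?P w) (1 - ?P w)"
  proof (cases "w \<le> z")
    case True
    then have "?P w * (1 - ?P z) \<le> 1 * (1 - ?P w)" "?P w * (1 - ?P z) \<le> ?P w * 1"
      using mono[of w z] nn by (intro mult_mono; simp)+
    with True show ?thesis using pos by (simp add: stein_sol_def)
  next
    case False
    then have "?P z * (1 - ?P w) \<le> 1 * (1 - ?P w)" "?P z * (1 - ?P w) \<le> ?P w * 1"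
      using mono[of z w] nn by (intro mult_mono; simp)+
    with False show ?thesis using pos by (simp add: stein_sol_def)
  qed
  have eq: "min (?P w) (1 - ?P w) \<le> 1 - ?P \<bar>w\<bar>"
    using cdf_std_normal_minus[of w] by (auto simp: abs_if min_def)
  have sym: "std_normal_density \<bar>w\<bar> = std_normal_density w"
    by (simp add: normal_density_def)
  have "stein_sol z w * std_normal_density w \<le> 5 * std_normal_density w"
    using std_normal_tail_le[OF abs_ge_zero, of w, unfolded sym] bd eq by linarith
  then show "stein_sol z w \<le> 5" using pos by simp
  have "\<bar>w\<bar> * stein_sol z w * std_normal_density w \<le> 1 * std_normal_density w"
  proof (cases "w = 0")
    case False
    have "\<bar>w\<bar> * (stein_sol z w * std_normal_density w) \<le> \<bar>w\<bar> * (1 - ?P \<bar>w\<bar>)"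
      using bd eq by (intro mult_left_mono) auto
    also have "\<dots> \<le> std_normal_density w"
      using std_normal_mills[of "\<bar>w\<bar>"] False sym by simp
    finally show ?thesis by (simp add: mult.assoc)
  qed simp
  then show "\<bar>w * stein_sol z w\<bar> \<le> 1"
    using pos nonneg by (simp add: abs_mult)
qed

lemma abs_stein_deriv_le: "\<bar>stein_deriv z w\<bar> \<le> 2"
proof -
  interpret N: real_distribution std_normal_distribution
    by (rule real_dist_normal_dist)
  have "0 \<le> \<Phi> z" "\<Phi> z \<le> 1"
    by (simp_all add: N.cdf_nonneg N.cdf_bounded_prob)
  then show ?thesis using abs_mult_stein_sol_le[of w z]
    by (auto simp: stein_deriv_def indicator_def)
qed

lemma stein_sol_deriv:
  assumes "w \<noteq> z"
  shows "(stein_sol z has_real_derivative stein_deriv z w) (at w)"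
proof -
  have nz: "std_normal_density w \<noteq> 0" using normal_density_pos[of 1 0 w] by simp
  show ?thesis
  proof (cases "w < z")
    case True
    have "((\<lambda>w. \<Phi> w * (1 - \<Phi> z)
        / std_normal_density w) has_real_derivative stein_deriv z w) (at w)"
    proof (rule DERIV_cong[OF DERIV_divide])
      show "((\<lambda>w. \<Phi> w * (1 - \<Phi> z)) has_real_derivative
          std_normal_density w * (1 - \<Phi> z)) (at w)"
        by (auto intro!: derivative_eq_intros cdf_std_normal_deriv)
      show "(std_normal_density w * (1 - \<Phi> z) * std_normal_density w - \<Phi> w * (1 - \<Phi> z) * (- w * std_normal_density w))
          / (std_normal_density w * std_normal_density w) = stein_deriv z w"
        using True nz by (simp add: stein_deriv_def stein_sol_def field_simps)
    qed (use nz std_normal_density_deriv in auto)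
    then show ?thesis
      by (rule has_field_derivative_transform_within_open[where S = "{..<z}"])
         (use True in \<open>auto simp: stein_sol_def\<close>)
  next
    case False
    with assms have gr: "z < w" by simp
    have "((\<lambda>w. \<Phi> z * (1 - \<Phi> w)
        / std_normal_density w) has_real_derivative stein_deriv z w) (at w)"
    proof (rule DERIV_cong[OF DERIV_divide])
      show "((\<lambda>w. \<Phi> z * (1 - \<Phi> w)) has_real_derivative
          - (\<Phi> z * std_normal_density w)) (at w)"
        by (auto intro!: derivative_eq_intros cdf_std_normal_deriv)
      show "(- (\<Phi> z * std_normal_density w) * std_normal_density w - \<Phi> z * (1 - \<Phi> w) * (- w * std_normal_density w))
          / (std_normal_density w * std_normal_density w) = stein_deriv z w"
        using gr nz by (simp add: stein_deriv_def stein_sol_def field_simps)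
    qed (use nz std_normal_density_deriv in auto)
    then show ?thesis
      by (rule has_field_derivative_transform_within_open[where S = "{z<..}"])
         (use gr in \<open>auto simp: stein_sol_def\<close>)
  qed
qed

lemma continuous_on_stein_sol: "continuous_on A (stein_sol z)"
proof -
  have cont: "continuous_on B (\<Phi>)" for B
    by (rule DERIV_continuous_on, rule DERIV_subset[OF cdf_std_normal_deriv]) auto
  \<comment> \<open>One formula in \<open>min w z\<close> and \<open>max w z\<close> covers both
    branches, so continuity at \<open>z\<close> needs no gluing.\<close>
  have eq: "stein_sol z = (\<lambda>w. \<Phi> (min w z)
      * (1 - \<Phi> (max w z)) / std_normal_density w)"
    by (auto simp: stein_sol_def fun_eq_iff min_def max_def)
  show ?thesis
    unfolding eq
  proof (intro continuous_on_divide continuous_on_mult continuous_on_diff continuous_on_const)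
    show "continuous_on A (\<lambda>w. \<Phi> (min w z))"
      by (rule continuous_on_compose2[OF cont[of UNIV]]) (auto intro!: continuous_intros)
    show "continuous_on A (\<lambda>w. \<Phi> (max w z))"
      by (rule continuous_on_compose2[OF cont[of UNIV]]) (auto intro!: continuous_intros)
    show "continuous_on A std_normal_density"
      by (rule DERIV_continuous_on, rule DERIV_subset[OF std_normal_density_deriv]) auto
    show "\<forall>w\<in>A. std_normal_density w \<noteq> 0"
      using normal_density_pos[of 1 0] by (metis less_irrefl zero_less_one)
  qed
qed

lemma borel_measurable_stein_sol [measurable]: "stein_sol z \<in> borel_measurable borel"
  using continuous_on_stein_sol by (rule borel_measurable_continuous_onI)

lemma borel_measurable_stein_deriv [measurable]: "stein_deriv z \<in> borel_measurable borel"
  unfolding stein_deriv_def[abs_def] by measurable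

text \<open>The kink may be an endpoint, since the mean value theorem asks for differentiability in
  the interior only. Longer steps can therefore be cut at \<open>z\<close>.\<close>

lemma stein_sol_mvt:
  assumes "x < y" and "z \<notin> {x<..<y}"
  obtains c where "x < c" "c < y" "stein_sol z y - stein_sol z x = (y - x) * stein_deriv z c"
proof -
  have "\<exists>l c. x < c \<and> c < y \<and> DERIV (stein_sol z) c :> l \<and>
      stein_sol z y - stein_sol z x = (y - x) * l"
    using assms
    by (intro MVT continuous_on_stein_sol) (auto simp: real_differentiable_def intro!: stein_sol_deriv exI)
  then obtain l c where c: "x < c" "c < y" "DERIV (stein_sol z) c :> l"
      "stein_sol z y - stein_sol z x = (y - x) * l" by blast
  with assms have "c \<noteq> z" by auto
  then have "l = stein_deriv z c" using c(3) stein_sol_deriv DERIV_unique by blast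
  with c that show ?thesis by blast
qed

lemma stein_sol_lipschitz: "\<bar>stein_sol z y - stein_sol z x\<bar> \<le> 2 * \<bar>y - x\<bar>"
proof -
  have 1: "\<bar>stein_sol z y - stein_sol z x\<bar> \<le> 2 * \<bar>y - x\<bar>" if "x < y" "z \<notin> {x<..<y}" for x y
  proof -
    from stein_sol_mvt[OF that] obtain c where
      "stein_sol z y - stein_sol z x = (y - x) * stein_deriv z c" .
    then have "\<bar>stein_sol z y - stein_sol z x\<bar> = \<bar>y - x\<bar> * \<bar>stein_deriv z c\<bar>"
      by (simp add: abs_mult)
    also have "\<dots> \<le> \<bar>y - x\<bar> * 2" by (intro mult_left_mono abs_stein_deriv_le) auto
    finally show ?thesis by simp
  qed
  have 2: "\<bar>stein_sol z y - stein_sol z x\<bar> \<le> 2 * \<bar>y - x\<bar>" if "x < y" for x y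
    using 1[of x y] 1[of x z] 1[of z y] that by (cases "z \<in> {x<..<y}") auto
  show ?thesis using 2[of x y] 2[of y x] by (cases x y rule: linorder_cases) auto
qed

text \<open>Taylor expansion with a step across \<open>z\<close> charged to the indicator.\<close>

lemma stein_sol_expansion:
  assumes "\<bar>e\<bar> \<le> \<delta>"
  shows "\<bar>e\<^sup>2 * stein_deriv z w - e * (stein_sol z w - stein_sol z (w - e))\<bar>
    \<le> e\<^sup>2 * (4 * indicator {w. \<bar>w - z\<bar> \<le> \<delta>} w + \<delta> * (5 + 2 * \<bar>w\<bar>))"
proof (cases "\<bar>w - z\<bar> \<le> \<delta>")
  case True
  have "\<bar>e * (stein_sol z w - stein_sol z (w - e))\<bar> \<le> \<bar>e\<bar> * (2 * \<bar>e\<bar>)"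
    using stein_sol_lipschitz[of z w "w - e"] by (simp add: abs_mult mult_left_mono)
  moreover have "\<bar>e\<^sup>2 * stein_deriv z w\<bar> \<le> e\<^sup>2 * 2"
    using abs_stein_deriv_le[of z w] by (simp add: abs_mult mult_left_mono)
  moreover have "0 \<le> e\<^sup>2 * (\<delta> * (5 + 2 * \<bar>w\<bar>))" using assms by auto
  moreover have "\<bar>e\<bar> * (2 * \<bar>e\<bar>) = e\<^sup>2 * 2" by (simp add: power2_eq_square)
  ultimately have "\<bar>e\<^sup>2 * stein_deriv z w - e * (stein_sol z w - stein_sol z (w - e))\<bar>
      \<le> e\<^sup>2 * 4 + e\<^sup>2 * (\<delta> * (5 + 2 * \<bar>w\<bar>))" by linarith
  then show ?thesis using True by (simp add: distrib_left)
next
  case False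
  show ?thesis
  proof (cases "e = 0")
    case e: False
    obtain c where c: "\<bar>c - w\<bar> \<le> \<delta>" "(c \<le> z) = (w \<le> z)"
      "stein_sol z w - stein_sol z (w - e) = e * stein_deriv z c"
    proof (cases "e > 0")
      case True
      obtain c where "w - e < c" "c < w"
        "stein_sol z w - stein_sol z (w - e) = (w - (w - e)) * stein_deriv z c"
        by (rule stein_sol_mvt[of "w - e" w z]) (use True False assms in auto)
      moreover from this have "(c \<le> z) = (w \<le> z)"
        using False assms by (cases "w \<le> z") auto
      ultimately show ?thesis using that[of c] False assms by auto
    next
      case neg: False
      obtain c where "w < c" "c < w - e"
        "stein_sol z (w - e) - stein_sol z w = ((w - e) - w) * stein_deriv z c"
        by (rule stein_sol_mvt[of w "w - e" z]) (use e neg False assms in auto)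
      moreover from this have "(c \<le> z) = (w \<le> z)"
        using False assms by (cases "w \<le> z") auto
      ultimately show ?thesis using that[of c] False assms by auto
    qed
    \<comment> \<open>As \<open>c\<close> and \<open>w\<close> lie on the same side of
      \<open>z\<close>, the indicators in Stein's equation cancel and only the difference of
      \<open>w * g w\<close> remains. The bound 5 on \<open>g\<close> and its Lipschitz constant 2
      give the factor \<open>5 + 2 * \<bar>w\<bar>\<close>.\<close>
    have "stein_deriv z w - stein_deriv z c
        = (w - c) * stein_sol z c + w * (stein_sol z w - stein_sol z c)"
      using c(2) by (auto simp: stein_deriv_def indicator_def algebra_simps)
    also have "\<bar>\<dots>\<bar> \<le> \<bar>w - c\<bar> * 5 + \<bar>w\<bar> * (2 * \<bar>w - c\<bar>)"
      using stein_sol_lipschitz[of z w c] stein_sol_le[of z c] stein_sol_nonneg[of z c]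
      by (intro abs_triangle_ineq[THEN order_trans] add_mono)
         (auto simp: abs_mult intro!: mult_left_mono)
    also have "\<dots> = \<bar>c - w\<bar> * (5 + 2 * \<bar>w\<bar>)" by (simp add: algebra_simps abs_minus_commute)
    also have "\<dots> \<le> \<delta> * (5 + 2 * \<bar>w\<bar>)"
      using c(1) by (intro mult_right_mono) auto
    finally have "\<bar>stein_deriv z w - stein_deriv z c\<bar> \<le> \<delta> * (5 + 2 * \<bar>w\<bar>)" .
    then have "e\<^sup>2 * \<bar>stein_deriv z w - stein_deriv z c\<bar> \<le> e\<^sup>2 * (\<delta> * (5 + 2 * \<bar>w\<bar>))"
      by (intro mult_left_mono) auto
    moreover have "e\<^sup>2 * stein_deriv z w - e * (stein_sol z w - stein_sol z (w - e))
       = e\<^sup>2 * (stein_deriv z w - stein_deriv z c)"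
      unfolding c(3) by (simp add: power2_eq_square algebra_simps)
    ultimately show ?thesis using False by (simp add: abs_mult)
  qed simp
qed

section \<open>Sums of bounded independent variables\<close>

text \<open>Boundedness is required at every point, also outside \<open>space M\<close>. The class
  is then closed under all the operations used below, and integrability of every integrand reduces
  to one structural rule.\<close>

definition bdd_meas :: "'a measure \<Rightarrow> ('a \<Rightarrow> real) \<Rightarrow> bool" where
  "bdd_meas M h \<longleftrightarrow> h \<in> borel_measurable M \<and> (\<exists>B. \<forall>x. \<bar>h x\<bar> \<le> B)"

named_theorems bdd_meas_intros

lemma bdd_measI:
  "h \<in> borel_measurable M \<Longrightarrow> (\<And>x. \<bar>h x\<bar> \<le> B) \<Longrightarrow> bdd_meas M h"
  by (auto simp: bdd_meas_def)

lemma bdd_measD [dest]: "bdd_meas M h \<Longrightarrow> h \<in> borel_measurable M"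
  by (simp add: bdd_meas_def)

lemma bdd_meas_const [bdd_meas_intros]: "bdd_meas M (\<lambda>_. c)"
  by (rule bdd_measI[of _ _ "\<bar>c\<bar>"]) auto

lemma bdd_meas_add [bdd_meas_intros]:
  assumes "bdd_meas M g" "bdd_meas M h"
  shows "bdd_meas M (\<lambda>x. g x + h x)"
proof -
  obtain A B where "\<And>x. \<bar>g x\<bar> \<le> A" "\<And>x. \<bar>h x\<bar> \<le> B"
    using assms by (auto simp: bdd_meas_def)
  with assms show ?thesis
    by (intro bdd_measI[of _ _ "A + B"] borel_measurable_add)
       (auto intro!: abs_triangle_ineq[THEN order_trans] add_mono)
qed

lemma bdd_meas_mult [bdd_meas_intros]:
  assumes "bdd_meas M g" "bdd_meas M h"
  shows "bdd_meas M (\<lambda>x. g x * h x)"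
proof -
  obtain A B where AB: "\<And>x. \<bar>g x\<bar> \<le> A" "\<And>x. \<bar>h x\<bar> \<le> B"
    using assms by (auto simp: bdd_meas_def)
  moreover have "0 \<le> A" using order_trans[OF abs_ge_zero AB(1)] .
  ultimately show ?thesis using assms
    by (intro bdd_measI[of _ _ "A * B"] borel_measurable_times)
       (auto simp: abs_mult intro!: mult_mono)
qed

lemma bdd_meas_uminus [bdd_meas_intros]:
  "bdd_meas M g \<Longrightarrow> bdd_meas M (\<lambda>x. - g x)"
  by (auto simp: bdd_meas_def)

lemma bdd_meas_diff [bdd_meas_intros]:
  "bdd_meas M g \<Longrightarrow> bdd_meas M h \<Longrightarrow> bdd_meas M (\<lambda>x. g x - h x)"
  using bdd_meas_add[of M g "\<lambda>x. - h x"] bdd_meas_uminus[of M h] by simp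

lemma bdd_meas_abs [bdd_meas_intros]:
  "bdd_meas M g \<Longrightarrow> bdd_meas M (\<lambda>x. \<bar>g x\<bar>)"
  by (auto simp: bdd_meas_def)

lemma bdd_meas_power [bdd_meas_intros]:
  "bdd_meas M g \<Longrightarrow> bdd_meas M (\<lambda>x. g x ^ k)"
  by (induction k) (auto intro: bdd_meas_intros)

lemma bdd_meas_sum [bdd_meas_intros]:
  "(\<And>i. i \<in> I \<Longrightarrow> bdd_meas M (g i)) \<Longrightarrow> bdd_meas M (\<lambda>x. \<Sum>i\<in>I. g i x)"
  by (induction I rule: infinite_finite_induct) (auto intro: bdd_meas_intros)

lemma bdd_meas_max [bdd_meas_intros]:
  assumes "bdd_meas M g" "bdd_meas M h"
  shows "bdd_meas M (\<lambda>x. max (g x) (h x))"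
proof -
  obtain A B where "\<And>x. \<bar>g x\<bar> \<le> A" "\<And>x. \<bar>h x\<bar> \<le> B"
    using assms by (auto simp: bdd_meas_def)
  then have "\<bar>max (g x) (h x)\<bar> \<le> max A B" for x
    by (smt (verit) max_def)
  with assms show ?thesis
    by (intro bdd_measI[of _ _ "max A B"] borel_measurable_max) auto
qed

lemma bdd_meas_min [bdd_meas_intros]:
  assumes "bdd_meas M g" "bdd_meas M h"
  shows "bdd_meas M (\<lambda>x. min (g x) (h x))"
proof -
  have "(\<lambda>x. min (g x) (h x)) = (\<lambda>x. - max (- g x) (- h x))"
    by (auto simp: fun_eq_iff)
  then show ?thesis
    using bdd_meas_uminus[OF
        bdd_meas_max[OF assms[THEN bdd_meas_uminus]]] by simp
qed

lemma bdd_meas_indicator [bdd_meas_intros]: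
  "{x \<in> space M. P x} \<in> sets M \<Longrightarrow> bdd_meas M (indicator {x \<in> space M. P x})"
  by (rule bdd_measI[of _ _ 1]) (auto simp: indicator_def)

lemma bdd_meas_compose:
  assumes "f \<in> borel_measurable M" "g \<in> borel_measurable borel" "\<And>x. \<bar>g x\<bar> \<le> B"
  shows "bdd_meas M (\<lambda>x. g (f x))"
  using assms by (intro bdd_measI[of _ _ B]) auto

lemma (in prob_space) integrable_bdd_meas:
  "bdd_meas M h \<Longrightarrow> integrable M h"
  unfolding bdd_meas_def using integrable_const_bound[of h] by auto

section \<open>Moments and exponential bounds from independence\<close>

locale finite_indep_family = prob_space M for M :: "'a measure" +
  fixes X :: "'i \<Rightarrow> 'a \<Rightarrow> real" and I :: "'i set"
  assumes finite_index: "finite I"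
    and indep: "indep_vars (\<lambda>_. borel) X I"
begin

lemma X_measurable [measurable]: "i \<in> I \<Longrightarrow> X i \<in> borel_measurable M"
  using indep by (simp add: indep_vars_def)

text \<open>\<open>X i\<close> is independent of the remaining variables jointly, so the expectation
  factors and the centred factor kills it. Three sums are provided because the leave-one-out width
  depends on \<open>W\<close> without its summand \<open>i\<close> and on the centred counts of the
  two tails without theirs; slots may be filled with zeros.\<close>

lemma leave_one_out:
  fixes h :: "real \<times> real \<times> real \<Rightarrow> real" and u v w :: "'i \<Rightarrow> real \<Rightarrow> real"
  assumes i: "i \<in> I"
    and p: "p \<in> borel_measurable borel" "bdd_meas M (\<lambda>\<omega>. p (X i \<omega>))"
    and centred: "expectation (\<lambda>\<omega>. p (X i \<omega>)) = 0"
    and [measurable]: "\<And>j. u j \<in> borel_measurable borel" "\<And>j. v j \<in> borel_measurable borel"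
      "\<And>j. w j \<in> borel_measurable borel" "h \<in> borel_measurable borel"
    and bdd: "bdd_meas M (\<lambda>\<omega>. h (\<Sum>j\<in>I - {i}. u j (X j \<omega>),
       \<Sum>j\<in>I - {i}. v j (X j \<omega>), \<Sum>j\<in>I - {i}. w j (X j \<omega>)))"
  shows "expectation (\<lambda>\<omega>. p (X i \<omega>) * h (\<Sum>j\<in>I - {i}. u j (X j \<omega>),
       \<Sum>j\<in>I - {i}. v j (X j \<omega>), \<Sum>j\<in>I - {i}. w j (X j \<omega>))) = 0"
proof -
  let ?K = "case_bool {i} (I - {i})"
  let ?R = "\<lambda>b \<omega>. restrict (\<lambda>j. X j \<omega>) (?K b)"
  have "indep_vars (\<lambda>b. PiM (?K b) (\<lambda>_. borel)) ?R UNIV"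
    by (rule indep_vars_restrict[OF indep]) (auto simp: disjoint_family_on_def i split: bool.split)
  then have ind: "indep_var (PiM {i} (\<lambda>_. borel)) (?R True) (PiM (I - {i}) (\<lambda>_. borel)) (?R False)"
    unfolding indep_var_def
    by (rule indep_vars_cong[THEN iffD1, rotated -1]) (auto split: bool.split)
  let ?G = "\<lambda>x. h (\<Sum>j\<in>I - {i}. u j (x j), \<Sum>j\<in>I - {i}. v j (x j), \<Sum>j\<in>I - {i}. w j (x j))"
  have pm: "(\<lambda>x. p (x i)) \<in> borel_measurable (PiM {i} (\<lambda>_. borel))"
    using p(1) by measurable
  have Gm: "?G \<in> borel_measurable (PiM (I - {i}) (\<lambda>_. borel))"
    by measurable
  have eq: "?G (?R False \<omega>) = h (\<Sum>j\<in>I - {i}. u j (X j \<omega>), \<Sum>j\<in>I - {i}. v j (X j \<omega>),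
      \<Sum>j\<in>I - {i}. w j (X j \<omega>))" for \<omega>
    by simp
  have "indep_var borel (\<lambda>\<omega>. p (X i \<omega>)) borel (\<lambda>\<omega>. ?G (\<lambda>j. X j \<omega>))"
    using indep_var_compose[OF ind pm Gm] by (simp add: comp_def)
  from indep_var_lebesgue_integral[OF this integrable_bdd_meas[OF p(2)]
      integrable_bdd_meas[OF bdd]]
  show ?thesis by (simp add: centred)
qed

lemma expectation_square_sum:
  fixes p :: "'i \<Rightarrow> real \<Rightarrow> real"
  assumes p: "\<And>j. p j \<in> borel_measurable borel"
    and bd: "\<And>j. j \<in> I \<Longrightarrow> bdd_meas M (\<lambda>\<omega>. p j (X j \<omega>))"
    and centred: "\<And>j. j \<in> I \<Longrightarrow> expectation (\<lambda>\<omega>. p j (X j \<omega>)) = 0"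
  shows "expectation (\<lambda>\<omega>. (\<Sum>j\<in>I. p j (X j \<omega>))\<^sup>2) = (\<Sum>j\<in>I. expectation (\<lambda>\<omega>. (p j (X j \<omega>))\<^sup>2))"
proof -
  have "(\<Sum>j\<in>I. p j (X j \<omega>))\<^sup>2
      = (\<Sum>i\<in>I. (p i (X i \<omega>))\<^sup>2 + p i (X i \<omega>) * (\<Sum>j\<in>I - {i}. p j (X j \<omega>)))" for \<omega>
    by (simp add: power2_eq_square sum_distrib_right sum.remove[OF finite_index] distrib_left
        cong: sum.cong)
  then have "expectation (\<lambda>\<omega>. (\<Sum>j\<in>I. p j (X j \<omega>))\<^sup>2)
     = expectation (\<lambda>\<omega>. \<Sum>i\<in>I. (p i (X i \<omega>))\<^sup>2 + p i (X i \<omega>) * (\<Sum>j\<in>I - {i}. p j (X j \<omega>)))"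
    by simp
  also have "\<dots> = (\<Sum>i\<in>I. expectation (\<lambda>\<omega>. (p i (X i \<omega>))\<^sup>2)
       + expectation (\<lambda>\<omega>. p i (X i \<omega>) * (\<Sum>j\<in>I - {i}. p j (X j \<omega>))))"
    by (subst Bochner_Integration.integral_sum)
       (auto intro!: sum.cong Bochner_Integration.integral_add integrable_bdd_meas
          bdd_meas_intros bd)
  also have "\<dots> = (\<Sum>i\<in>I. expectation (\<lambda>\<omega>. (p i (X i \<omega>))\<^sup>2))"
  proof (rule sum.cong)
    fix i assume i: "i \<in> I"
    have "bdd_meas M (\<lambda>\<omega>. \<Sum>j\<in>I - {i}. p j (X j \<omega>))"
      by (intro bdd_meas_intros bd) auto
    then have "expectation (\<lambda>\<omega>. p i (X i \<omega>) * (\<Sum>j\<in>I - {i}. p j (X j \<omega>))) = 0"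
      using leave_one_out[of i "p i" p "\<lambda>_ _. 0" "\<lambda>_ _. 0" fst] i p
        bd[OF i] centred[OF i] by (auto simp: borel_prod[symmetric])
    then show "expectation (\<lambda>\<omega>. (p i (X i \<omega>))\<^sup>2)
       + expectation (\<lambda>\<omega>. p i (X i \<omega>) * (\<Sum>j\<in>I - {i}. p j (X j \<omega>)))
       = expectation (\<lambda>\<omega>. (p i (X i \<omega>))\<^sup>2)" by simp
  qed simp
  finally show ?thesis .
qed

lemma expectation_exp_sum_le:
  fixes p :: "'i \<Rightarrow> real \<Rightarrow> real"
  assumes p: "\<And>j. p j \<in> borel_measurable borel"
    and bd: "\<And>j x. j \<in> I \<Longrightarrow> \<bar>p j x\<bar> \<le> 1"
    and centred: "\<And>j. j \<in> I \<Longrightarrow> expectation (\<lambda>\<omega>. p j (X j \<omega>)) = 0"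
  shows "expectation (\<lambda>\<omega>. exp (\<Sum>j\<in>I. p j (X j \<omega>)))
    \<le> exp (\<Sum>j\<in>I. expectation (\<lambda>\<omega>. (p j (X j \<omega>))\<^sup>2))"
proof -
  have bm: "bdd_meas M (\<lambda>\<omega>. p j (X j \<omega>))" if "j \<in> I" for j
    using that p bd by (intro bdd_measI[of _ _ 1]) auto
  have bme: "bdd_meas M (\<lambda>\<omega>. exp (p j (X j \<omega>)))" if "j \<in> I" for j
    using that p bd[OF that] by (intro bdd_measI[of _ _ "exp 1"]) (auto simp: abs_le_iff)
  \<comment> \<open>For negative \<open>x\<close> the claim is inverted:
    \<open>exp (- x) \<ge> 1 - x + x\<^sup>2 / 2\<close>, and the product of this polynomial with
    \<open>1 + x + x\<^sup>2\<close> is at least 1.\<close>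
  have exp_le: "exp x \<le> 1 + x + x\<^sup>2" if "\<bar>x\<bar> \<le> 1" for x :: real
  proof (cases "0 \<le> x")
    case True
    then show ?thesis using exp_bound[of x] that by auto
  next
    case False
    have "1 \<le> (1 - x + x\<^sup>2 / 2) * (1 + x + x\<^sup>2)"
    proof -
      have "(1 - x + x\<^sup>2 / 2) * (1 + x + x\<^sup>2) - 1 = x\<^sup>2 * (1 - x + x\<^sup>2) / 2"
        by (simp add: field_simps power2_eq_square)
      moreover have "0 \<le> x\<^sup>2 * (1 - x + x\<^sup>2)" using False by auto
      ultimately show ?thesis by simp
    qed
    also have "\<dots> \<le> exp (- x) * (1 + x + x\<^sup>2)"
      using False that exp_lower_Taylor_quadratic[of "- x"]
      by (intro mult_right_mono) auto
    finally show ?thesis by (simp add: exp_minus field_simps)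
  qed
  have "expectation (\<lambda>\<omega>. exp (\<Sum>j\<in>I. p j (X j \<omega>)))
      = expectation (\<lambda>\<omega>. \<Prod>j\<in>I. exp (p j (X j \<omega>)))"
    by (simp add: exp_sum finite_index)
  also have "\<dots> = (\<Prod>j\<in>I. expectation (\<lambda>\<omega>. exp (p j (X j \<omega>))))"
    by (rule indep_vars_lebesgue_integral[OF finite_index])
       (auto intro!: indep_vars_compose2[OF indep] integrable_bdd_meas bme p
          measurable_compose[OF p borel_measurable_exp])
  also have "\<dots> \<le> (\<Prod>j\<in>I. exp (expectation (\<lambda>\<omega>. (p j (X j \<omega>))\<^sup>2)))"
  proof (rule prod_mono, safe)
    fix j assume j: "j \<in> I"
    show "0 \<le> expectation (\<lambda>\<omega>. exp (p j (X j \<omega>)))" by simp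
    have "expectation (\<lambda>\<omega>. exp (p j (X j \<omega>)))
        \<le> expectation (\<lambda>\<omega>. 1 + p j (X j \<omega>) + (p j (X j \<omega>))\<^sup>2)"
      using bd[OF j] by (intro integral_mono integrable_bdd_meas bme
          bdd_meas_intros bm j exp_le)
    also have "\<dots> = 1 + expectation (\<lambda>\<omega>. (p j (X j \<omega>))\<^sup>2)"
      using centred[OF j] j
      by (subst Bochner_Integration.integral_add,
          auto intro!: integrable_bdd_meas bdd_meas_intros bm)+
         (simp add: prob_space)
    also have "\<dots> \<le> exp (expectation (\<lambda>\<omega>. (p j (X j \<omega>))\<^sup>2))"
      by (rule exp_ge_add_one_self)
    finally show "expectation (\<lambda>\<omega>. exp (p j (X j \<omega>))) \<le> exp (expectation (\<lambda>\<omega>. (p j (X j \<omega>))\<^sup>2))" .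
  qed
  also have "\<dots> = exp (\<Sum>j\<in>I. expectation (\<lambda>\<omega>. (p j (X j \<omega>))\<^sup>2))"
    by (simp add: exp_sum finite_index)
  finally show ?thesis .
qed

text \<open>Markov's inequality for the exponential of the sum. The parameter \<open>l\<close> stays
  free: a small value gives moderate deviations of a tail count, and the value 1/2 shows that a
  count is not much below its mean.\<close>

lemma chernoff_sum:
  fixes p :: "'i \<Rightarrow> real \<Rightarrow> real"
  assumes p: "\<And>j. p j \<in> borel_measurable borel"
    and l: "0 < l" and bd: "\<And>j x. j \<in> I \<Longrightarrow> \<bar>l * p j x\<bar> \<le> 1"
    and centred: "\<And>j. j \<in> I \<Longrightarrow> expectation (\<lambda>\<omega>. p j (X j \<omega>)) = 0"
    and var: "(\<Sum>j\<in>I. expectation (\<lambda>\<omega>. (p j (X j \<omega>))\<^sup>2)) \<le> v"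
  shows "prob {\<omega> \<in> space M. t \<le> (\<Sum>j\<in>I. p j (X j \<omega>))} \<le> exp (l\<^sup>2 * v - l * t)"
proof -
  let ?Z = "\<lambda>\<omega>. \<Sum>j\<in>I. l * p j (X j \<omega>)"
  have [measurable]: "(\<lambda>\<omega>. \<Sum>j\<in>I. p j (X j \<omega>)) \<in> borel_measurable M"
    using p by measurable
  have Zeq: "?Z \<omega> = l * (\<Sum>j\<in>I. p j (X j \<omega>))" for \<omega> by (simp add: sum_distrib_left)
  have "expectation (\<lambda>\<omega>. exp (?Z \<omega>)) \<le> exp (\<Sum>j\<in>I. expectation (\<lambda>\<omega>. (l * p j (X j \<omega>))\<^sup>2))"
    by (rule expectation_exp_sum_le[of "\<lambda>j x. l * p j x"])
       (use p bd centred in \<open>auto intro!: borel_measurable_times\<close>)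
  also have "\<dots> \<le> exp (l\<^sup>2 * v)"
    using var by (auto simp: power_mult_distrib sum_distrib_left[symmetric] intro!: mult_left_mono)
  finally have mgf: "expectation (\<lambda>\<omega>. exp (?Z \<omega>)) \<le> exp (l\<^sup>2 * v)" .
  have "\<bar>?Z \<omega>\<bar> \<le> real (card I)" for \<omega>
    using sum_norm_bound[of I "\<lambda>j. l * p j (X j \<omega>)" 1] bd by simp
  then have "bdd_meas M (\<lambda>\<omega>. exp (?Z \<omega>))"
    unfolding Zeq by (intro bdd_measI[of _ _ "exp (real (card I))"]) (auto simp: abs_le_iff)
  then have int: "integrable M (\<lambda>\<omega>. exp (?Z \<omega>))" by (rule integrable_bdd_meas)
  have "prob {\<omega> \<in> space M. exp (l * t) \<le> exp (?Z \<omega>)} \<le> expectation (\<lambda>\<omega>. exp (?Z \<omega>)) / exp (l * t)"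
    by (rule integral_Markov_inequality_measure[OF int, of "{}"]) auto
  also have "{\<omega> \<in> space M. exp (l * t) \<le> exp (?Z \<omega>)} = {\<omega> \<in> space M. t \<le> (\<Sum>j\<in>I. p j (X j \<omega>))}"
    using l by (simp add: Zeq)
  also have "expectation (\<lambda>\<omega>. exp (?Z \<omega>)) / exp (l * t) \<le> exp (l\<^sup>2 * v) / exp (l * t)"
    using mgf by (intro divide_right_mono) auto
  finally show ?thesis by (simp add: exp_diff)
qed

text \<open>The exponential moment replaces the expansion of the fourth power:
  \<open>x ^ 4 \<le> 24 * (exp x + exp (- x))\<close>, both exponentials have mean at most
  \<open>exp 1 \<le> 3\<close>, and \<open>24 * 6 = 144\<close>.\<close>

lemma expectation_fourth_power_le:
  fixes p :: "'i \<Rightarrow> real \<Rightarrow> real"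
  assumes p: "\<And>j. p j \<in> borel_measurable borel"
    and bd: "\<And>j x. j \<in> I \<Longrightarrow> \<bar>p j x\<bar> \<le> 1"
    and centred: "\<And>j. j \<in> I \<Longrightarrow> expectation (\<lambda>\<omega>. p j (X j \<omega>)) = 0"
    and var: "(\<Sum>j\<in>I. expectation (\<lambda>\<omega>. (p j (X j \<omega>))\<^sup>2)) \<le> 1"
  shows "expectation (\<lambda>\<omega>. (\<Sum>j\<in>I. p j (X j \<omega>)) ^ 4) \<le> 144"
proof -
  let ?Z = "\<lambda>\<omega>. \<Sum>j\<in>I. p j (X j \<omega>)"
  have [measurable]: "?Z \<in> borel_measurable M"
    using p by measurable
  have bZ: "\<bar>?Z \<omega>\<bar> \<le> real (card I)" for \<omega>
    using sum_norm_bound[of I "\<lambda>j. p j (X j \<omega>)" 1] bd by simp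
  have e1: "expectation (\<lambda>\<omega>. exp (?Z \<omega>)) \<le> exp 1"
    using expectation_exp_sum_le[OF p bd centred] var by (simp add: order_trans)
  have "expectation (\<lambda>\<omega>. exp (\<Sum>j\<in>I. - p j (X j \<omega>)))
      \<le> exp (\<Sum>j\<in>I. expectation (\<lambda>\<omega>. (- p j (X j \<omega>))\<^sup>2))"
    using p bd centred by (intro expectation_exp_sum_le) auto
  then have e2: "expectation (\<lambda>\<omega>. exp (- ?Z \<omega>)) \<le> exp 1"
    using var by (simp add: sum_negf order_trans)
  have bm: "bdd_meas M (\<lambda>\<omega>. exp (?Z \<omega>))" "bdd_meas M (\<lambda>\<omega>. exp (- ?Z \<omega>))"
    "bdd_meas M ?Z"
    using bZ by (auto intro!: bdd_measI[of _ _ "exp (real (card I))"]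
        bdd_measI[of ?Z _ "real (card I)"] simp: abs_le_iff)
  have pt: "x ^ 4 \<le> 24 * (exp x + exp (- x))" for x :: real
  proof -
    have 1: "y ^ 4 \<le> 24 * exp y" if "0 \<le> y" for y :: real
    proof -
      have "(\<Sum>n\<in>{4}. y ^ n /\<^sub>R fact n) \<le> exp y"
        unfolding exp_def using that by (intro sum_le_suminf summable_exp_generic) auto
      then show ?thesis by (simp add: fact_numeral field_simps)
    qed
    show ?thesis
    proof (cases "0 \<le> x")
      case True
      have "24 * exp x \<le> 24 * (exp x + exp (- x))" by simp
      with 1[OF True] show ?thesis by (rule order_trans)
    next
      case False
      have "24 * exp (- x) \<le> 24 * (exp x + exp (- x))" by simp
      moreover have "x ^ 4 \<le> 24 * exp (- x)" using 1[of "- x"] False by simp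
      ultimately show ?thesis by linarith
    qed
  qed
  have "expectation (\<lambda>\<omega>. ?Z \<omega> ^ 4) \<le> expectation (\<lambda>\<omega>. 24 * (exp (?Z \<omega>) + exp (- ?Z \<omega>)))"
    by (intro integral_mono integrable_bdd_meas bdd_meas_intros bm pt)
  also have "\<dots> = 24 * (expectation (\<lambda>\<omega>. exp (?Z \<omega>)) + expectation (\<lambda>\<omega>. exp (- ?Z \<omega>)))"
    by (simp only: integral_mult_right_zero Bochner_Integration.integral_add
        integrable_bdd_meas bm)
  also have "\<dots> \<le> 24 * (exp 1 + exp 1)" using e1 e2 by simp
  also have "\<dots> \<le> 144" using exp_le by simp
  finally show ?thesis .
qed

text \<open>The squares are again independent, and the variance of each is at most
  \<open>d\<^sup>2\<close> times its mean. Hence the sum of squared small summands is close to its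
  expectation, with error of the order of \<open>d\<close>.\<close>

lemma expectation_sum_squares:
  fixes p :: "'i \<Rightarrow> real \<Rightarrow> real"
  assumes p [measurable]: "\<And>j. p j \<in> borel_measurable borel"
    and bd: "\<And>j x. j \<in> I \<Longrightarrow> \<bar>p j x\<bar> \<le> d"
  defines "v \<equiv> (\<Sum>j\<in>I. expectation (\<lambda>\<omega>. (p j (X j \<omega>))\<^sup>2))"
  shows "expectation (\<lambda>\<omega>. ((\<Sum>j\<in>I. (p j (X j \<omega>))\<^sup>2) - v)\<^sup>2) \<le> d\<^sup>2 * v"
    and "expectation (\<lambda>\<omega>. (\<Sum>j\<in>I. (p j (X j \<omega>))\<^sup>2)\<^sup>2) \<le> v\<^sup>2 + d\<^sup>2 * v"
proof -
  have bm: "bdd_meas M (\<lambda>\<omega>. p j (X j \<omega>))" if "j \<in> I" for j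
    using that bd by (intro bdd_measI[of _ _ d]) auto
  let ?q = "\<lambda>i x. (p i x)\<^sup>2 - expectation (\<lambda>\<omega>. (p i (X i \<omega>))\<^sup>2)"
  let ?T = "\<lambda>\<omega>. \<Sum>j\<in>I. (p j (X j \<omega>))\<^sup>2"
  have "?T \<omega> - v = (\<Sum>i\<in>I. ?q i (X i \<omega>))" for \<omega>
    by (simp add: v_def sum_subtractf)
  then have "expectation (\<lambda>\<omega>. (?T \<omega> - v)\<^sup>2) = expectation (\<lambda>\<omega>. (\<Sum>i\<in>I. ?q i (X i \<omega>))\<^sup>2)" by simp
  also have "\<dots> = (\<Sum>i\<in>I. expectation (\<lambda>\<omega>. (?q i (X i \<omega>))\<^sup>2))"
    by (rule expectation_square_sum)
       (simp_all add: prob_space bdd_meas_intros integrable_bdd_meas bm)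
  also have "\<dots> \<le> (\<Sum>i\<in>I. d\<^sup>2 * expectation (\<lambda>\<omega>. (p i (X i \<omega>))\<^sup>2))"
  proof (rule sum_mono)
    fix i assume i: "i \<in> I"
    have "expectation (\<lambda>\<omega>. (?q i (X i \<omega>))\<^sup>2)
        = expectation (\<lambda>\<omega>. ((p i (X i \<omega>))\<^sup>2)\<^sup>2) - (expectation (\<lambda>\<omega>. (p i (X i \<omega>))\<^sup>2))\<^sup>2"
      using i by (intro variance_eq integrable_bdd_meas bdd_meas_intros bm)
    also have "\<dots> \<le> expectation (\<lambda>\<omega>. ((p i (X i \<omega>))\<^sup>2)\<^sup>2)" by simp
    also have "\<dots> \<le> expectation (\<lambda>\<omega>. d\<^sup>2 * (p i (X i \<omega>))\<^sup>2)"
    proof (intro integral_mono integrable_bdd_meas bdd_meas_intros bm i)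
      fix \<omega>
      have "(p i (X i \<omega>))\<^sup>2 \<le> d\<^sup>2"
        using power_mono[OF bd[OF i, of "X i \<omega>"], of 2] by simp
      then have "(p i (X i \<omega>))\<^sup>2 * (p i (X i \<omega>))\<^sup>2 \<le> d\<^sup>2 * (p i (X i \<omega>))\<^sup>2"
        by (intro mult_right_mono) auto
      then show "((p i (X i \<omega>))\<^sup>2)\<^sup>2 \<le> d\<^sup>2 * (p i (X i \<omega>))\<^sup>2"
        by (simp only: power2_eq_square[of "(p i (X i \<omega>))\<^sup>2"])
    qed
    finally show "expectation (\<lambda>\<omega>. (?q i (X i \<omega>))\<^sup>2) \<le> d\<^sup>2 * expectation (\<lambda>\<omega>. (p i (X i \<omega>))\<^sup>2)" by simp
  qed
  also have "\<dots> = d\<^sup>2 * v" by (simp add: sum_distrib_left[symmetric] v_def)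
  finally show 1: "expectation (\<lambda>\<omega>. (?T \<omega> - v)\<^sup>2) \<le> d\<^sup>2 * v" .
  have "expectation ?T = v"
    unfolding v_def by (rule Bochner_Integration.integral_sum)
      (intro integrable_bdd_meas bdd_meas_intros bm)
  then have "expectation (\<lambda>\<omega>. (?T \<omega> - v)\<^sup>2) = expectation (\<lambda>\<omega>. (?T \<omega>)\<^sup>2) - v\<^sup>2"
    using variance_eq[of ?T]
    by (simp add: integrable_bdd_meas bdd_meas_intros bm)
  with 1 show "expectation (\<lambda>\<omega>. (?T \<omega>)\<^sup>2) \<le> v\<^sup>2 + d\<^sup>2 * v" by simp
qed

end

section \<open>Concentration and normal approximation\<close>

definition clip :: "real \<Rightarrow> real \<Rightarrow> real" where
  "clip c w = max (- c) (min w c)"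

lemma clip_le: "\<bar>clip c w\<bar> \<le> \<bar>c\<bar>"
  by (auto simp: clip_def)

text \<open>The Lipschitz property in the truncation level is what allows a random level to be
  exchanged for one that is free of a given observation.\<close>

lemma clip_diff_le: "\<bar>clip c w - clip d w\<bar> \<le> \<bar>c - d\<bar>"
  by (auto simp: clip_def max_def min_def)

lemma bdd_meas_clip [bdd_meas_intros]:
  "bdd_meas M f \<Longrightarrow> bdd_meas M g \<Longrightarrow> bdd_meas M (\<lambda>x. clip (f x) (g x))"
  unfolding clip_def by (intro bdd_meas_intros)

lemma clip_increment_nonneg:
  "0 \<le> e * (clip c w - clip c (w - e))"
  by (cases "0 \<le> e") (auto simp: clip_def max_def min_def zero_le_mult_iff)

lemma clip_increment_eq:
  "\<bar>w\<bar> \<le> D \<Longrightarrow> \<bar>e\<bar> \<le> \<delta> \<Longrightarrow> clip (D + \<delta>) w - clip (D + \<delta>) (w - e) = e"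
  by (auto simp: clip_def max_def min_def)

locale normalised_small_sum = finite_indep_family M X I
  for M :: "'a measure" and X :: "'i \<Rightarrow> 'a \<Rightarrow> real" and I +
  fixes g :: "'i \<Rightarrow> real \<Rightarrow> real" and \<delta> :: real
  assumes g_measurable [measurable]: "\<And>i. g i \<in> borel_measurable borel"
    and g_le: "\<And>i x. i \<in> I \<Longrightarrow> \<bar>g i x\<bar> \<le> \<delta>"
    and g_centred: "\<And>i. i \<in> I \<Longrightarrow> expectation (\<lambda>\<omega>. g i (X i \<omega>)) = 0"
    and g_normalised: "(\<Sum>i\<in>I. expectation (\<lambda>\<omega>. (g i (X i \<omega>))\<^sup>2)) = 1"
    and \<delta>_pos: "0 < \<delta>" and \<delta>_le: "\<delta> \<le> 1"
begin

definition W :: "'a \<Rightarrow> real" where "W \<omega> = (\<Sum>i\<in>I. g i (X i \<omega>))"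

definition S :: "'a \<Rightarrow> real" where "S \<omega> = (\<Sum>i\<in>I. (g i (X i \<omega>))\<^sup>2)"

lemma bm_g [bdd_meas_intros]: "i \<in> I \<Longrightarrow> bdd_meas M (\<lambda>\<omega>. g i (X i \<omega>))"
  using g_le by (intro bdd_measI[of _ _ \<delta>]) auto

lemma bm_W [bdd_meas_intros]: "bdd_meas M W"
  unfolding W_def[abs_def] by (intro bdd_meas_intros)

lemma bm_S [bdd_meas_intros]: "bdd_meas M S"
  unfolding S_def[abs_def] by (intro bdd_meas_intros)

lemma W_measurable [measurable]: "W \<in> borel_measurable M"
  using bm_W by auto

lemma S_nonneg: "0 \<le> S \<omega>" by (auto simp: S_def intro: sum_nonneg)

lemma sum_minus_summand: "i \<in> I \<Longrightarrow> (\<Sum>j\<in>I - {i}. f j) = (\<Sum>j\<in>I. f j) - f i" for f :: "'i \<Rightarrow> real"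
  using sum.remove[OF finite_index, of i f] by simp

lemma W_minus_summand: "i \<in> I \<Longrightarrow> (\<Sum>j\<in>I - {i}. g j (X j \<omega>)) = W \<omega> - g i (X i \<omega>)"
  by (simp add: sum_minus_summand W_def)

lemma expectation_S: "expectation S = 1"
  unfolding S_def[abs_def] using g_normalised
  by (subst Bochner_Integration.integral_sum)
     (auto intro!: integrable_bdd_meas bdd_meas_intros)

lemma expectation_W2: "expectation (\<lambda>\<omega>. (W \<omega>)\<^sup>2) = 1"
  unfolding W_def using g_normalised expectation_square_sum[of g]
  by (simp add: g_centred bm_g)

lemma expectation_abs_le_1:
  assumes "bdd_meas M Y" "expectation (\<lambda>\<omega>. (Y \<omega>)\<^sup>2) \<le> c\<^sup>2" "0 \<le> c"
  shows "expectation (\<lambda>\<omega>. \<bar>Y \<omega>\<bar>) \<le> c"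
proof -
  have "(expectation (\<lambda>\<omega>. \<bar>Y \<omega>\<bar>))\<^sup>2 \<le> expectation (\<lambda>\<omega>. \<bar>Y \<omega>\<bar>\<^sup>2)"
  proof -
    have "0 \<le> variance (\<lambda>\<omega>. \<bar>Y \<omega>\<bar>)" by (rule Bochner_Integration.integral_nonneg) simp
    then show ?thesis
      by (subst (asm) variance_eq)
         (auto intro!: integrable_bdd_meas bdd_meas_intros assms(1))
  qed
  also have "\<dots> \<le> c\<^sup>2" using assms(2) by simp
  finally show ?thesis using assms(3) by (rule power2_le_imp_le)
qed

lemma expectation_S_minus_1_square: "expectation (\<lambda>\<omega>. (S \<omega> - 1)\<^sup>2) \<le> \<delta>\<^sup>2"
  and expectation_S2: "expectation (\<lambda>\<omega>. (S \<omega>)\<^sup>2) \<le> 1 + \<delta>\<^sup>2"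
  using expectation_sum_squares[of g \<delta>] g_le by (simp_all add: g_normalised S_def)

text \<open>Stein's method with the truncated linear function \<open>clip (D + \<delta>) (w - z)\<close>. The increments
  of this function in the direction of a summand have the sign of the summand, and are equal to
  it where \<open>\<bar>W - z\<bar> \<le> D\<close>.\<close>

lemma randomized_concentration:
  assumes D: "bdd_meas M D" and Dnn: "\<And>\<omega>. 0 \<le> D \<omega>"
    and D': "\<And>i. i \<in> I \<Longrightarrow> bdd_meas M (D' i)"
    and orth: "\<And>i. i \<in> I \<Longrightarrow> expectation (\<lambda>\<omega>. g i (X i \<omega>) *
        clip (D' i \<omega> + \<delta>) (W \<omega> - g i (X i \<omega>) - z)) = 0"
  shows "expectation (\<lambda>\<omega>. indicator {\<omega>\<in>space M. \<bar>W \<omega> - z\<bar> \<le> D \<omega>} \<omega> * S \<omega>)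
    \<le> expectation (\<lambda>\<omega>. \<bar>W \<omega>\<bar> * (D \<omega> + \<delta>))
      + (\<Sum>i\<in>I. expectation (\<lambda>\<omega>. \<bar>g i (X i \<omega>)\<bar> * \<bar>D \<omega> - D' i \<omega>\<bar>))"
proof -
  let ?F = "\<lambda>\<omega> w. clip (D \<omega> + \<delta>) (w - z)"
  let ?A = "{\<omega>\<in>space M. \<bar>W \<omega> - z\<bar> \<le> D \<omega>}"
  have [measurable]: "D \<in> borel_measurable M" using D by auto
  note bmi = integrable_bdd_meas bdd_meas_intros D D'
  have "?A \<in> sets M" by measurable
  then have int1: "integrable M (\<lambda>\<omega>. indicator ?A \<omega> * S \<omega>)" by (intro bmi)
  have int2: "integrable M (\<lambda>\<omega>. \<bar>W \<omega>\<bar> * (D \<omega> + \<delta>))" by (intro bmi)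
  have int3: "integrable M (\<lambda>\<omega>. \<bar>g i (X i \<omega>)\<bar> * \<bar>D \<omega> - D' i \<omega>\<bar>)"
    "integrable M (\<lambda>\<omega>. g i (X i \<omega>) * clip (D' i \<omega> + \<delta>) (W \<omega> - g i (X i \<omega>) - z))"
    if "i \<in> I" for i using that by (auto intro!: bmi)
  have int4: "integrable M (\<lambda>\<omega>. \<Sum>i\<in>I. \<bar>g i (X i \<omega>)\<bar> * \<bar>D \<omega> - D' i \<omega>\<bar>)"
    "integrable M (\<lambda>\<omega>. \<Sum>i\<in>I. g i (X i \<omega>) * clip (D' i \<omega> + \<delta>) (W \<omega> - g i (X i \<omega>) - z))"
    by (auto intro!: Bochner_Integration.integrable_sum int3)
  note int = int1 int2 int3 int4
  have pt: "indicator ?A \<omega> * S \<omega>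
      \<le> \<bar>W \<omega>\<bar> * (D \<omega> + \<delta>) + (\<Sum>i\<in>I. \<bar>g i (X i \<omega>)\<bar> * \<bar>D \<omega> - D' i \<omega>\<bar>)
        - (\<Sum>i\<in>I. g i (X i \<omega>) * clip (D' i \<omega> + \<delta>) (W \<omega> - g i (X i \<omega>) - z))" for \<omega>
  proof -
    have "indicator ?A \<omega> * S \<omega>
        \<le> (\<Sum>i\<in>I. g i (X i \<omega>) * (?F \<omega> (W \<omega>) - ?F \<omega> (W \<omega> - g i (X i \<omega>))))"
      unfolding S_def sum_distrib_left
    proof (rule sum_mono)
      fix i assume i: "i \<in> I"
      have eq: "W \<omega> - g i (X i \<omega>) - z = W \<omega> - z - g i (X i \<omega>)" by simp
      show "indicator ?A \<omega> * (g i (X i \<omega>))\<^sup>2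
         \<le> g i (X i \<omega>) * (?F \<omega> (W \<omega>) - ?F \<omega> (W \<omega> - g i (X i \<omega>)))"
        unfolding eq
        using clip_increment_nonneg[of "g i (X i \<omega>)" "D \<omega> + \<delta>" "W \<omega> - z"]
          clip_increment_eq[of "W \<omega> - z" "D \<omega>" "g i (X i \<omega>)" \<delta>] g_le[OF i, of "X i \<omega>"]
        by (auto simp: indicator_def power2_eq_square)
    qed
    also have "\<dots> = W \<omega> * ?F \<omega> (W \<omega>) - (\<Sum>i\<in>I. g i (X i \<omega>) * ?F \<omega> (W \<omega> - g i (X i \<omega>)))"
      by (simp add: right_diff_distrib sum_subtractf W_def sum_distrib_right)
    finally have 1: "indicator ?A \<omega> * S \<omega>
        \<le> W \<omega> * ?F \<omega> (W \<omega>) - (\<Sum>i\<in>I. g i (X i \<omega>) * ?F \<omega> (W \<omega> - g i (X i \<omega>)))" .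
    have 2: "W \<omega> * ?F \<omega> (W \<omega>) \<le> \<bar>W \<omega>\<bar> * (D \<omega> + \<delta>)"
      using clip_le[of "D \<omega> + \<delta>" "W \<omega> - z"] Dnn[of \<omega>] \<delta>_pos
      by - (rule abs_le_D1, auto simp: abs_mult intro!: mult_left_mono)
    \<comment> \<open>At level \<open>D\<close> the factor multiplying \<open>g i\<close> still
      depends on observation \<open>i\<close>. Passing to \<open>D' i\<close> costs
      \<open>\<bar>g i\<bar> * \<bar>D - D' i\<bar>\<close> and leaves a product whose mean vanishes
      by \<open>orth\<close>.\<close>
    have 3: "- (\<Sum>i\<in>I. g i (X i \<omega>) * ?F \<omega> (W \<omega> - g i (X i \<omega>)))
        \<le> (\<Sum>i\<in>I. \<bar>g i (X i \<omega>)\<bar> * \<bar>D \<omega> - D' i \<omega>\<bar>)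
        - (\<Sum>i\<in>I. g i (X i \<omega>) * clip (D' i \<omega> + \<delta>) (W \<omega> - g i (X i \<omega>) - z))"
      unfolding sum_negf[symmetric] sum_subtractf[symmetric]
    proof (rule sum_mono)
      fix i assume i: "i \<in> I"
      let ?v = "W \<omega> - g i (X i \<omega>) - z"
      have "g i (X i \<omega>) * (clip (D' i \<omega> + \<delta>) ?v - clip (D \<omega> + \<delta>) ?v)
         \<le> \<bar>g i (X i \<omega>)\<bar> * \<bar>D \<omega> - D' i \<omega>\<bar>"
        using clip_diff_le[of "D' i \<omega> + \<delta>" ?v "D \<omega> + \<delta>"]
        by - (rule abs_le_D1, auto simp: abs_mult abs_minus_commute intro!: mult_left_mono)
      then show "- (g i (X i \<omega>) * clip (D \<omega> + \<delta>) ?v)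
         \<le> \<bar>g i (X i \<omega>)\<bar> * \<bar>D \<omega> - D' i \<omega>\<bar> - g i (X i \<omega>) * clip (D' i \<omega> + \<delta>) ?v"
        by (simp add: right_diff_distrib)
    qed
    from 1 2 3 show ?thesis by linarith
  qed
  have "expectation (\<lambda>\<omega>. indicator ?A \<omega> * S \<omega>)
     \<le> expectation (\<lambda>\<omega>. \<bar>W \<omega>\<bar> * (D \<omega> + \<delta>) + (\<Sum>i\<in>I. \<bar>g i (X i \<omega>)\<bar> * \<bar>D \<omega> - D' i \<omega>\<bar>)
        - (\<Sum>i\<in>I. g i (X i \<omega>) * clip (D' i \<omega> + \<delta>) (W \<omega> - g i (X i \<omega>) - z)))"
    by (intro integral_mono pt Bochner_Integration.integrable_diff
        Bochner_Integration.integrable_add int)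
  also have "\<dots> = expectation (\<lambda>\<omega>. \<bar>W \<omega>\<bar> * (D \<omega> + \<delta>))
     + expectation (\<lambda>\<omega>. \<Sum>i\<in>I. \<bar>g i (X i \<omega>)\<bar> * \<bar>D \<omega> - D' i \<omega>\<bar>)
     - expectation (\<lambda>\<omega>. \<Sum>i\<in>I. g i (X i \<omega>) * clip (D' i \<omega> + \<delta>) (W \<omega> - g i (X i \<omega>) - z))"
    by (simp only: Bochner_Integration.integral_diff Bochner_Integration.integral_add
        Bochner_Integration.integrable_add int)
  also have "expectation (\<lambda>\<omega>. \<Sum>i\<in>I. g i (X i \<omega>) * clip (D' i \<omega> + \<delta>) (W \<omega> - g i (X i \<omega>) - z)) = 0"
    by (subst Bochner_Integration.integral_sum) (simp_all add: orth int)
  also have "expectation (\<lambda>\<omega>. \<Sum>i\<in>I. \<bar>g i (X i \<omega>)\<bar> * \<bar>D \<omega> - D' i \<omega>\<bar>)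
     = (\<Sum>i\<in>I. expectation (\<lambda>\<omega>. \<bar>g i (X i \<omega>)\<bar> * \<bar>D \<omega> - D' i \<omega>\<bar>))"
    by (rule Bochner_Integration.integral_sum) (rule int)
  finally show ?thesis by simp
qed

end

section \<open>Berry-Esseen bound, and concentration with a quadratic random width\<close>

context normalised_small_sum
begin

lemma expectation_abs_W: "expectation (\<lambda>\<omega>. \<bar>W \<omega>\<bar>) \<le> 1"
  using expectation_abs_le_1[OF bm_W, of 1] by (simp add: expectation_W2)

text \<open>The case of constant width \<open>\<delta>\<close>, where the exchange of
  \<open>D\<close> costs nothing. The weight \<open>S\<close> is kept, because it is with this
  weight that the indicator appears when the steps across \<open>z\<close> are summed over all
  observations.\<close>

lemma concentration_weighted:
  "expectation (\<lambda>\<omega>. indicator {\<omega>\<in>space M. \<bar>W \<omega> - z\<bar> \<le> \<delta>} \<omega> * S \<omega>) \<le> 2 * \<delta>"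
proof -
  have "expectation (\<lambda>\<omega>. indicator {\<omega>\<in>space M. \<bar>W \<omega> - z\<bar> \<le> \<delta>} \<omega> * S \<omega>)
    \<le> expectation (\<lambda>\<omega>. \<bar>W \<omega>\<bar> * (\<delta> + \<delta>)) + (\<Sum>i\<in>I. expectation (\<lambda>\<omega>. \<bar>g i (X i \<omega>)\<bar> * \<bar>\<delta> - \<delta>\<bar>))"
  proof (rule randomized_concentration)
    fix i assume i: "i \<in> I"
    let ?h = "\<lambda>x :: real \<times> real \<times> real. clip (\<delta> + \<delta>) (fst x - z)"
    have "?h \<in> borel_measurable borel"
      unfolding clip_def borel_prod[symmetric] by measurable
    moreover have "bdd_meas M (\<lambda>\<omega>. clip (\<delta> + \<delta>) (W \<omega> - g i (X i \<omega>) - z))"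
      by (intro bdd_meas_intros i)
    ultimately show "expectation (\<lambda>\<omega>. g i (X i \<omega>) * clip (\<delta> + \<delta>) (W \<omega> - g i (X i \<omega>) - z)) = 0"
      using leave_one_out[of i "g i" g "\<lambda>_ _. 0" "\<lambda>_ _. 0" ?h] i g_centred[OF i] bm_g[OF i]
      by (simp add: W_minus_summand)
  qed (use \<delta>_pos in \<open>auto intro: bdd_meas_intros\<close>)
  also have "\<dots> = 2 * \<delta> * expectation (\<lambda>\<omega>. \<bar>W \<omega>\<bar>)" by simp
  also have "\<dots> \<le> 2 * \<delta> * 1" using \<delta>_pos expectation_abs_W by (intro mult_left_mono) auto
  finally show ?thesis by simp
qed

text \<open>The constant is \<open>2 + 8 + 8\<close>: twice the mean of
  \<open>\<bar>S - 1\<bar>\<close>, four times the weighted concentration bound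
  \<open>2 * \<delta>\<close>, and the Taylor remainder
  \<open>\<delta> * (5 + 2 + 1)\<close>.\<close>

theorem berry_esseen_bounded:
  "\<bar>prob {\<omega>\<in>space M. W \<omega> \<le> z} - \<Phi> z\<bar> \<le> 18 * \<delta>"
proof -
  let ?f = "stein_sol z" and ?f' = "stein_deriv z"
  let ?A = "{\<omega>\<in>space M. \<bar>W \<omega> - z\<bar> \<le> \<delta>}"
  let ?L = "\<lambda>\<omega>. ?f' (W \<omega>) - W \<omega> * ?f (W \<omega>) + (\<Sum>i\<in>I. g i (X i \<omega>) * ?f (W \<omega> - g i (X i \<omega>)))"
  let ?R = "\<lambda>\<omega>. 2 * \<bar>S \<omega> - 1\<bar> + 4 * (indicator ?A \<omega> * S \<omega>) + \<delta> * (5 * S \<omega> + ((S \<omega>)\<^sup>2 + (W \<omega>)\<^sup>2))"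
  have pt: "\<bar>?L \<omega>\<bar> \<le> ?R \<omega>" if "\<omega> \<in> space M" for \<omega>
  proof -
    \<comment> \<open>Since \<open>g i\<close> is orthogonal to any function of
      \<open>W - g i\<close>, the added sum has mean 0 and \<open>?L\<close> has the mean sought.
      Pointwise it splits into the defect of \<open>S\<close> from 1 and one Taylor error per
      summand.\<close>
    have eq: "?L \<omega> = ?f' (W \<omega>) * (1 - S \<omega>)
        + (\<Sum>i\<in>I. (g i (X i \<omega>))\<^sup>2 * ?f' (W \<omega>) - g i (X i \<omega>) * (?f (W \<omega>) - ?f (W \<omega> - g i (X i \<omega>))))"
      by (simp add: sum_subtractf right_diff_distrib sum_distrib_right[symmetric] W_def[symmetric]
          S_def[symmetric])
    have "\<bar>?L \<omega>\<bar> \<le> 2 * \<bar>1 - S \<omega>\<bar>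
        + (\<Sum>i\<in>I. (g i (X i \<omega>))\<^sup>2 * (4 * indicator {w. \<bar>w - z\<bar> \<le> \<delta>} (W \<omega>) + \<delta> * (5 + 2 * \<bar>W \<omega>\<bar>)))"
      unfolding eq
    proof (rule order_trans[OF abs_triangle_ineq add_mono])
      show "\<bar>?f' (W \<omega>) * (1 - S \<omega>)\<bar> \<le> 2 * \<bar>1 - S \<omega>\<bar>"
        unfolding abs_mult by (intro mult_right_mono abs_stein_deriv_le) auto
      show "\<bar>\<Sum>i\<in>I. (g i (X i \<omega>))\<^sup>2 * ?f' (W \<omega>) - g i (X i \<omega>) * (?f (W \<omega>) - ?f (W \<omega> - g i (X i \<omega>)))\<bar>
        \<le> (\<Sum>i\<in>I. (g i (X i \<omega>))\<^sup>2 * (4 * indicator {w. \<bar>w - z\<bar> \<le> \<delta>} (W \<omega>) + \<delta> * (5 + 2 * \<bar>W \<omega>\<bar>)))"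
        by (rule sum_abs[THEN order_trans], rule sum_mono, rule stein_sol_expansion, rule g_le)
    qed
    also have "\<dots> = 2 * \<bar>S \<omega> - 1\<bar> + 4 * (indicator ?A \<omega> * S \<omega>) + \<delta> * (5 * S \<omega> + 2 * \<bar>W \<omega>\<bar> * S \<omega>)"
    proof -
      have "indicator {w. \<bar>w - z\<bar> \<le> \<delta>} (W \<omega>) = (indicator ?A \<omega> :: real)"
        using that by (simp add: indicator_def)
      moreover have "(\<Sum>i\<in>I. (g i (X i \<omega>))\<^sup>2 * c) = S \<omega> * c" for c
        by (simp add: S_def sum_distrib_right)
      moreover have "2 * x + s * (4 * y + d * (5 + 2 * w)) = 2 * x + 4 * (y * s) + d * (5 * s + 2 * w * s)"
        for x y s d w :: real by (simp add: algebra_simps)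
      ultimately show ?thesis by (simp only: abs_minus_commute[of 1 "S \<omega>"])
    qed
    also have "\<dots> \<le> ?R \<omega>"
    proof -
      have "0 \<le> (\<bar>W \<omega>\<bar> - S \<omega>)\<^sup>2" by simp
      then have "2 * \<bar>W \<omega>\<bar> * S \<omega> \<le> (S \<omega>)\<^sup>2 + (W \<omega>)\<^sup>2" by (simp add: power2_diff)
      then show ?thesis using \<delta>_pos by simp
    qed
    finally show ?thesis .
  qed
  have "{\<omega> \<in> space M. \<bar>W \<omega> - z\<bar> \<le> \<delta>} \<in> sets M" "{\<omega> \<in> space M. W \<omega> \<le> z} \<in> sets M" by measurable
  note ind = this[THEN bdd_meas_indicator]
  have bmf: "bdd_meas M (\<lambda>\<omega>. ?f (h \<omega>))" "bdd_meas M (\<lambda>\<omega>. ?f' (h \<omega>))"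
    if "bdd_meas M h" for h
    using that stein_sol_nonneg[of z] stein_sol_le[of z] abs_stein_deriv_le[of z]
    by (auto intro: bdd_meas_compose[of _ _ _ 5] bdd_meas_compose[of _ _ _ 2])
  have bmL1: "bdd_meas M (\<lambda>\<omega>. g i (X i \<omega>) * ?f (W \<omega> - g i (X i \<omega>)))" if "i \<in> I" for i
    using that by (intro bdd_meas_intros bmf)
  have bmL2: "bdd_meas M (\<lambda>\<omega>. ?f' (W \<omega>) - W \<omega> * ?f (W \<omega>))"
    by (intro bdd_meas_intros bmf)
  have bmL3: "bdd_meas M (\<lambda>\<omega>. \<Sum>i\<in>I. g i (X i \<omega>) * ?f (W \<omega> - g i (X i \<omega>)))"
    by (intro bdd_meas_intros bmL1)
  have orth: "expectation (\<lambda>\<omega>. g i (X i \<omega>) * ?f (W \<omega> - g i (X i \<omega>))) = 0" if i: "i \<in> I" for i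
  proof -
    have "(\<lambda>x :: real \<times> real \<times> real. ?f (fst x)) \<in> borel_measurable borel"
      by (rule measurable_compose[OF _ borel_measurable_stein_sol])
         (simp add: borel_prod[symmetric])
    moreover have "bdd_meas M (\<lambda>\<omega>. ?f (W \<omega> - g i (X i \<omega>)))"
      by (intro bmf bdd_meas_intros i)
    ultimately show ?thesis
      using leave_one_out[of i "g i" g "\<lambda>_ _. 0" "\<lambda>_ _. 0" "\<lambda>x. ?f (fst x)"] i g_centred[OF i] bm_g[OF i]
      by (simp add: W_minus_summand)
  qed
  have "expectation ?L = expectation (\<lambda>\<omega>. ?f' (W \<omega>) - W \<omega> * ?f (W \<omega>))
      + expectation (\<lambda>\<omega>. \<Sum>i\<in>I. g i (X i \<omega>) * ?f (W \<omega> - g i (X i \<omega>)))"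
    by (intro Bochner_Integration.integral_add integrable_bdd_meas bmL2 bmL3)
  also have "expectation (\<lambda>\<omega>. \<Sum>i\<in>I. g i (X i \<omega>) * ?f (W \<omega> - g i (X i \<omega>))) = 0"
    by (subst Bochner_Integration.integral_sum)
       (simp_all add: orth integrable_bdd_meas bmL1)
  also have "expectation (\<lambda>\<omega>. ?f' (W \<omega>) - W \<omega> * ?f (W \<omega>))
     = expectation (\<lambda>\<omega>. indicator {\<omega>\<in>space M. W \<omega> \<le> z} \<omega> - \<Phi> z)"
    by (intro Bochner_Integration.integral_cong)
       (auto simp: stein_deriv_def indicator_def algebra_simps)
  also have "\<dots> = prob {\<omega>\<in>space M. W \<omega> \<le> z} - \<Phi> z"
    by (subst Bochner_Integration.integral_diff)
       (auto simp: prob_space intro!: integrable_bdd_meas ind)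
  finally have L: "expectation ?L = prob {\<omega>\<in>space M. W \<omega> \<le> z} - \<Phi> z"
    by simp
  have bmR: "bdd_meas M (\<lambda>\<omega>. \<bar>S \<omega> - 1\<bar>)" "bdd_meas M (\<lambda>\<omega>. indicator ?A \<omega> * S \<omega>)"
    "bdd_meas M (\<lambda>\<omega>. (S \<omega>)\<^sup>2)" "bdd_meas M (\<lambda>\<omega>. (W \<omega>)\<^sup>2)"
    by (intro bdd_meas_intros ind)+
  have "\<bar>expectation ?L\<bar> \<le> expectation (\<lambda>\<omega>. \<bar>?L \<omega>\<bar>)"
    by (rule integral_abs_bound)
  also have "\<dots> \<le> expectation ?R"
    by (intro integral_mono pt integrable_bdd_meas bdd_meas_abs
        bdd_meas_add[OF bmL2 bmL3])
       (intro bdd_meas_intros bmR)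
  also have "\<dots> = 2 * expectation (\<lambda>\<omega>. \<bar>S \<omega> - 1\<bar>) + 4 * expectation (\<lambda>\<omega>. indicator ?A \<omega> * S \<omega>)
     + \<delta> * (5 * expectation S + (expectation (\<lambda>\<omega>. (S \<omega>)\<^sup>2) + expectation (\<lambda>\<omega>. (W \<omega>)\<^sup>2)))"
    by (simp only: Bochner_Integration.integral_add Bochner_Integration.integrable_add
        integral_mult_right_zero integrable_mult_right bmR[THEN integrable_bdd_meas]
        bm_S[THEN integrable_bdd_meas])
  also have "\<dots> \<le> 2 * \<delta> + 4 * (2 * \<delta>) + \<delta> * (5 * 1 + (2 + 1))"
  proof (intro add_mono mult_left_mono concentration_weighted)
    show "expectation (\<lambda>\<omega>. \<bar>S \<omega> - 1\<bar>) \<le> \<delta>"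
      using \<delta>_pos expectation_S_minus_1_square
      by (intro expectation_abs_le_1 bdd_meas_intros) auto
    show "expectation (\<lambda>\<omega>. (S \<omega>)\<^sup>2) \<le> 2"
      using expectation_S2 power_mono[OF \<delta>_le, of 2] \<delta>_pos by simp
  qed (use \<delta>_pos in \<open>auto simp: expectation_S expectation_W2\<close>)
  finally show ?thesis unfolding L by simp
qed

text \<open>This is the price in \<open>randomized_concentration\<close> of the width
  \<open>A\<^sup>2 + 1\<close> for a normalised sum \<open>A\<close>. Every product is split by
  \<open>2 * x * y \<le> x\<^sup>2 + y\<^sup>2\<close>, so that only moments of single variables
  remain; they add up to \<open>1 + 144 / 2 + 1 / 2 + 1 + 1 + 1 + 1 \<le> 78\<close>.\<close>

lemma quadratic_perturbation_cost:
  fixes p :: "'i \<Rightarrow> real \<Rightarrow> real"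
  assumes p [measurable]: "\<And>j. p j \<in> borel_measurable borel"
    and bd: "\<And>j x. j \<in> I \<Longrightarrow> \<bar>p j x\<bar> \<le> 1"
    and centred: "\<And>j. j \<in> I \<Longrightarrow> expectation (\<lambda>\<omega>. p j (X j \<omega>)) = 0"
    and var: "(\<Sum>j\<in>I. expectation (\<lambda>\<omega>. (p j (X j \<omega>))\<^sup>2)) \<le> 1"
  shows "expectation (\<lambda>\<omega>. \<bar>W \<omega>\<bar> * ((\<Sum>j\<in>I. p j (X j \<omega>))\<^sup>2 + 1)
     + (\<Sum>i\<in>I. \<bar>g i (X i \<omega>)\<bar> * \<bar>(\<Sum>j\<in>I. p j (X j \<omega>))\<^sup>2 - ((\<Sum>j\<in>I. p j (X j \<omega>)) - p i (X i \<omega>))\<^sup>2\<bar>)) \<le> 78"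
proof -
  let ?A = "\<lambda>\<omega>. \<Sum>j\<in>I. p j (X j \<omega>)" and ?T = "\<lambda>\<omega>. \<Sum>j\<in>I. (p j (X j \<omega>))\<^sup>2"
  let ?L = "\<lambda>\<omega>. \<bar>W \<omega>\<bar> * ((?A \<omega>)\<^sup>2 + 1) + (\<Sum>i\<in>I. \<bar>g i (X i \<omega>)\<bar> * \<bar>(?A \<omega>)\<^sup>2 - (?A \<omega> - p i (X i \<omega>))\<^sup>2\<bar>)"
  let ?R = "\<lambda>\<omega>. (W \<omega>)\<^sup>2 + (?A \<omega>) ^ 4 / 2 + 1 / 2 + (?A \<omega>)\<^sup>2 + (S \<omega>)\<^sup>2 / 2 + (?T \<omega>)\<^sup>2 / 2 + ?T \<omega>"
  have bmp: "bdd_meas M (\<lambda>\<omega>. p j (X j \<omega>))" if "j \<in> I" for j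
    using that bd by (intro bdd_measI[of _ _ 1]) auto
  have bmA: "bdd_meas M ?A" and bmT: "bdd_meas M ?T"
    by (intro bdd_meas_intros bmp; assumption)+
  have pt: "?L \<omega> \<le> ?R \<omega>" for \<omega>
  proof -
    have am: "2 * x * y \<le> x\<^sup>2 + y\<^sup>2" for x y :: real
      using sum_squares_bound[of x y] by simp
    have 1: "\<bar>W \<omega>\<bar> * ((?A \<omega>)\<^sup>2 + 1) \<le> (W \<omega>)\<^sup>2 + (?A \<omega>) ^ 4 / 2 + 1 / 2"
      using am[of "\<bar>W \<omega>\<bar>" "(?A \<omega>)\<^sup>2"] am[of "\<bar>W \<omega>\<bar>" 1] by (simp add: distrib_left)
    have "(\<Sum>i\<in>I. \<bar>g i (X i \<omega>)\<bar> * \<bar>(?A \<omega>)\<^sup>2 - (?A \<omega> - p i (X i \<omega>))\<^sup>2\<bar>)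
      \<le> (\<Sum>i\<in>I. \<bar>?A \<omega>\<bar> * ((g i (X i \<omega>))\<^sup>2 + (p i (X i \<omega>))\<^sup>2) + (p i (X i \<omega>))\<^sup>2)"
    proof (rule sum_mono)
      fix i assume i: "i \<in> I"
      define a b c where "a = ?A \<omega>" and "b = g i (X i \<omega>)" and "c = p i (X i \<omega>)"
      have b: "\<bar>b\<bar> \<le> 1" using g_le[OF i, of "X i \<omega>"] \<delta>_le by (simp add: b_def)
      have "a\<^sup>2 - (a - c)\<^sup>2 = 2 * a * c - c\<^sup>2" by (simp add: power2_diff)
      then have "\<bar>a\<^sup>2 - (a - c)\<^sup>2\<bar> \<le> 2 * \<bar>a\<bar> * \<bar>c\<bar> + c\<^sup>2"
        using abs_triangle_ineq4[of "2 * a * c" "c\<^sup>2"] by (simp add: abs_mult)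
      then have "\<bar>b\<bar> * \<bar>a\<^sup>2 - (a - c)\<^sup>2\<bar> \<le> \<bar>b\<bar> * (2 * \<bar>a\<bar> * \<bar>c\<bar> + c\<^sup>2)"
        by (intro mult_left_mono) auto
      also have "\<dots> = \<bar>a\<bar> * (2 * \<bar>b\<bar> * \<bar>c\<bar>) + \<bar>b\<bar> * c\<^sup>2" by (simp add: algebra_simps)
      also have "\<dots> \<le> \<bar>a\<bar> * (b\<^sup>2 + c\<^sup>2) + 1 * c\<^sup>2"
        using am[of "\<bar>b\<bar>" "\<bar>c\<bar>"] b by (intro add_mono mult_left_mono mult_right_mono) auto
      finally show "\<bar>g i (X i \<omega>)\<bar> * \<bar>(?A \<omega>)\<^sup>2 - (?A \<omega> - p i (X i \<omega>))\<^sup>2\<bar>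
         \<le> \<bar>?A \<omega>\<bar> * ((g i (X i \<omega>))\<^sup>2 + (p i (X i \<omega>))\<^sup>2) + (p i (X i \<omega>))\<^sup>2"
        by (simp add: a_def b_def c_def)
    qed
    also have "\<dots> = \<bar>?A \<omega>\<bar> * S \<omega> + \<bar>?A \<omega>\<bar> * ?T \<omega> + ?T \<omega>"
      by (simp add: sum.distrib sum_distrib_left[symmetric] S_def distrib_left)
    also have "\<dots> \<le> (?A \<omega>)\<^sup>2 + (S \<omega>)\<^sup>2 / 2 + (?T \<omega>)\<^sup>2 / 2 + ?T \<omega>"
      using am[of "\<bar>?A \<omega>\<bar>" "S \<omega>"] am[of "\<bar>?A \<omega>\<bar>" "?T \<omega>"] by simp
    finally show ?thesis using 1 by linarith
  qed
  have T2: "expectation (\<lambda>\<omega>. (?T \<omega>)\<^sup>2) \<le> 2"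
  proof -
    define v where "v = (\<Sum>j\<in>I. expectation (\<lambda>\<omega>. (p j (X j \<omega>))\<^sup>2))"
    have "0 \<le> v" "v \<le> 1" using var by (auto simp: v_def intro!: sum_nonneg)
    then have "v\<^sup>2 + v \<le> 2" using power_le_one[of v 2] by simp
    moreover have "expectation (\<lambda>\<omega>. (?T \<omega>)\<^sup>2) \<le> v\<^sup>2 + v"
      using expectation_sum_squares(2)[of p 1] bd by (simp add: v_def)
    ultimately show ?thesis by linarith
  qed
  have T1: "expectation ?T \<le> 1"
    using var by (subst Bochner_Integration.integral_sum)
      (auto intro!: integrable_bdd_meas bdd_meas_intros bmp)
  have A2: "expectation (\<lambda>\<omega>. (?A \<omega>)\<^sup>2) \<le> 1"
    using var expectation_square_sum[of p] by (simp add: bmp centred)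
  have A4: "expectation (\<lambda>\<omega>. (?A \<omega>) ^ 4) \<le> 144"
    by (rule expectation_fourth_power_le[OF p bd centred var])
  have S2: "expectation (\<lambda>\<omega>. (S \<omega>)\<^sup>2) \<le> 2"
    using expectation_S2 power_mono[OF \<delta>_le, of 2] \<delta>_pos by simp
  have int: "integrable M (\<lambda>\<omega>. (W \<omega>)\<^sup>2)" "integrable M (\<lambda>\<omega>. (?A \<omega>) ^ 4)" "integrable M (\<lambda>\<omega>. (?A \<omega>)\<^sup>2)"
    "integrable M (\<lambda>\<omega>. (S \<omega>)\<^sup>2)" "integrable M (\<lambda>\<omega>. (?T \<omega>)\<^sup>2)" "integrable M ?T"
    by (rule integrable_bdd_meas, (rule bdd_meas_power bm_W bm_S bmA bmT)+)+
  have bmL: "bdd_meas M ?L"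
    by (intro bdd_meas_intros bmA bmp; assumption)
  have "expectation ?L \<le> expectation ?R"
    by (intro integral_mono pt integrable_bdd_meas[OF bmL]
        Bochner_Integration.integrable_add integrable_divide_zero int) auto
  also have "\<dots> = expectation (\<lambda>\<omega>. (W \<omega>)\<^sup>2) + expectation (\<lambda>\<omega>. (?A \<omega>) ^ 4) / 2
    + expectation (\<lambda>_. 1 / 2) + expectation (\<lambda>\<omega>. (?A \<omega>)\<^sup>2) + expectation (\<lambda>\<omega>. (S \<omega>)\<^sup>2) / 2
    + expectation (\<lambda>\<omega>. (?T \<omega>)\<^sup>2) / 2 + expectation ?T"
    by (simp only: Bochner_Integration.integral_add Bochner_Integration.integrable_add
        integral_divide_zero integrable_divide_zero int integrable_const)
  also have "\<dots> \<le> 78"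
    using T1 T2 A2 A4 S2 by (simp add: expectation_W2 prob_space)
  finally show ?thesis .
qed

text \<open>The copy \<open>D' i\<close> omits the \<open>i\<close>-th summands inside the two
  squares, hence it is a function of the other observations. The price is linear in \<open>a\<close>
  and \<open>b\<close>, so the two tails contribute separately, 78 each; removing the weight
  \<open>S\<close> doubles this.\<close>

theorem quadratic_concentration:
  fixes p q :: "'i \<Rightarrow> real \<Rightarrow> real"
  assumes p [measurable]: "\<And>j. p j \<in> borel_measurable borel"
    and p_le: "\<And>j x. j \<in> I \<Longrightarrow> \<bar>p j x\<bar> \<le> 1"
    and p_centred: "\<And>j. j \<in> I \<Longrightarrow> expectation (\<lambda>\<omega>. p j (X j \<omega>)) = 0"
    and p_var: "(\<Sum>j\<in>I. expectation (\<lambda>\<omega>. (p j (X j \<omega>))\<^sup>2)) \<le> 1"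
    and q [measurable]: "\<And>j. q j \<in> borel_measurable borel"
    and q_le: "\<And>j x. j \<in> I \<Longrightarrow> \<bar>q j x\<bar> \<le> 1"
    and q_centred: "\<And>j. j \<in> I \<Longrightarrow> expectation (\<lambda>\<omega>. q j (X j \<omega>)) = 0"
    and q_var: "(\<Sum>j\<in>I. expectation (\<lambda>\<omega>. (q j (X j \<omega>))\<^sup>2)) \<le> 1"
    and a: "0 \<le> a" and b: "0 \<le> b"
  defines "D \<equiv> \<lambda>\<omega>. a * ((\<Sum>j\<in>I. p j (X j \<omega>))\<^sup>2 + 1) + b * ((\<Sum>j\<in>I. q j (X j \<omega>))\<^sup>2 + 1)"
  shows "prob {\<omega>\<in>space M. \<bar>W \<omega> - z\<bar> \<le> D \<omega>} \<le> 6 * \<delta> + 156 * (a + b)"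
proof -
  let ?A = "\<lambda>\<omega>. \<Sum>j\<in>I. p j (X j \<omega>)" and ?B = "\<lambda>\<omega>. \<Sum>j\<in>I. q j (X j \<omega>)"
  let ?E = "{\<omega>\<in>space M. \<bar>W \<omega> - z\<bar> \<le> D \<omega>}"
  define D' where "D' i \<omega> = a * ((?A \<omega> - p i (X i \<omega>))\<^sup>2 + 1) + b * ((?B \<omega> - q i (X i \<omega>))\<^sup>2 + 1)" for i \<omega>
  have bmp: "bdd_meas M (\<lambda>\<omega>. p j (X j \<omega>))" "bdd_meas M (\<lambda>\<omega>. q j (X j \<omega>))"
    if "j \<in> I" for j
    using that p_le q_le by (auto intro!: bdd_measI[of _ _ 1])
  have bmA: "bdd_meas M ?A" and bmB: "bdd_meas M ?B"
    by (intro bdd_meas_intros bmp; assumption)+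
  have bmD: "bdd_meas M D"
    unfolding D_def by (intro bdd_meas_intros bmA bmB)
  have bmD': "bdd_meas M (D' i)" if "i \<in> I" for i
    unfolding D'_def[abs_def] by (intro bdd_meas_intros bmA bmB bmp that)
  have [measurable]: "D \<in> borel_measurable M" using bmD by auto
  have E: "?E \<in> sets M" by measurable
  have conc: "expectation (\<lambda>\<omega>. indicator ?E \<omega> * S \<omega>)
    \<le> expectation (\<lambda>\<omega>. \<bar>W \<omega>\<bar> * (D \<omega> + \<delta>)) + (\<Sum>i\<in>I. expectation (\<lambda>\<omega>. \<bar>g i (X i \<omega>)\<bar> * \<bar>D \<omega> - D' i \<omega>\<bar>))"
  proof (rule randomized_concentration[OF bmD _ bmD'])
    show "0 \<le> D \<omega>" for \<omega> using a b by (simp add: D_def)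
    fix i assume i: "i \<in> I"
    let ?h = "\<lambda>(w, s, t). clip (a * (s\<^sup>2 + 1) + b * (t\<^sup>2 + 1) + \<delta>) (w - z)"
    have "?h \<in> borel_measurable borel"
      unfolding clip_def borel_prod[symmetric] by measurable
    moreover have "bdd_meas M (\<lambda>\<omega>. clip (D' i \<omega> + \<delta>) (W \<omega> - g i (X i \<omega>) - z))"
      by (intro bdd_meas_intros bmD' i)
    ultimately show "expectation (\<lambda>\<omega>. g i (X i \<omega>) * clip (D' i \<omega> + \<delta>) (W \<omega> - g i (X i \<omega>) - z)) = 0"
      using leave_one_out[of i "g i" g p q ?h] i g_centred[OF i] bm_g[OF i]
      by (simp add: W_minus_summand sum_minus_summand D'_def)
  qed
  let ?P = "\<lambda>\<omega>. \<bar>W \<omega>\<bar> * ((?A \<omega>)\<^sup>2 + 1)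
     + (\<Sum>i\<in>I. \<bar>g i (X i \<omega>)\<bar> * \<bar>(?A \<omega>)\<^sup>2 - (?A \<omega> - p i (X i \<omega>))\<^sup>2\<bar>)"
  let ?Q = "\<lambda>\<omega>. \<bar>W \<omega>\<bar> * ((?B \<omega>)\<^sup>2 + 1)
     + (\<Sum>i\<in>I. \<bar>g i (X i \<omega>)\<bar> * \<bar>(?B \<omega>)\<^sup>2 - (?B \<omega> - q i (X i \<omega>))\<^sup>2\<bar>)"
  have bmP: "bdd_meas M ?P" "bdd_meas M ?Q"
    by (intro bdd_meas_intros bmA bmB bmp; assumption)+
  have bmG: "bdd_meas M (\<lambda>\<omega>. \<bar>W \<omega>\<bar> * (D \<omega> + \<delta>))"
    "\<And>i. i \<in> I \<Longrightarrow> bdd_meas M (\<lambda>\<omega>. \<bar>g i (X i \<omega>)\<bar> * \<bar>D \<omega> - D' i \<omega>\<bar>)"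
    by (intro bdd_meas_intros bmD bmD'; assumption)+
  have bmS: "bdd_meas M (\<lambda>\<omega>. \<Sum>i\<in>I. \<bar>g i (X i \<omega>)\<bar> * \<bar>D \<omega> - D' i \<omega>\<bar>)"
    by (intro bdd_meas_intros bmG)
  have "expectation (\<lambda>\<omega>. \<bar>W \<omega>\<bar> * (D \<omega> + \<delta>)) + (\<Sum>i\<in>I. expectation (\<lambda>\<omega>. \<bar>g i (X i \<omega>)\<bar> * \<bar>D \<omega> - D' i \<omega>\<bar>))
     = expectation (\<lambda>\<omega>. \<bar>W \<omega>\<bar> * (D \<omega> + \<delta>) + (\<Sum>i\<in>I. \<bar>g i (X i \<omega>)\<bar> * \<bar>D \<omega> - D' i \<omega>\<bar>))"
    by (simp add: bmG bmS integrable_bdd_meas)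
  also have "\<dots> \<le> expectation (\<lambda>\<omega>. \<delta> * \<bar>W \<omega>\<bar> + a * ?P \<omega> + b * ?Q \<omega>)"
  proof (intro integral_mono integrable_bdd_meas)
    show "bdd_meas M (\<lambda>\<omega>. \<bar>W \<omega>\<bar> * (D \<omega> + \<delta>) + (\<Sum>i\<in>I. \<bar>g i (X i \<omega>)\<bar> * \<bar>D \<omega> - D' i \<omega>\<bar>))"
      by (intro bdd_meas_add bmG bmS)
    show "bdd_meas M (\<lambda>\<omega>. \<delta> * \<bar>W \<omega>\<bar> + a * ?P \<omega> + b * ?Q \<omega>)"
      by (rule bdd_meas_add bdd_meas_mult bdd_meas_const
          bmP bdd_meas_abs bm_W)+
    fix \<omega>
    have "(\<Sum>i\<in>I. \<bar>g i (X i \<omega>)\<bar> * \<bar>D \<omega> - D' i \<omega>\<bar>)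
      \<le> (\<Sum>i\<in>I. a * (\<bar>g i (X i \<omega>)\<bar> * \<bar>(?A \<omega>)\<^sup>2 - (?A \<omega> - p i (X i \<omega>))\<^sup>2\<bar>)
          + b * (\<bar>g i (X i \<omega>)\<bar> * \<bar>(?B \<omega>)\<^sup>2 - (?B \<omega> - q i (X i \<omega>))\<^sup>2\<bar>))"
    proof (rule sum_mono)
      fix i
      have "D \<omega> - D' i \<omega> = a * ((?A \<omega>)\<^sup>2 - (?A \<omega> - p i (X i \<omega>))\<^sup>2) + b * ((?B \<omega>)\<^sup>2 - (?B \<omega> - q i (X i \<omega>))\<^sup>2)"
        by (simp add: D_def D'_def algebra_simps)
      also have "\<bar>\<dots>\<bar> \<le> a * \<bar>(?A \<omega>)\<^sup>2 - (?A \<omega> - p i (X i \<omega>))\<^sup>2\<bar> + b * \<bar>(?B \<omega>)\<^sup>2 - (?B \<omega> - q i (X i \<omega>))\<^sup>2\<bar>"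
        using a b by (intro order_trans[OF abs_triangle_ineq]) (simp add: abs_mult)
      finally have "\<bar>g i (X i \<omega>)\<bar> * \<bar>D \<omega> - D' i \<omega>\<bar> \<le> \<bar>g i (X i \<omega>)\<bar> *
          (a * \<bar>(?A \<omega>)\<^sup>2 - (?A \<omega> - p i (X i \<omega>))\<^sup>2\<bar> + b * \<bar>(?B \<omega>)\<^sup>2 - (?B \<omega> - q i (X i \<omega>))\<^sup>2\<bar>)"
        by (intro mult_left_mono) auto
      then show "\<bar>g i (X i \<omega>)\<bar> * \<bar>D \<omega> - D' i \<omega>\<bar>
        \<le> a * (\<bar>g i (X i \<omega>)\<bar> * \<bar>(?A \<omega>)\<^sup>2 - (?A \<omega> - p i (X i \<omega>))\<^sup>2\<bar>)
          + b * (\<bar>g i (X i \<omega>)\<bar> * \<bar>(?B \<omega>)\<^sup>2 - (?B \<omega> - q i (X i \<omega>))\<^sup>2\<bar>)"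
        by (simp only: distrib_left mult.left_commute[of "\<bar>g i (X i \<omega>)\<bar>"])
    qed
    then show "\<bar>W \<omega>\<bar> * (D \<omega> + \<delta>) + (\<Sum>i\<in>I. \<bar>g i (X i \<omega>)\<bar> * \<bar>D \<omega> - D' i \<omega>\<bar>)
        \<le> \<delta> * \<bar>W \<omega>\<bar> + a * ?P \<omega> + b * ?Q \<omega>"
      unfolding sum.distrib sum_distrib_left[symmetric] D_def
      by (simp only: distrib_left mult.left_commute[of "\<bar>W \<omega>\<bar>"] mult.commute[of "\<bar>W \<omega>\<bar>" \<delta>])
  qed
  also have "\<dots> = \<delta> * expectation (\<lambda>\<omega>. \<bar>W \<omega>\<bar>) + a * expectation ?P + b * expectation ?Q"
    by (simp only: Bochner_Integration.integral_add Bochner_Integration.integrable_add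
        integral_mult_right_zero integrable_mult_right bmP[THEN integrable_bdd_meas]
        bm_W[THEN bdd_meas_abs, THEN integrable_bdd_meas])
  also have "\<dots> \<le> \<delta> * 1 + a * 78 + b * 78"
    using \<delta>_pos a b
    by (intro add_mono mult_left_mono expectation_abs_W
        quadratic_perturbation_cost[OF p p_le p_centred p_var]
        quadratic_perturbation_cost[OF q q_le q_centred q_var]) auto
  finally have E_S: "expectation (\<lambda>\<omega>. indicator ?E \<omega> * S \<omega>) \<le> \<delta> + 78 * (a + b)"
    using conc by simp
  have int1: "integrable M (\<lambda>\<omega>. indicator ?E \<omega> * S \<omega>)"
    using E by (intro integrable_bdd_meas bdd_meas_intros)
  have int2: "integrable M (\<lambda>\<omega>. (S \<omega> - 1)\<^sup>2)"
    by (intro integrable_bdd_meas bdd_meas_intros)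
  have "prob ?E = expectation (indicator ?E)" using E by simp
  also have "\<dots> \<le> expectation (\<lambda>\<omega>. 2 * (indicator ?E \<omega> * S \<omega>) + 4 * (S \<omega> - 1)\<^sup>2)"
  proof (intro integral_mono)
    show "integrable M (indicator ?E :: _ \<Rightarrow> real)"
      using E by (intro integrable_bdd_meas bdd_meas_intros)
    show "integrable M (\<lambda>\<omega>. 2 * (indicator ?E \<omega> * S \<omega>) + 4 * (S \<omega> - 1)\<^sup>2)"
      by (intro Bochner_Integration.integrable_add integrable_mult_right int1 int2)
    fix \<omega>
    \<comment> \<open>This removes the weight: where \<open>S \<ge> 1 / 2\<close> it is at least one
      half, and elsewhere \<open>4 * (S - 1)\<^sup>2 \<ge> 1\<close>, an event already paid for by
      the second moment of \<open>S - 1\<close>.\<close>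
    show "indicator ?E \<omega> \<le> 2 * (indicator ?E \<omega> * S \<omega>) + 4 * (S \<omega> - 1)\<^sup>2"
    proof (cases "1 / 2 \<le> S \<omega>")
      case True
      then have "1 \<le> 2 * S \<omega> + 4 * (S \<omega> - 1)\<^sup>2" using zero_le_power2[of "S \<omega> - 1"] by linarith
      then show ?thesis by (auto simp: indicator_def)
    next
      case False
      then have "(1 / 2)\<^sup>2 \<le> (1 - S \<omega>)\<^sup>2" by (intro power_mono) auto
      then have "1 \<le> 4 * (S \<omega> - 1)\<^sup>2" by (simp add: power2_commute power_divide)
      then show ?thesis using S_nonneg[of \<omega>] by (auto simp: indicator_def)
    qed
  qed
  also have "\<dots> = 2 * expectation (\<lambda>\<omega>. indicator ?E \<omega> * S \<omega>) + 4 * expectation (\<lambda>\<omega>. (S \<omega> - 1)\<^sup>2)"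
    by (simp only: Bochner_Integration.integral_add integral_mult_right_zero integrable_mult_right int1 int2)
  also have "\<dots> \<le> 2 * (\<delta> + 78 * (a + b)) + 4 * \<delta>\<^sup>2"
    using E_S expectation_S_minus_1_square by (intro add_mono mult_left_mono) auto
  also have "\<dots> \<le> 6 * \<delta> + 156 * (a + b)"
    using \<delta>_pos \<delta>_le mult_left_le[of \<delta> \<delta>] by (simp add: power2_eq_square)
  finally show ?thesis .
qed

end

section \<open>Trimming and Winsorizing\<close>

text \<open>In a sorted list the elements with a downward closed property form an initial segment.
  Arbitrary \<open>P\<close> covers weak and strict inequalities at once; both are needed, as the
  lower tail is counted by \<open>\<le>\<close> and the upper tail by \<open>\<ge>\<close>.\<close>

lemma sorted_nth_down_closed_iff:
  assumes "sorted s" "i < length s" "\<And>x y. x \<le> y \<Longrightarrow> P y \<Longrightarrow> P x"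
  shows "P (s ! i) \<longleftrightarrow> i < length (filter P s)"
  using assms(1,2)
proof (induction s arbitrary: i)
  case (Cons a s)
  show ?case
  proof (cases "P a")
    case True
    then show ?thesis using Cons by (cases i) auto
  next
    case False
    then have "\<not> P x" if "x \<in> set (a # s)" for x
      using Cons.prems(1) assms(3) that by auto
    moreover from this have "filter P (a # s) = []" by (auto simp: filter_empty_conv)
    ultimately show ?thesis using Cons.prems(2) by (metis list.size(3) not_less_zero nth_mem)
  qed
qed simp

lemma length_filter_sort_map:
  "length (filter P (sort (map x [1..<Suc n]))) = card {j \<in> {1..n}. P (x j)}"
proof -
  have "length (filter P (sort (map x [1..<Suc n]))) = length (filter P (map x [1..<Suc n]))"
    by (metis filter_sort length_sort)
  also have "\<dots> = length (filter (\<lambda>j. P (x j)) [1..<Suc n])"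
    by (simp add: filter_map comp_def del: upt_Suc)
  also have "\<dots> = card {j \<in> {1..n}. P (x j)}"
    by (subst distinct_card[symmetric])
       (auto simp del: upt_Suc intro!: arg_cong[of _ _ card])
  finally show ?thesis .
qed

lemma sort_nth_iff:
  fixes x :: "nat \<Rightarrow> real"
  assumes "i < n"
  shows "sort (map x [1..<Suc n]) ! i \<le> c \<longleftrightarrow> i < card {j \<in> {1..n}. x j \<le> c}"
    and "sort (map x [1..<Suc n]) ! i < c \<longleftrightarrow> i < card {j \<in> {1..n}. x j < c}"
proof -
  have "i < length (sort (map x [1..<Suc n]))" using assms by simp
  note * = sorted_nth_down_closed_iff[OF sorted_sort this, unfolded length_filter_sort_map]
  show "sort (map x [1..<Suc n]) ! i \<le> c \<longleftrightarrow> i < card {j \<in> {1..n}. x j \<le> c}"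
    by (rule *) (rule order_trans)
  show "sort (map x [1..<Suc n]) ! i < c \<longleftrightarrow> i < card {j \<in> {1..n}. x j < c}"
    by (rule *) (rule order_le_less_trans)
qed

lemma sum_sort_map:
  fixes f :: "real \<Rightarrow> real"
  shows "(\<Sum>i<n. f (sort (map x [1..<Suc n]) ! i)) = (\<Sum>j=1..n. f (x j))"
proof -
  let ?s = "sort (map x [1..<Suc n])"
  have "(\<Sum>i<n. f (?s ! i)) = sum_list (map f ?s)"
    by (simp add: sum_list_sum_nth atLeast0LessThan del: upt_Suc)
  also have "\<dots> = sum_mset (image_mset f (mset ?s))"
    by (metis mset_map sum_mset_sum_list)
  also have "\<dots> = sum_list (map f (map x [1..<Suc n]))"
    by (metis mset_map mset_sort sum_mset_sum_list)
  also have "\<dots> = (\<Sum>j=1..n. f (x j))"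
    by (simp add: comp_def interv_sum_list_conv_sum_set_nat atLeastLessThanSuc_atLeastAtMost del: upt_Suc)
  finally show ?thesis .
qed

text \<open>If fewer than \<open>k\<close> values are at most \<open>a\<close>, the ranks between
  \<open>A\<close> and \<open>k\<close> hold values just above \<open>a\<close>; if more, those
  between \<open>k\<close> and \<open>A\<close> hold values just below. The hypotheses put enough
  observations within \<open>h\<close> of \<open>a\<close> on either side to confine these values,
  and likewise at \<open>b\<close>.\<close>

lemma trimmed_minus_winsorized_le:
  fixes x :: "nat \<Rightarrow> real"
  assumes km: "k < n - m" and ab: "a \<le> b" and h: "0 \<le> h" "0 \<le> h'"
  defines "A \<equiv> card {j \<in> {1..n}. x j \<le> a}" and "B \<equiv> card {j \<in> {1..n}. b \<le> x j}"
  assumes a1: "\<bar>int A - int k\<bar> \<le> int (card {j \<in> {1..n}. a < x j \<and> x j \<le> a + h})"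
    and a2: "\<bar>int A - int k\<bar> \<le> int (card {j \<in> {1..n}. a - h \<le> x j \<and> x j \<le> a})"
    and b1: "\<bar>int B - int m\<bar> \<le> int (card {j \<in> {1..n}. b - h' \<le> x j \<and> x j < b})"
    and b2: "\<bar>int B - int m\<bar> \<le> int (card {j \<in> {1..n}. b \<le> x j \<and> x j \<le> b + h'})"
  shows "\<bar>(\<Sum>i=k..<n - m. sort (map x [1..<Suc n]) ! i) + real k * a + real m * b
           - (\<Sum>j=1..n. max a (min (x j) b))\<bar>
         \<le> \<bar>real A - real k\<bar> * h + \<bar>real B - real m\<bar> * h'"
proof -
  define s where "s = sort (map x [1..<Suc n])"
  define c where "c y = max a (min y b)" for y
  \<comment> \<open>At index \<open>i\<close>, counted from 0, this compares the sorted sample with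
    its trimmed positions overwritten by \<open>a\<close> and \<open>b\<close> to the Winsorized
    sample. It vanishes outside the index ranges \<open>Ra\<close> and \<open>Rb\<close>, whose
    lengths are the discrepancies of the two counts.\<close>
  define t where "t i = (if i < k then a else if i < n - m then s ! i else b) - c (s ! i)" for i
  define Ra where "Ra = {min A k..<max A k}"
  define Rb where "Rb = {n - max B m..<n - min B m}"
  have B_le: "B \<le> n"
    unfolding B_def by (rule order_trans[OF card_mono[of "{1..n}"]]) auto
  have card_Un: "card {j \<in> {1..n}. P j} + card {j \<in> {1..n}. Q j} = card {j \<in> {1..n}. R j}"
    if "\<And>j. R j = (P j \<or> Q j)" "\<And>j. \<not> (P j \<and> Q j)" for P Q R :: "nat \<Rightarrow> bool"
    using that by (subst card_Un_disjoint[symmetric]) (auto intro!: arg_cong[of _ _ card])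
  have lt_b: "card {j \<in> {1..n}. x j < b} = n - B"
  proof -
    have "card {j \<in> {1..n}. x j < b} + B = card {j \<in> {1..n}. True}"
      unfolding B_def by (rule card_Un) auto
    moreover have "{j \<in> {1..n}. True} = {1..n}" by auto
    ultimately show ?thesis by simp
  qed
  have c1: "A + card {j \<in> {1..n}. a < x j \<and> x j \<le> a + h} = card {j \<in> {1..n}. x j \<le> a + h}"
    unfolding A_def using h by (intro card_Un) auto
  have c2: "card {j \<in> {1..n}. x j < a - h} + card {j \<in> {1..n}. a - h \<le> x j \<and> x j \<le> a} = A"
    unfolding A_def using h by (intro card_Un) auto
  have c3: "card {j \<in> {1..n}. x j < b - h'} + card {j \<in> {1..n}. b - h' \<le> x j \<and> x j < b} = n - B"
    unfolding lt_b[symmetric] using h by (intro card_Un) auto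
  have c4: "(n - B) + card {j \<in> {1..n}. b \<le> x j \<and> x j \<le> b + h'} = card {j \<in> {1..n}. x j \<le> b + h'}"
    unfolding lt_b[symmetric] using h by (intro card_Un) auto
  have le_iff: "s ! i \<le> y \<longleftrightarrow> i < card {j \<in> {1..n}. x j \<le> y}"
    and less_iff: "s ! i < y \<longleftrightarrow> i < card {j \<in> {1..n}. x j < y}" if "i < n" for i y
    using sort_nth_iff[OF that, of x y] by (simp_all add: s_def)
  have bound: "\<bar>t i\<bar> \<le> h * indicator Ra i + h' * indicator Rb i" if i: "i < n" for i
  proof -
    have leA: "s ! i \<le> a \<longleftrightarrow> i < A" using le_iff[OF i] by (simp add: A_def)
    have ltB: "s ! i < b \<longleftrightarrow> i < n - B" unfolding less_iff[OF i] lt_b ..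
    consider "i < k" | "k \<le> i" "i < n - m" | "n - m \<le> i" using km by linarith
    then show ?thesis
    proof cases
      case 1
      then have t: "t i = a - c (s ! i)" by (simp add: t_def)
      show ?thesis
      proof (cases "i < A")
        case True
        then have "t i = 0" using leA ab by (auto simp: t c_def)
        then show ?thesis using h by simp
      next
        case False
        then have "s ! i \<le> a + h" using 1 c1 a1 le_iff[OF i, of "a + h"] by linarith
        then have "\<bar>t i\<bar> \<le> h" using False leA ab h by (auto simp: t c_def)
        moreover have "i \<in> Ra" using 1 False by (auto simp: Ra_def)
        ultimately show ?thesis using h by (auto simp: indicator_def)
      qed
    next
      case 2
      then have t: "t i = s ! i - c (s ! i)" by (simp add: t_def)
      consider "s ! i < a" | "a \<le> s ! i" "s ! i \<le> b" | "b < s ! i" by linarith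
      then show ?thesis
      proof cases
        case lt: 1
        then have "i < A" using leA by simp
        moreover have "\<not> s ! i < a - h" using 2 c2 a2 less_iff[OF i, of "a - h"] calculation by linarith
        ultimately have "\<bar>t i\<bar> \<le> h" "i \<in> Ra" using lt ab 2 by (auto simp: t c_def Ra_def)
        then show ?thesis using h by (auto simp: indicator_def)
      next
        case 2
        then have "t i = 0" by (simp add: t c_def)
        then show ?thesis using h by simp
      next
        case gt: 3
        then have "n - B \<le> i" using ltB by simp
        moreover have "s ! i \<le> b + h'" using 2 c4 b2 le_iff[OF i, of "b + h'"] calculation B_le by linarith
        ultimately have "\<bar>t i\<bar> \<le> h'" "i \<in> Rb" using gt ab 2 by (auto simp: t c_def Rb_def)
        then show ?thesis using h by (auto simp: indicator_def)
      qed
    next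
      case 3
      then have t: "t i = b - c (s ! i)" using km by (simp add: t_def)
      show ?thesis
      proof (cases "s ! i < b")
        case False
        then have "t i = 0" using ab by (auto simp: t c_def)
        then show ?thesis using h by simp
      next
        case True
        then have "i < n - B" using ltB by simp
        moreover have "\<not> s ! i < b - h'" using 3 c3 b1 less_iff[OF i, of "b - h'"] calculation B_le by linarith
        ultimately have "\<bar>t i\<bar> \<le> h'" "i \<in> Rb" using True ab 3 by (auto simp: t c_def Rb_def)
        then show ?thesis using h by (auto simp: indicator_def)
      qed
    qed
  qed
  have "(\<Sum>i<n. t i) = (\<Sum>i<n. if i < k then a else if i < n - m then s ! i else b) - (\<Sum>i<n. c (s ! i))"
    by (simp add: t_def sum_subtractf)
  also have "(\<Sum>i<n. if i < k then a else if i < n - m then s ! i else b)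
     = (\<Sum>i<k. a) + (\<Sum>i=k..<n - m. s ! i) + (\<Sum>i=n - m..<n. b)"
  proof -
    have sets: "{..<n} = ({..<k} \<union> {k..<n - m}) \<union> {n - m..<n}" using km by auto
    have split: "sum F {..<n} = sum F {..<k} + sum F {k..<n - m} + sum F {n - m..<n}" for F :: "nat \<Rightarrow> real"
    proof -
      have "sum F {..<n} = sum F ({..<k} \<union> {k..<n - m}) + sum F {n - m..<n}"
        unfolding sets using km by (intro sum.union_disjoint) auto
      also have "sum F ({..<k} \<union> {k..<n - m}) = sum F {..<k} + sum F {k..<n - m}"
        by (intro sum.union_disjoint) auto
      finally show ?thesis .
    qed
    show ?thesis
      unfolding split using km by (intro arg_cong2[of _ _ _ _ "(+)"] sum.cong) auto
  qed
  also have "(\<Sum>i<n. c (s ! i)) = (\<Sum>j=1..n. max a (min (x j) b))"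
    unfolding s_def c_def by (rule sum_sort_map[of "\<lambda>y. max a (min y b)"])
  finally have eq: "(\<Sum>i=k..<n - m. s ! i) + real k * a + real m * b - (\<Sum>j=1..n. max a (min (x j) b))
      = (\<Sum>i<n. t i)"
    using km by simp
  have "\<bar>\<Sum>i<n. t i\<bar> \<le> (\<Sum>i<n. \<bar>t i\<bar>)" by (rule sum_abs)
  also have "\<dots> \<le> (\<Sum>i<n. h * indicator Ra i + h' * indicator Rb i)"
    by (intro sum_mono bound) simp
  also have "\<dots> = h * (\<Sum>i<n. indicator Ra i) + h' * (\<Sum>i<n. indicator Rb i)"
    by (simp add: sum.distrib sum_distrib_left)
  also have "\<dots> \<le> h * real (card Ra) + h' * real (card Rb)"
  proof (intro add_mono mult_left_mono)
    have "(\<Sum>i<n. indicator R i) = real (card ({..<n} \<inter> R))" for R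
      by (simp add: indicator_def sum.If_cases Int_def)
    then show "(\<Sum>i<n. indicator Ra i) \<le> real (card Ra)" "(\<Sum>i<n. indicator Rb i) \<le> real (card Rb)"
      by (auto simp: Ra_def Rb_def simp del: card_atLeastLessThan intro!: card_mono)
  qed (use h in auto)
  also have "\<dots> \<le> h * \<bar>real A - real k\<bar> + h' * \<bar>real B - real m\<bar>"
    using h km B_le by (intro add_mono mult_left_mono)
      (auto simp: Ra_def Rb_def min_def max_def)
  finally show ?thesis unfolding eq[symmetric] s_def by (simp add: mult.commute)
qed

section \<open>Numbers of observations in intervals\<close>

context finite_indep_family
begin

lemma count_measurable [measurable]:
  assumes "C \<in> sets borel"
  shows "(\<lambda>\<omega>. real (card {j \<in> I. X j \<omega> \<in> C})) \<in> borel_measurable M"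
proof -
  have "real (card {j \<in> I. X j \<omega> \<in> C}) = (\<Sum>j\<in>I. indicator C (X j \<omega>))" for \<omega>
    by (simp add: finite_index indicator_def sum.If_cases Int_def)
  then show ?thesis using assms by simp
qed

lemma sum_centred_indicator:
  "(\<Sum>j\<in>I. indicator C (X j \<omega>) - u) = real (card {j \<in> I. X j \<omega> \<in> C}) - real (card I) * u"
  by (simp add: sum_subtractf finite_index indicator_def sum.If_cases Int_def)

lemma centred_indicator_moments:
  assumes C: "C \<in> sets borel" and i: "i \<in> I" and u: "prob {\<omega>\<in>space M. X i \<omega> \<in> C} = u"
  shows "expectation (\<lambda>\<omega>. indicator C (X i \<omega>) - u) = 0"
    and "expectation (\<lambda>\<omega>. (indicator C (X i \<omega>) - u)\<^sup>2) \<le> u"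
proof -
  note [measurable] = C X_measurable[OF i]
  have e: "{\<omega>\<in>space M. X i \<omega> \<in> C} \<in> sets M" by measurable
  have "expectation (\<lambda>\<omega>. indicator C (X i \<omega>)) = expectation (indicator {\<omega>\<in>space M. X i \<omega> \<in> C})"
    by (intro Bochner_Integration.integral_cong) (auto simp: indicator_def)
  also have "\<dots> = u" using e u by simp
  finally have E: "expectation (\<lambda>\<omega>. indicator C (X i \<omega>)) = u" .
  have bm: "bdd_meas M (\<lambda>\<omega>. indicator C (X i \<omega>))"
    by (rule bdd_measI[of _ _ 1]) (auto simp: indicator_def)
  note int = integrable_bdd_meas[OF bm]
  show "expectation (\<lambda>\<omega>. indicator C (X i \<omega>) - u) = 0"
    using int E by (simp add: prob_space)
  have "(indicator C y - u)\<^sup>2 = (1 - 2 * u) * indicator C y + u\<^sup>2" for y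
    by (auto simp: indicator_def power2_eq_square algebra_simps)
  then have "expectation (\<lambda>\<omega>. (indicator C (X i \<omega>) - u)\<^sup>2) = (1 - 2 * u) * u + u\<^sup>2"
    using int E by (simp add: prob_space)
  also have "\<dots> \<le> u" by (simp add: power2_eq_square algebra_simps)
  finally show "expectation (\<lambda>\<omega>. (indicator C (X i \<omega>) - u)\<^sup>2) \<le> u" .
qed

text \<open>Having fewer than \<open>i\<close> hits, with mean \<open>v \<ge> 4 * (i + L)\<close>,
  is a deviation of at least \<open>3 / 4 * v\<close>. Chernoff's bound with parameter 1/2 has
  exponent \<open>v / 4 - 3 / 8 * v = - v / 8\<close>, which is at most
  \<open>- L / 2\<close>.\<close>

lemma prob_count_less:
  assumes C [measurable]: "C \<in> sets borel" and u: "\<And>j. j \<in> I \<Longrightarrow> prob {\<omega>\<in>space M. X j \<omega> \<in> C} = u"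
    and L: "0 \<le> L" and big: "4 * (real i + L) \<le> real (card I) * u"
  shows "prob {\<omega>\<in>space M. card {j \<in> I. X j \<omega> \<in> C} < i} \<le> exp (- L / 2)"
\<comment> \<open>For empty \<open>I\<close> nothing is known about \<open>u\<close>, but then
  \<open>big\<close> forces \<open>i = 0\<close>.\<close>
proof (cases "I = {}")
  case True
  with L big have "i = 0" by simp
  then show ?thesis by simp
next
  case False
  then have u01: "0 \<le> u" "u \<le> 1" using u by (force intro: measure_nonneg prob_le_1)+
  let ?v = "real (card I) * u"
  have "{\<omega>\<in>space M. card {j \<in> I. X j \<omega> \<in> C} < i}
      \<subseteq> {\<omega>\<in>space M. 3 / 4 * ?v \<le> (\<Sum>j\<in>I. - (indicator C (X j \<omega>) - u))}"
  proof safe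
    fix \<omega> assume "card {j \<in> I. X j \<omega> \<in> C} < i"
    then have "real (card {j \<in> I. X j \<omega> \<in> C}) < real i" by simp
    moreover have "4 * real i + 4 * L \<le> ?v" using big by simp
    moreover have "(\<Sum>j\<in>I. - (indicator C (X j \<omega>) - u)) = ?v - real (card {j \<in> I. X j \<omega> \<in> C})"
      by (subst sum_negf) (simp add: sum_centred_indicator)
    ultimately show "3 / 4 * ?v \<le> (\<Sum>j\<in>I. - (indicator C (X j \<omega>) - u))"
      using L by linarith
  qed
  then have "prob {\<omega>\<in>space M. card {j \<in> I. X j \<omega> \<in> C} < i}
      \<le> prob {\<omega>\<in>space M. 3 / 4 * ?v \<le> (\<Sum>j\<in>I. - (indicator C (X j \<omega>) - u))}"
    by (rule finite_measure_mono) measurable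
  also have "\<dots> \<le> exp ((1 / 2)\<^sup>2 * ?v - 1 / 2 * (3 / 4 * ?v))"
  proof (rule chernoff_sum[where p = "\<lambda>_ y. - (indicator C y - u)"])
    show "\<bar>1 / 2 * - (indicator C x - u)\<bar> \<le> 1" for x
      using u01 by (auto simp: indicator_def)
    show "expectation (\<lambda>\<omega>. - (indicator C (X j \<omega>) - u)) = 0" if "j \<in> I" for j
      using centred_indicator_moments(1)[OF C that u[OF that]]
      by (subst Bochner_Integration.integral_minus) simp
    show "(\<Sum>j\<in>I. expectation (\<lambda>\<omega>. (- (indicator C (X j \<omega>) - u))\<^sup>2)) \<le> ?v"
      using sum_bounded_above[of I "\<lambda>j. expectation (\<lambda>\<omega>. (indicator C (X j \<omega>) - u)\<^sup>2)" u]
        centred_indicator_moments(2)[OF C _ u] by (simp add: power2_commute[of u])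
  qed simp_all
  also have "\<dots> = exp (- ?v / 8)" by (simp add: power2_eq_square)
  also have "\<dots> \<le> exp (- L / 2)" using big L by simp
  finally show ?thesis .
qed

text \<open>The interval to be inspected is chosen by the random number \<open>N \<omega>\<close>,
  computed from the same sample, so Chernoff's bound does not apply to it directly. It is applied to
  every possible value \<open>i\<close> instead: each fails with probability at most
  \<open>1 / k\<^sup>2\<close>, and there are at most \<open>k\<close> of them. With
  \<open>1 / k\<close> for each direction of deviation of the tail count, the total is
  \<open>4 / k\<close>.\<close>

lemma tail_counts:
  fixes U V :: "nat \<Rightarrow> real set" and k :: nat
  assumes C [measurable]: "C \<in> sets borel" and C_prob: "\<And>j. j \<in> I \<Longrightarrow> prob {\<omega>\<in>space M. X j \<omega> \<in> C} = \<alpha>"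
    and alpha: "real (card I) * \<alpha> = real k"
    and k: "2 \<le> k" "4 * ln (real k) \<le> real k"
    and U [measurable]: "\<And>i. U i \<in> sets borel" and V [measurable]: "\<And>i. V i \<in> sets borel"
    and U_prob: "\<And>i j. real i \<le> 2 * sqrt (k * ln k) \<Longrightarrow> j \<in> I \<Longrightarrow> prob {\<omega>\<in>space M. X j \<omega> \<in> U i} = u i"
    and V_prob: "\<And>i j. real i \<le> 2 * sqrt (k * ln k) \<Longrightarrow> j \<in> I \<Longrightarrow> prob {\<omega>\<in>space M. X j \<omega> \<in> V i} = v i"
    and U_big: "\<And>i. real i \<le> 2 * sqrt (k * ln k) \<Longrightarrow> 4 * (real i + 4 * ln (real k)) \<le> real (card I) * u i"
    and V_big: "\<And>i. real i \<le> 2 * sqrt (k * ln k) \<Longrightarrow> 4 * (real i + 4 * ln (real k)) \<le> real (card I) * v i"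
  defines "N \<equiv> \<lambda>\<omega>. nat \<bar>int (card {j \<in> I. X j \<omega> \<in> C}) - int k\<bar>"
  obtains G where "G \<in> sets M" "prob (space M - G) \<le> 4 / real k"
    "\<And>\<omega>. \<omega> \<in> G \<Longrightarrow> real (N \<omega>) \<le> 2 * sqrt (k * ln k)"
    "\<And>\<omega>. \<omega> \<in> G \<Longrightarrow> N \<omega> \<le> card {j \<in> I. X j \<omega> \<in> U (N \<omega>)}"
    "\<And>\<omega>. \<omega> \<in> G \<Longrightarrow> N \<omega> \<le> card {j \<in> I. X j \<omega> \<in> V (N \<omega>)}"
proof -
  let ?J = "2 * sqrt (k * ln k)" and ?Z = "\<lambda>\<omega>. \<Sum>j\<in>I. indicator C (X j \<omega>) - \<alpha>"
  have lnk: "0 < ln (real k)" using k by simp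
  \<comment> \<open>Zero is left out because the claims are trivial for
    \<open>N \<omega> = 0\<close>. The hypothesis \<open>4 * ln k \<le> k\<close> gives
    \<open>?J \<le> k\<close>, so the range up to \<open>k\<close> loses no other admissible
    value.\<close>
  define K where "K = {i \<in> {1..k}. real i \<le> ?J}"
  define B1 where "B1 = {\<omega>\<in>space M. ?J \<le> ?Z \<omega>} \<union> {\<omega>\<in>space M. ?J \<le> (\<Sum>j\<in>I. - (indicator C (X j \<omega>) - \<alpha>))}"
  define BU where "BU i = {\<omega>\<in>space M. card {j \<in> I. X j \<omega> \<in> U i} < i}" for i
  define BV where "BV i = {\<omega>\<in>space M. card {j \<in> I. X j \<omega> \<in> V i} < i}" for i
  define G where "G = space M - (B1 \<union> (\<Union>i\<in>K. BU i) \<union> (\<Union>i\<in>K. BV i))"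
  have [measurable]: "B1 \<in> sets M" unfolding B1_def by measurable
  have BU_eq: "BU i = {\<omega>\<in>space M. real (card {j \<in> I. X j \<omega> \<in> U i}) < real i}"
    and BV_eq: "BV i = {\<omega>\<in>space M. real (card {j \<in> I. X j \<omega> \<in> V i}) < real i}" for i
    by (simp_all add: BU_def BV_def)
  have [measurable]: "BU i \<in> sets M" "BV i \<in> sets M" for i
    unfolding BU_eq BV_eq by measurable
  have "finite K" by (simp add: K_def)
  have cardK: "real (card K) \<le> real k"
    unfolding K_def of_nat_le_iff by (rule order_trans[OF card_mono[of "{1..k}"]]) auto
  have dev: "prob {\<omega>\<in>space M. ?J \<le> (\<Sum>j\<in>I. e * (indicator C (X j \<omega>) - \<alpha>))} \<le> 1 / real k"
    if e: "e = 1 \<or> e = -1" for e :: real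
  proof -
    \<comment> \<open>This minimises the exponent \<open>l\<^sup>2 * k - l * ?J\<close>; the minimum
      is \<open>ln k - 2 * ln k = - ln k\<close>.\<close>
    define l where "l = sqrt (ln k / k)"
    have l: "0 < l" "l \<le> 1" "l\<^sup>2 = ln k / k" using lnk k by (auto simp: l_def)
    have lJ: "l * ?J = 2 * ln k"
      using k lnk by (simp add: l_def real_sqrt_mult[symmetric])
    have "I \<noteq> {}" using alpha k by auto
    then have a01: "0 \<le> \<alpha>" "\<alpha> \<le> 1" using C_prob by (force intro: measure_nonneg prob_le_1)+
    have "prob {\<omega>\<in>space M. ?J \<le> (\<Sum>j\<in>I. e * (indicator C (X j \<omega>) - \<alpha>))} \<le> exp (l\<^sup>2 * real k - l * ?J)"
    proof (rule chernoff_sum[where p = "\<lambda>_ y. e * (indicator C y - \<alpha>)"])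
      show "\<bar>l * (e * (indicator C x - \<alpha>))\<bar> \<le> 1" for x
      proof -
        have "\<bar>l\<bar> * (\<bar>e\<bar> * \<bar>indicator C x - \<alpha>\<bar>) \<le> 1 * (1 * 1)"
          using l a01 e by (intro mult_mono) (auto simp: indicator_def)
        then show ?thesis by (simp add: abs_mult)
      qed
      show "expectation (\<lambda>\<omega>. e * (indicator C (X j \<omega>) - \<alpha>)) = 0" if "j \<in> I" for j
        using centred_indicator_moments(1)[OF C that C_prob[OF that]]
        by (simp only: integral_mult_right_zero mult_zero_right)
      have "(\<Sum>j\<in>I. expectation (\<lambda>\<omega>. (e * (indicator C (X j \<omega>) - \<alpha>))\<^sup>2))
        = (\<Sum>j\<in>I. expectation (\<lambda>\<omega>. (indicator C (X j \<omega>) - \<alpha>)\<^sup>2))"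
        using e by (auto simp: power_mult_distrib)
      also have "\<dots> \<le> real (card I) * \<alpha>"
        by (intro sum_bounded_above centred_indicator_moments(2)[OF C _ C_prob])
      finally show "(\<Sum>j\<in>I. expectation (\<lambda>\<omega>. (e * (indicator C (X j \<omega>) - \<alpha>))\<^sup>2)) \<le> real k"
        by (simp add: alpha)
    qed (use l in auto)
    also have "l\<^sup>2 * real k - l * ?J = - ln k" using l k lJ by simp
    also have "exp (- ln (real k)) = 1 / real k" using k by (simp add: exp_minus inverse_eq_divide)
    finally show ?thesis .
  qed
  have B1: "prob B1 \<le> 1 / real k + 1 / real k"
  proof -
    have "prob B1 \<le> prob {\<omega>\<in>space M. ?J \<le> ?Z \<omega>}
        + prob {\<omega>\<in>space M. ?J \<le> (\<Sum>j\<in>I. - (indicator C (X j \<omega>) - \<alpha>))}"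
      unfolding B1_def by (rule measure_Un_le) measurable
    then show ?thesis using dev[of 1] dev[of "-1"] by simp
  qed
  have exp_L: "exp (- (4 * ln (real k)) / 2) = 1 / (real k)\<^sup>2"
  proof -
    have "- (4 * ln (real k)) / 2 = - (ln (real k) + ln (real k))" by simp
    then show ?thesis
      using k by (simp only: exp_minus exp_add) (simp add: power2_eq_square inverse_eq_divide)
  qed
  have UNK: "prob (\<Union>i\<in>K. B i) \<le> 1 / real k"
    if "\<And>i. i \<in> K \<Longrightarrow> B i \<in> sets M" "\<And>i. i \<in> K \<Longrightarrow> prob (B i) \<le> 1 / (real k)\<^sup>2" for B
  proof -
    have "prob (\<Union>i\<in>K. B i) \<le> (\<Sum>i\<in>K. prob (B i))"
      by (rule finite_measure_subadditive_finite) (use \<open>finite K\<close> that in auto)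
    also have "\<dots> \<le> real (card K) * (1 / (real k)\<^sup>2)" by (rule sum_bounded_above) (rule that)
    also have "\<dots> \<le> real k * (1 / (real k)\<^sup>2)" using cardK by (intro mult_right_mono) auto
    finally show ?thesis using k by (simp add: power2_eq_square)
  qed
  have BU: "prob (\<Union>i\<in>K. BU i) \<le> 1 / real k"
  proof (rule UNK)
    fix i assume "i \<in> K"
    then have iJ: "real i \<le> ?J" by (simp add: K_def)
    have "prob (BU i) \<le> exp (- (4 * ln (real k)) / 2)"
      unfolding BU_def using lnk by (intro prob_count_less[OF U U_prob[OF iJ] _ U_big[OF iJ]]) auto
    then show "prob (BU i) \<le> 1 / (real k)\<^sup>2" unfolding exp_L .
  qed simp
  have BV: "prob (\<Union>i\<in>K. BV i) \<le> 1 / real k"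
  proof (rule UNK)
    fix i assume "i \<in> K"
    then have iJ: "real i \<le> ?J" by (simp add: K_def)
    have "prob (BV i) \<le> exp (- (4 * ln (real k)) / 2)"
      unfolding BV_def using lnk by (intro prob_count_less[OF V V_prob[OF iJ] _ V_big[OF iJ]]) auto
    then show "prob (BV i) \<le> 1 / (real k)\<^sup>2" unfolding exp_L .
  qed simp
  show thesis
  proof (rule that[of G])
    show "G \<in> sets M" unfolding G_def using \<open>finite K\<close> by (intro sets.Diff sets.Un sets.finite_UN) auto
    have eq: "space M - G = B1 \<union> (\<Union>i\<in>K. BU i) \<union> (\<Union>i\<in>K. BV i)"
      unfolding G_def by (auto simp: B1_def BU_def BV_def)
    have "prob (space M - G) \<le> prob (B1 \<union> (\<Union>i\<in>K. BU i)) + prob (\<Union>i\<in>K. BV i)"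
      unfolding eq using \<open>finite K\<close> by (intro measure_Un_le) auto
    moreover have "prob (B1 \<union> (\<Union>i\<in>K. BU i)) \<le> prob B1 + prob (\<Union>i\<in>K. BU i)"
      using \<open>finite K\<close> by (intro measure_Un_le) auto
    ultimately show "prob (space M - G) \<le> 4 / real k" using B1 BU BV by simp
    fix \<omega> assume \<omega>: "\<omega> \<in> G"
    have "real (N \<omega>) = \<bar>?Z \<omega>\<bar>"
      unfolding sum_centred_indicator alpha by (simp add: N_def)
    moreover have "\<not> ?J \<le> ?Z \<omega>" "\<not> ?J \<le> (\<Sum>j\<in>I. - (indicator C (X j \<omega>) - \<alpha>))"
      using \<omega> unfolding G_def B1_def by (auto simp del: minus_diff_eq)
    then have "?Z \<omega> < ?J" "- ?Z \<omega> < ?J" unfolding sum_negf by simp_all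
    ultimately show J: "real (N \<omega>) \<le> ?J" by linarith
    have "4 * (real k * ln k) \<le> real k * real k"
      using mult_left_mono[OF k(2), of "real k"] by simp
    then have "sqrt (4 * (real k * ln k)) \<le> sqrt (real k * real k)" by (rule real_sqrt_le_mono)
    then have "?J \<le> real k" by (simp add: real_sqrt_mult)
    then have NK: "N \<omega> \<in> K" if "N \<omega> \<noteq> 0" using J that by (auto simp: K_def)
    have "\<omega> \<in> space M" "i \<in> K \<Longrightarrow> \<omega> \<notin> BU i" "i \<in> K \<Longrightarrow> \<omega> \<notin> BV i" for i
      using \<omega> by (auto simp: G_def)
    then have cnt: "i \<in> K \<Longrightarrow> i \<le> card {j \<in> I. X j \<omega> \<in> U i} \<and> i \<le> card {j \<in> I. X j \<omega> \<in> V i}" for i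
      by (simp add: BU_def BV_def not_less)
    show "N \<omega> \<le> card {j \<in> I. X j \<omega> \<in> U (N \<omega>)}"
      using cnt[OF NK] by (cases "N \<omega> = 0") simp_all
    show "N \<omega> \<le> card {j \<in> I. X j \<omega> \<in> V (N \<omega>)}"
      using cnt[OF NK] by (cases "N \<omega> = 0") simp_all
  qed
qed

end

section \<open>Smooth quantile functions\<close>

context
  fixes N :: "real measure"
  assumes N: "real_distribution N"
begin

interpretation cdf_distribution N
  using N by (simp add: cdf_distribution_def)

lemma le_cdf_quantile: "0 < u \<Longrightarrow> u < 1 \<Longrightarrow> u \<le> cdf N (quantile (cdf N) u)"
  using quantile_le_iff[OF N, of u "quantile (cdf N) u"] by simp

lemma quantile_mono: "0 < u \<Longrightarrow> u \<le> v \<Longrightarrow> v < 1 \<Longrightarrow> quantile (cdf N) u \<le> quantile (cdf N) v"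
  using quantile_le_iff[OF N, of u "quantile (cdf N) v"] le_cdf_quantile[of v] by simp

text \<open>The left-continuous inverse maps Lebesgue measure on the open unit interval to
  \<open>N\<close>. The endpoints 0 and 1, where \<open>quantile\<close> may be a default value,
  form a null set.\<close>

lemma integral_eq_integral_quantile:
  fixes h :: "real \<Rightarrow> real"
  assumes [measurable]: "h \<in> borel_measurable borel"
  shows "(LINT u:{0..1}|lborel. h (quantile (cdf N) u)) = integral\<^sup>L N h"
proof -
  let ?R = "restrict_space lborel {0<..<1 :: real}"
  let ?I = "\<lambda>u. Inf {x. u \<le> cdf N x}"
  have I: "?I \<in> borel_measurable ?R"
    using measurable_CI by (simp cong: measurable_cong_sets)
  have "integral\<^sup>L N h = integral\<^sup>L (distr ?R borel ?I) h"
    using distr_I_eq_M by simp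
  also have "\<dots> = (LINT u|?R. h (?I u))"
    using I by (rule integral_distr) measurable
  also have "\<dots> = (LINT u|lborel. indicator {0<..<1} u *\<^sub>R h (?I u))"
    by (rule integral_restrict_space) simp
  also have "\<dots> = (LINT u|lborel. indicator {0..1} u *\<^sub>R h (quantile (cdf N) u))"
    by (rule integral_discrete_difference[of "{0, 1}"]) (auto simp: indicator_def quantile_def)
  finally show ?thesis by (simp add: set_lebesgue_integral_def)
qed

lemma winsor_mean_eq:
  "winsor_mean (cdf N) a b = integral\<^sup>L N (\<lambda>x. max (quantile (cdf N) a) (min x (quantile (cdf N) b)))"
  unfolding winsor_mean_def winsor_quantile_def
  by (rule integral_eq_integral_quantile[where h = "\<lambda>x. max (quantile (cdf N) a) (min x (quantile (cdf N) b))"]) measurable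

lemma winsor_var_eq:
  "winsor_var (cdf N) a b = integral\<^sup>L N
     (\<lambda>x. (max (quantile (cdf N) a) (min x (quantile (cdf N) b)) - winsor_mean (cdf N) a b)\<^sup>2)"
  unfolding winsor_var_def winsor_quantile_def
  by (rule integral_eq_integral_quantile[where
        h = "\<lambda>x. (max (quantile (cdf N) a) (min x (quantile (cdf N) b)) - winsor_mean (cdf N) a b)\<^sup>2"]) measurable

text \<open>The Winsorized quantile function is constant on the two outer intervals of levels. The
  resulting boundary terms match the values with which the trimmed positions are filled, so the
  centrings of the trimmed and of the Winsorized sum agree.\<close>

lemma trimmed_mean_eq:
  assumes "0 < a" "a < 1 - b" "0 < b"
  shows "trimmed_mean (cdf N) a (1 - b)
    = winsor_mean (cdf N) a (1 - b) - a * quantile (cdf N) a - b * quantile (cdf N) (1 - b)"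
proof -
  let ?q = "quantile (cdf N)"
  let ?I = "\<lambda>u. Inf {x. u \<le> cdf N x}"
  let ?g = "\<lambda>u. indicator {0<..<1} u *\<^sub>R ?I u"
  have "?I \<in> borel_measurable (restrict_space borel {0<..<1})" by measurable
  then have g [measurable]: "?g \<in> borel_measurable borel"
    by (subst (asm) borel_measurable_restrict_space_iff) auto
  have qI: "?g u = ?q u" if "0 < u" "u < 1" for u
    using that by (simp add: quantile_def)
  have mid: "integrable lborel (\<lambda>u. indicator {a..1 - b} u *\<^sub>R ?g u)"
  proof (rule integrableI_bounded_set[where A = "{a..1 - b}" and B = "max \<bar>?q a\<bar> \<bar>?q (1 - b)\<bar>"])
    show "AE u in lborel. u \<in> {a..1 - b} \<longrightarrow> norm (indicator {a..1 - b} u *\<^sub>R ?g u) \<le> max \<bar>?q a\<bar> \<bar>?q (1 - b)\<bar>"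
    proof (intro AE_I2 impI)
      fix u assume u: "u \<in> {a..1 - b}"
      then have "?q a \<le> ?q u" "?q u \<le> ?q (1 - b)" using assms by (auto intro!: quantile_mono)
      then show "norm (indicator {a..1 - b} u *\<^sub>R ?g u) \<le> max \<bar>?q a\<bar> \<bar>?q (1 - b)\<bar>"
        using u qI[of u] assms by auto
    qed
    show "(\<lambda>u. indicator {a..1 - b} u *\<^sub>R ?g u) \<in> borel_measurable lborel"
      using borel_measurable_scaleR[OF borel_measurable_indicator g, of "{a..1 - b}"] by simp
  qed (use assms in auto)
  have "winsor_mean (cdf N) a (1 - b)
     = (LINT u|lborel. ?q a * indicator {0<..<a} u + indicator {a..1 - b} u *\<^sub>R ?g u
         + ?q (1 - b) * indicator {1 - b<..<1} u)"
    unfolding winsor_mean_def set_lebesgue_integral_def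
  proof (rule integral_discrete_difference[of "{0, 1}"])
    fix u :: real assume "u \<in> space lborel" and u: "u \<notin> {0, 1}"
    consider "u < 0" | "0 < u" "u < a" | "a \<le> u" "u \<le> 1 - b" | "1 - b < u" "u < 1" | "1 < u"
      using u by (smt (verit) insert_iff)
    then show "indicator {0..1} u *\<^sub>R winsor_quantile (cdf N) a (1 - b) u
      = ?q a * indicator {0<..<a} u + indicator {a..1 - b} u *\<^sub>R ?g u + ?q (1 - b) * indicator {1 - b<..<1} u"
    proof cases
      case 2
      then have "?q u \<le> ?q a" "?q a \<le> ?q (1 - b)" using assms by (auto intro!: quantile_mono)
      then show ?thesis using 2 assms by (simp add: winsor_quantile_def)
    next
      case 3
      then have "?q a \<le> ?q u" "?q u \<le> ?q (1 - b)" using assms by (auto intro!: quantile_mono)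
      then show ?thesis using 3 assms qI[of u] by (simp add: winsor_quantile_def)
    next
      case 4
      then have "?q (1 - b) \<le> ?q u" "?q a \<le> ?q (1 - b)" using assms by (auto intro!: quantile_mono)
      then show ?thesis using 4 assms by (simp add: winsor_quantile_def)
    qed (use assms in \<open>auto simp: indicator_def\<close>)
  qed auto
  also have "\<dots> = ?q a * a + (LINT u|lborel. indicator {a..1 - b} u *\<^sub>R ?g u) + ?q (1 - b) * b"
    using assms mid
    by (subst Bochner_Integration.integral_add, simp, simp, subst Bochner_Integration.integral_add) simp_all
  also have "(LINT u|lborel. indicator {a..1 - b} u *\<^sub>R ?g u) = trimmed_mean (cdf N) a (1 - b)"
    unfolding trimmed_mean_def set_lebesgue_integral_def
    using assms by (intro Bochner_Integration.integral_cong) (auto simp: indicator_def quantile_def)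
  finally show ?thesis by simp
qed

text \<open>To the left of the quantile the distribution function is below \<open>u\<close>;
  continuity carries this bound to the point itself.\<close>

lemma cdf_quantile:
  assumes "0 < u" "u < 1" "isCont (cdf N) (quantile (cdf N) u)"
  shows "cdf N (quantile (cdf N) u) = u"
proof (rule antisym)
  let ?x = "quantile (cdf N) u"
  have "(cdf N \<longlongrightarrow> cdf N ?x) (at_left ?x)"
    using assms(3) by (simp add: isCont_def filterlim_at_split)
  moreover have "\<forall>\<^sub>F y in at_left ?x. cdf N y \<le> u"
    unfolding eventually_at_filter
    by (rule always_eventually) (use quantile_le_iff[OF N assms(1,2)] in \<open>auto simp: not_le[symmetric] intro: less_imp_le\<close>)
  ultimately show "cdf N ?x \<le> u" by (rule tendsto_upperbound) simp
qed (use le_cdf_quantile assms in auto)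

section \<open>Levels at which the quantile function is smooth\<close>

context
  fixes U :: "real set"
  assumes U: "open U" "U \<subseteq> {0<..<1}"
    and q_diff: "\<And>u. u \<in> U \<Longrightarrow> quantile (cdf N) differentiable at u"
    and F_diff: "\<And>u. u \<in> U \<Longrightarrow> cdf N differentiable at (quantile (cdf N) u)"
    and f_pos: "\<And>u. u \<in> U \<Longrightarrow> 0 < deriv (cdf N) (quantile (cdf N) u)"
begin

lemma cdf_quantile_smooth: "u \<in> U \<Longrightarrow> cdf N (quantile (cdf N) u) = u"
  using U by (intro cdf_quantile differentiable_imp_continuous_within[OF F_diff]) auto

lemma measure_quantile_singleton: "u \<in> U \<Longrightarrow> measure N {quantile (cdf N) u} = 0"
  using isCont_cdf differentiable_imp_continuous_within[OF F_diff] by blast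

text \<open>Differentiability is assumed; the chain rule applied to
  \<open>cdf N (quantile (cdf N) u) = u\<close> on the open set \<open>U\<close> identifies the
  value.\<close>

lemma quantile_deriv:
  assumes "u \<in> U"
  shows "(quantile (cdf N) has_real_derivative 1 / deriv (cdf N) (quantile (cdf N) u)) (at u)"
proof -
  let ?q = "quantile (cdf N)" and ?f = "deriv (cdf N)"
  obtain d where d: "(?q has_real_derivative d) (at u)"
    using q_diff[OF assms] by (auto simp: real_differentiable_def)
  have F: "(cdf N has_real_derivative ?f (?q u)) (at (?q u))"
    using F_diff[OF assms] DERIV_imp_deriv by (auto simp: real_differentiable_def)
  have "((\<lambda>u. cdf N (?q u)) has_real_derivative ?f (?q u) * d) (at u)"
    by (rule DERIV_chain2[OF F d])
  then have "((\<lambda>u. u) has_real_derivative ?f (?q u) * d) (at u)"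
    by (rule has_field_derivative_transform_within_open[OF _ U(1) assms]) (rule cdf_quantile_smooth)
  moreover have "((\<lambda>u. u) has_real_derivative 1) (at u)" by (rule DERIV_ident)
  ultimately have "?f (?q u) * d = 1" by (rule DERIV_unique)
  then have "d = 1 / ?f (?q u)" using f_pos[OF assms] by (simp add: field_simps)
  with d show ?thesis by simp
qed

lemma quantile_mvt:
  assumes "x < y" "{x..y} \<subseteq> U"
  obtains c where "x < c" "c < y"
    "quantile (cdf N) y - quantile (cdf N) x = (y - x) * (1 / deriv (cdf N) (quantile (cdf N) c))"
proof -
  have "\<exists>z. x < z \<and> z < y \<and> quantile (cdf N) y - quantile (cdf N) x
      = (y - x) * (1 / deriv (cdf N) (quantile (cdf N) z))"
    using assms by (intro MVT2 quantile_deriv) auto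
  with that show ?thesis by blast
qed

lemma quantile_strict_mono: "x < y \<Longrightarrow> {x..y} \<subseteq> U \<Longrightarrow> quantile (cdf N) x < quantile (cdf N) y"
proof -
  assume xy: "x < y" "{x..y} \<subseteq> U"
  from quantile_mvt[OF this] obtain c where c: "x < c" "c < y"
    "quantile (cdf N) y - quantile (cdf N) x = (y - x) * (1 / deriv (cdf N) (quantile (cdf N) c))" .
  with xy have "c \<in> U" by auto
  from f_pos[OF this] xy have "0 < (y - x) * (1 / deriv (cdf N) (quantile (cdf N) c))" by simp
  with c show ?thesis by simp
qed

text \<open>Within the window the oscillation bound gives \<open>1 / f \<le> 2 / f q\<close>. By the
  mean value theorem, a change of level by \<open>y\<close> moves the quantile by at most
  \<open>2 * y / f q\<close>, so an interval of that length on either side of \<open>q\<close> has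
  mass at least \<open>y\<close>. The point \<open>q\<close> itself carries no mass and may be left
  out.\<close>

lemma measure_near_quantile:
  fixes p d B y :: real
  defines "q \<equiv> quantile (cdf N) p" and "f \<equiv> deriv (cdf N)"
  assumes Psi: "Psi (cdf N) (\<lambda>x. 1 / f x) p d B \<le> ereal (1 / f q)"
    and sub: "{p - B * d..p + B * d} \<subseteq> U" and d: "0 < d"
    and y: "0 \<le> y" "y \<le> B * d"
  shows "y \<le> measure N {q - 2 * y / f q..<q}" and "y \<le> measure N {q<..q + 2 * y / f q}"
proof -
  let ?q = "quantile (cdf N)"
  have p: "p \<in> U" using sub y by auto
  have fq: "0 < f q" using f_pos[OF p] by (simp add: f_def q_def)
  have inv_le: "1 / f (?q c) \<le> 2 / f q" if c: "\<bar>c - p\<bar> \<le> B * d" for c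
  proof -
    \<comment> \<open>The parameter of the supremum in \<open>Psi\<close> that reaches the level
      \<open>c\<close>.\<close>
    have "\<bar>(c - p) / d\<bar> \<le> B" using c d by (simp add: field_simps)
    then have "ereal \<bar>1 / f (?q (p + (c - p) / d * d)) - 1 / f (?q p)\<bar> \<le> Psi (cdf N) (\<lambda>x. 1 / f x) p d B"
      unfolding Psi_def by (intro SUP_upper) auto
    also have "\<dots> \<le> ereal (1 / f q)" by (rule Psi)
    finally have "\<bar>1 / f (?q c) - 1 / f q\<bar> \<le> 1 / f q" using d by (simp add: q_def)
    then show ?thesis by (simp add: abs_le_iff)
  qed
  have up: "?q (p + y) \<le> q + 2 * y / f q"
  proof (cases "y = 0")
    case False
    then have "p < p + y" "{p..p + y} \<subseteq> U" using y sub by auto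
    from quantile_mvt[OF this] obtain c where c: "p < c" "c < p + y"
      "?q (p + y) - q = y * (1 / f (?q c))" by (auto simp: f_def q_def)
    have "y * (1 / f (?q c)) \<le> y * (2 / f q)" using c y by (intro mult_left_mono inv_le) auto
    with c show ?thesis by (simp add: mult.commute)
  qed (simp add: q_def)
  have down: "q - 2 * y / f q \<le> ?q (p - y)"
  proof (cases "y = 0")
    case False
    then have "p - y < p" "{p - y..p} \<subseteq> U" using y sub by auto
    from quantile_mvt[OF this] obtain c where c: "p - y < c" "c < p"
      "q - ?q (p - y) = y * (1 / f (?q c))" by (auto simp: f_def q_def)
    have "y * (1 / f (?q c)) \<le> y * (2 / f q)" using c y by (intro mult_left_mono inv_le) auto
    with c show ?thesis by (simp add: mult.commute)
  qed (simp add: q_def)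
  have h: "0 \<le> 2 * y / f q" using y fq by simp
  have "p + y = cdf N (?q (p + y))" using y sub by (intro cdf_quantile_smooth[symmetric]) auto
  also have "\<dots> \<le> cdf N (q + 2 * y / f q)" by (rule cdf_nondecreasing[OF up])
  also have "\<dots> = cdf N q + measure N {q<..q + 2 * y / f q}"
    using h cdf_diff_eq[of q "q + 2 * y / f q"] by (cases "2 * y / f q = 0") auto
  also have "cdf N q = p" using cdf_quantile_smooth[OF p] by (simp add: q_def)
  finally show "y \<le> measure N {q<..q + 2 * y / f q}" by simp
  have "p = cdf N q" using cdf_quantile_smooth[OF p] by (simp add: q_def)
  also have "\<dots> \<le> measure N ({..q - 2 * y / f q} \<union> {q - 2 * y / f q..<q} \<union> {q})"
    unfolding cdf_def using h by (intro finite_measure_mono) auto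
  also have "\<dots> \<le> measure N ({..?q (p - y)} \<union> ({q - 2 * y / f q..<q} \<union> {q}))"
    using down by (intro finite_measure_mono) auto
  finally have "p \<le> measure N ({..?q (p - y)} \<union> ({q - 2 * y / f q..<q} \<union> {q}))" .
  moreover have "measure N ({..?q (p - y)} \<union> ({q - 2 * y / f q..<q} \<union> {q}))
      \<le> measure N {..?q (p - y)} + measure N ({q - 2 * y / f q..<q} \<union> {q})"
    by (rule measure_Un_le) auto
  moreover have "measure N ({q - 2 * y / f q..<q} \<union> {q}) \<le> measure N {q - 2 * y / f q..<q} + measure N {q}"
    by (rule measure_Un_le) auto
  moreover have "measure N {q} = 0" using measure_quantile_singleton[OF p] by (simp add: q_def)
  moreover have "measure N {..?q (p - y)} = p - y"
  proof -
    have "cdf N (?q (p - y)) = p - y" using y sub by (intro cdf_quantile_smooth) auto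
    then show ?thesis unfolding cdf_def .
  qed
  ultimately show "y \<le> measure N {q - 2 * y / f q..<q}" by simp
qed

end

end

section \<open>Tails of the quantile function\<close>

context
  fixes N :: "real measure"
  assumes N: "real_distribution N"
begin

text \<open>Measurability of the inner integral \<open>kernel_mass\<close> rests on this. The
  exhausting intervals stay away from 0 and 1, where the quantile function may be unbounded.\<close>

lemma sigma_finite_quantile_measure: "sigma_finite_measure (quantile_measure (cdf N))"
proof
  let ?\<nu> = "quantile_measure (cdf N)"
  define r where "r n = 1 / real (n + 3)" for n :: nat
  have r: "0 < r n" "r n \<le> 1 / 3" for n
    unfolding r_def by (simp_all add: field_simps)
  let ?A = "\<lambda>n. {r n..<1 - r n}"
  have "(\<Union>n. ?A n) = {0<..<1}"
  proof (intro equalityI subsetI)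
    fix x assume "x \<in> (\<Union>n. ?A n)"
    then obtain n where "r n \<le> x" "x < 1 - r n" by auto
    then show "x \<in> {0<..<1}" using r(1)[of n] by simp
  next
    fix x :: real assume x: "x \<in> {0<..<1}"
    then obtain n where n: "inverse (real (Suc n)) < min x (1 - x)"
      using reals_Archimedean[of "min x (1 - x)"] by auto
    have "r n \<le> inverse (real (Suc n))" by (simp add: r_def field_simps)
    with n have "x \<in> ?A n" by simp
    then show "x \<in> (\<Union>n. ?A n)" by blast
  qed
  moreover have "?A n \<in> sets ?\<nu>" for n
    using r[of n] unfolding sets_quantile_measure by (simp add: sets_restrict_space_iff subset_eq)
  moreover have "emeasure ?\<nu> (?A n) \<noteq> \<infinity>" for n
    using r[of n] by (subst emeasure_quantile_measure[OF N]) simp_all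
  ultimately show "\<exists>A. countable A \<and> A \<subseteq> sets ?\<nu> \<and> \<Union> A = space ?\<nu> \<and> (\<forall>a\<in>A. emeasure ?\<nu> a \<noteq> \<infinity>)"
    by (intro exI[of _ "range ?A"]) (auto simp: space_quantile_measure)
qed

text \<open>The inner integral of \<open>sigma2\<close>. Taken as a density, it makes
  \<open>sigma2\<close> the total mass of a measure on the levels, to which continuity from above
  applies.\<close>

definition kernel_mass :: "real \<Rightarrow> ennreal" where
  "kernel_mass s = (\<integral>\<^sup>+t. ennreal (min s t - s * t) \<partial>quantile_measure (cdf N))"

lemma id_quantile_measure [measurable]: "(\<lambda>x. x) \<in> borel_measurable (quantile_measure (cdf N))"
  by (subst measurable_cong_sets[OF sets_quantile_measure refl])
     (simp add: measurable_restrict_space1)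

lemma kernel_mass_measurable: "kernel_mass \<in> borel_measurable (quantile_measure (cdf N))"
proof -
  let ?\<nu> = "quantile_measure (cdf N)"
  interpret sigma_finite_measure ?\<nu> by (rule sigma_finite_quantile_measure)
  have [measurable]: "fst \<in> borel_measurable (?\<nu> \<Otimes>\<^sub>M ?\<nu>)" "snd \<in> borel_measurable (?\<nu> \<Otimes>\<^sub>M ?\<nu>)"
    by (rule measurable_compose[OF measurable_fst id_quantile_measure]
        measurable_compose[OF measurable_snd id_quantile_measure])+
  have "(\<lambda>(s, t). ennreal (min s t - s * t)) \<in> borel_measurable (?\<nu> \<Otimes>\<^sub>M ?\<nu>)"
    unfolding case_prod_beta by measurable
  then show ?thesis
    unfolding kernel_mass_def[abs_def] by (rule borel_measurable_nn_integral)
qed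

lemma sigma2_eq: "sigma2 (cdf N) 0 1 = (\<integral>\<^sup>+s. kernel_mass s \<partial>quantile_measure (cdf N))"
proof -
  have "(\<integral>\<^sup>+s\<in>{0..<1}. h s \<partial>quantile_measure (cdf N)) = (\<integral>\<^sup>+s. h s \<partial>quantile_measure (cdf N))" for h
    by (rule nn_integral_cong) (simp add: space_quantile_measure)
  then show ?thesis by (simp only: sigma2_def kernel_mass_def)
qed

text \<open>Restricting the double integral to the square with side \<open>{x..<y}\<close> leaves at
  least the lower bound \<open>w\<close> of the kernel times the squared mass of the side, and that
  mass is the increment of the quantile function.\<close>

lemma block_le:
  assumes xy: "0 < x" "x \<le> y" "y < 1" and w: "0 \<le> w"
    and le: "\<And>s t. x \<le> s \<Longrightarrow> s < y \<Longrightarrow> x \<le> t \<Longrightarrow> t < y \<Longrightarrow> w \<le> min s t - s * t"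
    and A: "{x..<y} \<subseteq> A"
  shows "ennreal (w * (quantile (cdf N) y - quantile (cdf N) x)\<^sup>2)
    \<le> (\<integral>\<^sup>+s\<in>A. kernel_mass s \<partial>quantile_measure (cdf N))"
proof -
  let ?\<nu> = "quantile_measure (cdf N)" and ?d = "quantile (cdf N) y - quantile (cdf N) x"
  have d: "0 \<le> ?d" using quantile_mono[OF N xy] by simp
  have em: "emeasure ?\<nu> {x..<y} = ennreal ?d" by (rule emeasure_quantile_measure[OF N xy])
  have [measurable]: "{x..<y} \<in> sets ?\<nu>"
    unfolding sets_quantile_measure using xy by (auto simp: sets_restrict_space_iff)
  have inner: "ennreal (w * ?d) \<le> kernel_mass s" if "s \<in> {x..<y}" for s
  proof -
    have "ennreal (w * ?d) = (\<integral>\<^sup>+t. ennreal w * indicator {x..<y} t \<partial>?\<nu>)"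
      by (subst nn_integral_cmult_indicator) (simp_all only: em ennreal_mult[OF w d], measurable)
    also have "\<dots> \<le> kernel_mass s"
      unfolding kernel_mass_def
      by (rule nn_integral_mono) (use that le w in \<open>auto simp: indicator_def intro!: ennreal_leI\<close>)
    finally show ?thesis .
  qed
  have "ennreal (w * ?d\<^sup>2) = (\<integral>\<^sup>+s. ennreal (w * ?d) * indicator {x..<y} s \<partial>?\<nu>)"
    using w d by (subst nn_integral_cmult_indicator)
      (simp_all add: em ennreal_mult[symmetric] power2_eq_square mult.assoc)
  also have "\<dots> \<le> (\<integral>\<^sup>+s\<in>A. kernel_mass s \<partial>?\<nu>)"
    by (rule nn_integral_mono) (use inner A in \<open>auto simp: indicator_def\<close>)
  finally show ?thesis .
qed

text \<open>Continuity from above of the measure with density \<open>kernel_mass\<close>, which is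
  finite because \<open>sigma2\<close> is.\<close>

lemma kernel_mass_vanishes:
  assumes fin: "sigma2 (cdf N) 0 1 < \<infinity>" and e: "0 < (e :: real)"
    and A: "\<And>n. A n \<in> sets borel" "decseq A" "(\<Inter>n. A n) \<inter> {0<..<1} = {}"
  obtains n :: nat where "(\<integral>\<^sup>+s\<in>A n. kernel_mass s \<partial>quantile_measure (cdf N)) \<le> ennreal e"
proof -
  let ?\<nu> = "quantile_measure (cdf N)"
  let ?D = "density ?\<nu> kernel_mass"
  let ?B = "\<lambda>n. A n \<inter> {0<..<1}"
  have B: "?B n \<in> sets ?\<nu>" for n
    unfolding sets_quantile_measure using A(1) by (auto simp: sets_restrict_space_iff)
  have emB: "emeasure ?D (?B n) = (\<integral>\<^sup>+s\<in>A n. kernel_mass s \<partial>?\<nu>)" for n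
    by (subst emeasure_density[OF kernel_mass_measurable B])
       (auto intro!: nn_integral_cong simp: space_quantile_measure indicator_def)
  have fin': "emeasure ?D (?B n) \<noteq> \<infinity>" for n
  proof -
    have "emeasure ?D (?B n) \<le> emeasure ?D (space ?D)"
      using B by (intro emeasure_space)
    also have "\<dots> = sigma2 (cdf N) 0 1"
      unfolding sigma2_eq using kernel_mass_measurable
      by (auto simp: emeasure_density intro!: nn_integral_cong)
    finally show ?thesis using fin by auto
  qed
  have "(\<lambda>n. emeasure ?D (?B n)) \<longlonglongrightarrow> emeasure ?D (\<Inter>n. ?B n)"
    using B A(2) fin' by (intro Lim_emeasure_decseq) (auto simp: decseq_def)
  moreover have "(\<Inter>n. ?B n) = {}" using A(3) by auto
  ultimately have "(\<lambda>n. emeasure ?D (?B n)) \<longlonglongrightarrow> 0" by simp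
  then have "\<forall>\<^sub>F n in sequentially. emeasure ?D (?B n) < ennreal e"
    by (rule order_tendstoD(2)) (use ennreal_lessI[OF e, of 0] e in simp)
  then have "\<exists>n. emeasure ?D (?B n) < ennreal e"
    by (rule eventually_happens'[OF sequentially_bot])
  then obtain n where "emeasure ?D (?B n) < ennreal e" by blast
  then have "(\<integral>\<^sup>+s\<in>A n. kernel_mass s \<partial>?\<nu>) \<le> ennreal e" unfolding emB by (rule less_imp_le)
  then show thesis by (rule that)
qed

lemma square_bound:
  fixes r s w e :: real
  assumes "w / 2 * (r - s)\<^sup>2 \<le> e" "0 \<le> w"
  shows "w * s\<^sup>2 \<le> 4 * e + 2 * w * r\<^sup>2"
proof -
  have "s\<^sup>2 \<le> 2 * (r - s)\<^sup>2 + 2 * r\<^sup>2"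
  proof -
    have "2 * (r - s)\<^sup>2 + 2 * r\<^sup>2 - s\<^sup>2 = (2 * r - s)\<^sup>2"
      by (simp add: power2_eq_square algebra_simps)
    then show ?thesis using zero_le_power2[of "2 * r - s"] by linarith
  qed
  then have "w * s\<^sup>2 \<le> w * (2 * (r - s)\<^sup>2 + 2 * r\<^sup>2)" using assms(2) by (rule mult_left_mono)
  also have "\<dots> = 4 * (w / 2 * (r - s)\<^sup>2) + 2 * w * r\<^sup>2" by (simp add: algebra_simps)
  finally show ?thesis using assms(1) by linarith
qed

text \<open>For \<open>u < v \<le> 1 / 2\<close> the kernel is at least \<open>u / 2\<close> on the
  square over \<open>{u..<v}\<close>, so \<open>u / 2 * (q v - q u)\<^sup>2\<close> is bounded by
  the mass of the levels below \<open>v\<close>. That mass is made small by fixing \<open>v\<close>,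
  uniformly in \<open>u\<close>; afterwards \<open>u * (q v)\<^sup>2\<close> vanishes as
  \<open>u\<close> tends to 0. The choice \<open>e / 8\<close> makes the first contribution
  \<open>e / 2\<close>.\<close>

lemma quantile_lower_tail:
  assumes fin: "sigma2 (cdf N) 0 1 < \<infinity>"
  shows "((\<lambda>u. u * (quantile (cdf N) u)\<^sup>2) \<longlongrightarrow> 0) (at_right 0)"
proof (rule tendstoI)
  fix e :: real assume e: "0 < e"
  let ?q = "quantile (cdf N)"
  let ?A = "\<lambda>n :: nat. {0<..<1 / (real n + 2)}"
  obtain n where n: "(\<integral>\<^sup>+s\<in>?A n. kernel_mass s \<partial>quantile_measure (cdf N)) \<le> ennreal (e / 8)"
  proof (rule kernel_mass_vanishes[OF fin, of "e / 8" ?A])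
    have "1 / (real n + 2) \<le> 1 / (real m + 2)" if "m \<le> n" for m n
      using that by (intro divide_left_mono) auto
    then show "decseq ?A" by (force simp: decseq_def)
    show "(\<Inter>n. ?A n) \<inter> {0<..<1} = {}"
    proof -
      have "\<exists>n. \<not> x < 1 / (real n + 2)" if "0 < x" for x :: real
      proof -
        obtain n where "1 / x < real n" using reals_Archimedean2 by blast
        then have "1 < x * real n" using that by (simp add: divide_less_eq mult.commute)
        then have "1 < x * (real n + 2)" using that by (simp add: distrib_left)
        then have "1 / (real n + 2) < x" by (simp add: divide_less_eq)
        then show ?thesis by (intro exI[of _ n]) simp
      qed
      then show ?thesis by fastforce
    qed
  qed (use e in auto)
  define v where "v = 1 / (real n + 2)"
  have v: "0 < v" "v \<le> 1 / 2" by (auto simp: v_def field_simps)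
  have "((\<lambda>u. e / 2 + 2 * u * (?q v)\<^sup>2) \<longlongrightarrow> e / 2 + 2 * 0 * (?q v)\<^sup>2) (at_right 0)"
    by (intro tendsto_intros)
  then have "\<forall>\<^sub>F u in at_right 0. e / 2 + 2 * u * (?q v)\<^sup>2 < e"
    by (rule order_tendstoD(2)) (use e in simp)
  moreover have "\<forall>\<^sub>F u in at_right 0. u < v"
    using v by (intro eventually_at_rightI[of 0 v]) auto
  moreover have "\<forall>\<^sub>F u in at_right 0. (0 :: real) < u"
    by (intro eventually_at_rightI[of 0 1]) auto
  ultimately show "\<forall>\<^sub>F u in at_right 0. dist (u * (?q u)\<^sup>2) 0 < e"
  proof eventually_elim
    case (elim u)
    have "ennreal (u / 2 * (?q v - ?q u)\<^sup>2)
        \<le> (\<integral>\<^sup>+s\<in>?A n. kernel_mass s \<partial>quantile_measure (cdf N))"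
    proof (rule block_le)
      fix s t assume st: "u \<le> s" "s < v" "u \<le> t" "t < v"
      have "u * (1 / 2) \<le> min s t * (1 - max s t)"
        using st elim v by (intro mult_mono) auto
      also have "min s t * (1 - max s t) = min s t - s * t" by (auto simp: min_def max_def algebra_simps)
      finally show "u / 2 \<le> min s t - s * t" by simp
    qed (use elim v in \<open>auto simp: v_def\<close>)
    then have "ennreal (u / 2 * (?q v - ?q u)\<^sup>2) \<le> ennreal (e / 8)" using n by (rule order_trans)
    then have "u / 2 * (?q v - ?q u)\<^sup>2 \<le> e / 8" using e by (simp add: ennreal_le_iff)
    then have "u * (?q u)\<^sup>2 \<le> 4 * (e / 8) + 2 * u * (?q v)\<^sup>2" using elim by (intro square_bound) auto
    then show ?case using elim by simp
  qed
qed

text \<open>Mirror image, with the square over \<open>{1 - v..<1 - u}\<close>: the factors of the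
  kernel exchange roles, \<open>min s t \<ge> 1 / 2\<close> and
  \<open>1 - max s t \<ge> u\<close>.\<close>

lemma quantile_upper_tail:
  assumes fin: "sigma2 (cdf N) 0 1 < \<infinity>"
  shows "((\<lambda>u. u * (quantile (cdf N) (1 - u))\<^sup>2) \<longlongrightarrow> 0) (at_right 0)"
proof (rule tendstoI)
  fix e :: real assume e: "0 < e"
  let ?q = "quantile (cdf N)"
  let ?A = "\<lambda>n :: nat. {1 - 1 / (real n + 2)..<1}"
  obtain n where n: "(\<integral>\<^sup>+s\<in>?A n. kernel_mass s \<partial>quantile_measure (cdf N)) \<le> ennreal (e / 8)"
  proof (rule kernel_mass_vanishes[OF fin, of "e / 8" ?A])
    have "1 / (real n + 2) \<le> 1 / (real m + 2)" if "m \<le> n" for m n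
      using that by (intro divide_left_mono) auto
    then show "decseq ?A" by (force simp: decseq_def)
    show "(\<Inter>n. ?A n) \<inter> {0<..<1} = {}"
    proof -
      have "\<exists>n. \<not> 1 - 1 / (real n + 2) \<le> x" if "x < 1" for x :: real
      proof -
        obtain n where "1 / (1 - x) < real n" using reals_Archimedean2 by blast
        moreover define y where "y = 1 - x"
        ultimately have "1 < y * real n" "0 < y" using that by (simp_all add: divide_less_eq mult.commute)
        then have "1 < y * (real n + 2)" by (simp add: distrib_left)
        then have "1 < (1 - x) * (real n + 2)" by (simp add: y_def)
        then have "1 / (real n + 2) < 1 - x" by (simp add: divide_less_eq)
        then show ?thesis by (intro exI[of _ n]) simp
      qed
      then show ?thesis by fastforce
    qed
  qed (use e in auto)
  define v where "v = 1 / (real n + 2)"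
  have v: "0 < v" "v \<le> 1 / 2" by (auto simp: v_def field_simps)
  have "((\<lambda>u. e / 2 + 2 * u * (?q (1 - v))\<^sup>2) \<longlongrightarrow> e / 2 + 2 * 0 * (?q (1 - v))\<^sup>2) (at_right 0)"
    by (intro tendsto_intros)
  then have "\<forall>\<^sub>F u in at_right 0. e / 2 + 2 * u * (?q (1 - v))\<^sup>2 < e"
    by (rule order_tendstoD(2)) (use e in simp)
  moreover have "\<forall>\<^sub>F u in at_right 0. u < v"
    using v by (intro eventually_at_rightI[of 0 v]) auto
  moreover have "\<forall>\<^sub>F u in at_right 0. (0 :: real) < u"
    by (intro eventually_at_rightI[of 0 1]) auto
  ultimately show "\<forall>\<^sub>F u in at_right 0. dist (u * (?q (1 - u))\<^sup>2) 0 < e"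
  proof eventually_elim
    case (elim u)
    have "ennreal (u / 2 * (?q (1 - u) - ?q (1 - v))\<^sup>2)
        \<le> (\<integral>\<^sup>+s\<in>?A n. kernel_mass s \<partial>quantile_measure (cdf N))"
    proof (rule block_le)
      fix s t assume st: "1 - v \<le> s" "s < 1 - u" "1 - v \<le> t" "t < 1 - u"
      have "(1 / 2) * u \<le> min s t * (1 - max s t)"
        using st elim v by (intro mult_mono) auto
      also have "min s t * (1 - max s t) = min s t - s * t" by (auto simp: min_def max_def algebra_simps)
      finally show "u / 2 \<le> min s t - s * t" by simp
    qed (use elim v in \<open>auto simp: v_def\<close>)
    then have "ennreal (u / 2 * (?q (1 - u) - ?q (1 - v))\<^sup>2) \<le> ennreal (e / 8)" using n by (rule order_trans)
    then have "u / 2 * (?q (1 - v) - ?q (1 - u))\<^sup>2 \<le> e / 8" using e by (simp add: ennreal_le_iff power2_commute)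
    then have "u * (?q (1 - u))\<^sup>2 \<le> 4 * (e / 8) + 2 * u * (?q (1 - v))\<^sup>2" using elim by (intro square_bound) auto
    then show ?case using elim by simp
  qed
qed

end

section \<open>The trimmed sum for a fixed sample size\<close>

text \<open>The probability an interval must have so that its expected count is
  \<open>4 * (i + L)\<close> with \<open>L = 4 * ln l\<close>, as \<open>prob_count_less\<close>
  demands; this \<open>L\<close> makes the failure probability \<open>1 / l\<^sup>2\<close>.\<close>

abbreviation count_level :: "nat \<Rightarrow> nat \<Rightarrow> nat \<Rightarrow> real" where
  "count_level l n i \<equiv> 4 * (real i + 4 * ln (real l)) / real n"

lemma order_stat_measurable:
  assumes "\<And>j. j \<in> {1..n} \<Longrightarrow> X j \<in> borel_measurable M" and "1 \<le> i" "i \<le> n"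
  shows "order_stat X n i \<in> borel_measurable M"
proof (rule borel_measurableI_le)
  fix y
  have [measurable]: "\<And>j. j \<in> {1..n} \<Longrightarrow> X j \<in> borel_measurable M" by fact
  have "order_stat X n i \<omega> \<le> y \<longleftrightarrow> real (i - 1) < (\<Sum>j\<in>{1..n}. indicator {..y} (X j \<omega>))" for \<omega>
  proof -
    have "order_stat X n i \<omega> \<le> y \<longleftrightarrow> i - 1 < card {j \<in> {1..n}. X j \<omega> \<le> y}"
      unfolding order_stat_def using assms by (intro sort_nth_iff(1)) auto
    also have "real (card {j \<in> {1..n}. X j \<omega> \<le> y}) = (\<Sum>j\<in>{1..n}. indicator {..y} (X j \<omega>))"
      by (simp add: indicator_def sum.If_cases Int_def)
    then have "i - 1 < card {j \<in> {1..n}. X j \<omega> \<le> y}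
        \<longleftrightarrow> real (i - 1) < (\<Sum>j\<in>{1..n}. indicator {..y} (X j \<omega>))"
      by (simp only: of_nat_less_iff[symmetric, where 'a = real])
    finally show ?thesis .
  qed
  then have "{\<omega> \<in> space M. order_stat X n i \<omega> \<le> y}
      = {\<omega> \<in> space M. real (i - 1) < (\<Sum>j\<in>{1..n}. indicator {..y} (X j \<omega>))}" by simp
  also have "\<dots> \<in> sets M" by measurable
  finally show "{\<omega> \<in> space M. order_stat X n i \<omega> \<le> y} \<in> sets M" .
qed

lemma trimmed_sum_eq:
  "k < n - m \<Longrightarrow> real n * trimmed_sum X n k m \<omega>
    = (\<Sum>i=k..<n - m. sort (map (\<lambda>j. X j \<omega>) [1..<Suc n]) ! i)"
proof -
  assume "k < n - m"
  have "(\<Sum>i = k + 1..n - m. order_stat X n i \<omega>) = (\<Sum>i=k..<n - m. order_stat X n (Suc i) \<omega>)"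
    by (rule sum.reindex_bij_witness[of _ Suc "\<lambda>i. i - 1"]) auto
  with \<open>k < n - m\<close> show ?thesis by (simp add: trimmed_sum_def order_stat_def)
qed

text \<open>Here the logarithm is absorbed: with \<open>N = A * sqrt k\<close>, the product
  \<open>N * (N + 4 * ln k)\<close> is at most
  \<open>(A\<^sup>2 + A) * k \<le> 2 * (A\<^sup>2 + 1) * k\<close>. The other factors contribute
  \<open>2 * 4 = 8\<close>, whence 16.\<close>

lemma tail_error_le:
  fixes k n :: nat and N \<psi> \<sigma> :: real
  assumes k: "2 \<le> k" "4 * ln (real k) \<le> sqrt (real k)" and n: "1 \<le> n" and pos: "0 < \<sigma>" "0 \<le> \<psi>" "0 \<le> N"
  shows "N * (2 * (4 * (N + 4 * ln (real k)) / n) * \<psi>) / (\<sigma> * sqrt n)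
    \<le> 16 * (real k / n) * \<psi> / (\<sigma> * sqrt n) * ((N / sqrt k)\<^sup>2 + 1)"
proof -
  define A where "A = N / sqrt k"
  have sk: "0 < sqrt (real k)" using k by simp
  have N: "N = A * sqrt k" using sk by (simp add: A_def)
  have "N * (N + 4 * ln (real k)) \<le> N * (N + sqrt k)"
    using k pos by (intro mult_left_mono) auto
  also have "\<dots> = (A\<^sup>2 + A) * k"
    by (simp add: N power2_eq_square algebra_simps)
  also have "\<dots> \<le> (2 * (A\<^sup>2 + 1)) * k"
  proof (intro mult_right_mono)
    have "0 \<le> (A - 1)\<^sup>2" by simp
    then have "2 * A \<le> A\<^sup>2 + 1" by (simp add: power2_diff)
    then have "A\<^sup>2 + A \<le> 2 * A\<^sup>2 + 2" using zero_le_power2[of A] by linarith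
    then show "A\<^sup>2 + A \<le> 2 * (A\<^sup>2 + 1)" by simp
  qed simp
  finally have "N * (N + 4 * ln (real k)) \<le> 2 * (A\<^sup>2 + 1) * k" .
  then have "(8 * \<psi> / (n * (\<sigma> * sqrt n))) * (N * (N + 4 * ln (real k)))
    \<le> (8 * \<psi> / (n * (\<sigma> * sqrt n))) * (2 * (A\<^sup>2 + 1) * k)"
    using pos by (intro mult_left_mono) auto
  then show ?thesis using k by (simp add: A_def field_simps)
qed

lemma (in prob_space) prob_diff_le:
  assumes [measurable]: "E \<in> sets M" "E' \<in> sets M" "R \<in> sets M"
    and sub: "E \<subseteq> E' \<union> R" "E' \<subseteq> E \<union> R"
  shows "\<bar>prob E - prob E'\<bar> \<le> prob R"
proof -
  have "prob E \<le> prob (E' \<union> R)" "prob E' \<le> prob (E \<union> R)"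
    using sub by (auto intro!: finite_measure_mono)
  moreover have "prob (E' \<union> R) \<le> prob E' + prob R" "prob (E \<union> R) \<le> prob E + prob R"
    by (auto intro!: measure_Un_le)
  ultimately show ?thesis by linarith
qed

text \<open>In the bound, \<open>24 = 18 + 6\<close> collects the normal approximation of
  \<open>W\<close> and the part of the concentration bound due to the size of the summands; the
  terms with 156 are the cost of the random width, and \<open>4 / k + 4 / m\<close> bounds the
  exceptional events. The reciprocals of the density enter only through \<open>\<psi>\<close> and
  \<open>\<psi>'\<close>.\<close>

theorem (in prob_space) trimmed_sum_berry_esseen:
  fixes X :: "nat \<Rightarrow> 'a \<Rightarrow> real" and N :: "real measure" and n k m :: nat and \<psi> \<psi>' :: real
  assumes indep: "indep_vars (\<lambda>_. borel) X {1..n}"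
    and ident: "\<And>i. i \<in> {1..n} \<Longrightarrow> distr M borel (X i) = N"
    and k: "2 \<le> k" "4 * ln (real k) \<le> sqrt k" and m: "2 \<le> m" "4 * ln (real m) \<le> sqrt m"
    and km: "k < n - m"
  defines "\<alpha> \<equiv> real k / n" and "\<beta> \<equiv> real m / n"
  defines "a \<equiv> quantile (cdf N) \<alpha>" and "b \<equiv> quantile (cdf N) (1 - \<beta>)"
    and "\<sigma> \<equiv> winsor_sd (cdf N) \<alpha> (1 - \<beta>)"
    and "h \<equiv> \<lambda>i :: nat. 2 * count_level k n i * \<psi>"
    and "h' \<equiv> \<lambda>i :: nat. 2 * count_level m n i * \<psi>'"
  defines "\<delta> \<equiv> (\<bar>a\<bar> + \<bar>b\<bar>) / (\<sigma> * sqrt n)"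
  assumes sd: "0 < \<sigma>" and psi: "0 \<le> \<psi>" "0 \<le> \<psi>'" and \<delta>: "0 < \<delta>" "\<delta> \<le> 1"
    and a: "measure N {..a} = \<alpha>" and b: "measure N {b..} = \<beta>"
    and a_left: "\<And>i. real i \<le> 2 * sqrt (k * ln k) \<Longrightarrow> count_level k n i \<le> measure N {a - h i..a}"
    and a_right: "\<And>i. real i \<le> 2 * sqrt (k * ln k) \<Longrightarrow> count_level k n i \<le> measure N {a<..a + h i}"
    and b_left: "\<And>i. real i \<le> 2 * sqrt (m * ln m) \<Longrightarrow> count_level m n i \<le> measure N {b - h' i..<b}"
    and b_right: "\<And>i. real i \<le> 2 * sqrt (m * ln m) \<Longrightarrow> count_level m n i \<le> measure N {b..b + h' i}"
  shows "\<bar>trimmed_cdf M X (cdf N) n k m x - \<Phi> x\<bar>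
    \<le> 24 * \<delta> + 156 * (16 * \<alpha> * \<psi> / (\<sigma> * sqrt n) + 16 * \<beta> * \<psi>' / (\<sigma> * sqrt n)) + 4 / k + 4 / m"
proof -
  have n: "1 \<le> n" using km by simp
  interpret finite_indep_family M X "{1..n}"
    by standard (use indep in auto)
  have X1: "X 1 \<in> borel_measurable M" using n by (intro X_measurable) simp
  have N_def: "N = distr M borel (X 1)" using ident[of 1] n by simp
  have N: "real_distribution N" unfolding N_def using X1 by (rule real_distribution_distr)
  interpret N: real_distribution N by (rule N)
  have prob_eq: "prob {\<omega>\<in>space M. X j \<omega> \<in> C} = measure N C" if "C \<in> sets borel" "j \<in> {1..n}" for C j
    using that X_measurable[OF that(2)]
    by (subst ident[OF that(2), symmetric], subst measure_distr) (auto intro!: arg_cong[of _ _ prob])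
  have expect_eq: "expectation (\<lambda>\<omega>. g (X j \<omega>)) = integral\<^sup>L N g"
    if "g \<in> borel_measurable borel" "j \<in> {1..n}" for g :: "real \<Rightarrow> real" and j
    using that X_measurable[OF that(2)]
    by (subst ident[OF that(2), symmetric], subst integral_distr) auto
  have lnk: "0 \<le> ln (real k)" "0 \<le> ln (real m)" using k m by auto
  have sqrt_le: "sqrt (real i) \<le> real i" if "2 \<le> i" for i :: nat
    using that by (intro real_le_lsqrt) (auto simp: power2_eq_square)
  have levels: "0 < \<alpha>" "\<alpha> < 1 - \<beta>" "0 < \<beta>" using k m km by (auto simp: \<alpha>_def \<beta>_def field_simps)
  then have ab: "a \<le> b" unfolding a_def b_def by (intro quantile_mono[OF N]) auto
  define c where "c y = max a (min y b)" for y
  define \<mu> where "\<mu> = winsor_mean (cdf N) \<alpha> (1 - \<beta>)"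
  have c [measurable]: "c \<in> borel_measurable borel" unfolding c_def by measurable
  have c_le: "a \<le> c y" "c y \<le> b" for y using ab by (auto simp: c_def)
  have "norm (c y) \<le> \<bar>a\<bar> + \<bar>b\<bar>" for y
    using c_le[of y] by (simp add: abs_le_iff) linarith
  then have int_c: "integrable N c"
    by (intro N.integrable_const_bound[of _ "\<bar>a\<bar> + \<bar>b\<bar>"] AE_I2) auto
  have \<mu>: "\<mu> = integral\<^sup>L N c"
    unfolding \<mu>_def winsor_mean_eq[OF N] c_def a_def b_def ..
  have \<mu>_le: "a \<le> \<mu>" "\<mu> \<le> b"
    using integral_mono[of N "\<lambda>_. a" c] integral_mono[of N c "\<lambda>_. b"] int_c c_le N.prob_space
    by (auto simp: \<mu>)
  have var: "integral\<^sup>L N (\<lambda>y. (c y - \<mu>)\<^sup>2) = \<sigma>\<^sup>2"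
  proof -
    have "integral\<^sup>L N (\<lambda>y. (c y - \<mu>)\<^sup>2) = winsor_var (cdf N) \<alpha> (1 - \<beta>)"
      unfolding winsor_var_eq[OF N] c_def \<mu>_def a_def b_def ..
    moreover have "0 \<le> integral\<^sup>L N (\<lambda>y. (c y - \<mu>)\<^sup>2)" by simp
    ultimately show ?thesis by (simp add: \<sigma>_def winsor_sd_def)
  qed
  define s where "s = \<sigma> * sqrt n"
  have s: "0 < s" "s\<^sup>2 = \<sigma>\<^sup>2 * n" using sd n by (auto simp: s_def power_mult_distrib)
  define g where "g y = (c y - \<mu>) / s" for y
  have g [measurable]: "g \<in> borel_measurable borel" unfolding g_def by measurable
  interpret Z: normalised_small_sum M X "{1..n}" "\<lambda>_. g" \<delta>
  proof
    show "\<bar>g y\<bar> \<le> \<delta>" for y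
    proof -
      have "\<bar>c y - \<mu>\<bar> \<le> \<bar>a\<bar> + \<bar>b\<bar>" using c_le[of y] \<mu>_le by linarith
      then show ?thesis using s by (simp add: g_def \<delta>_def s_def[symmetric] divide_right_mono)
    qed
    have int_g: "integral\<^sup>L N g = 0"
      using int_c N.prob_space by (simp add: g_def[abs_def] \<mu>)
    show "expectation (\<lambda>\<omega>. g (X i \<omega>)) = 0" if "i \<in> {1..n}" for i
      using expect_eq[OF g that] int_g by simp
    have "integral\<^sup>L N (\<lambda>y. (g y)\<^sup>2) = 1 / n"
      using s sd n by (simp add: g_def power_divide var)
    then show "(\<Sum>i\<in>{1..n}. expectation (\<lambda>\<omega>. (g (X i \<omega>))\<^sup>2)) = 1"
      using expect_eq[of "\<lambda>y. (g y)\<^sup>2"] n by simp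
  qed (use \<delta> in auto)
  obtain Ga where Ga: "Ga \<in> sets M" "prob (space M - Ga) \<le> 4 / real k"
    and Ga_right: "\<And>\<omega>. \<omega> \<in> Ga \<Longrightarrow> nat \<bar>int (card {j \<in> {1..n}. X j \<omega> \<in> {..a}}) - int k\<bar> \<le> card {j \<in> {1..n}. X j \<omega> \<in>
        {a<..a + h (nat \<bar>int (card {j \<in> {1..n}. X j \<omega> \<in> {..a}}) - int k\<bar>)}}"
    and Ga_left: "\<And>\<omega>. \<omega> \<in> Ga \<Longrightarrow> nat \<bar>int (card {j \<in> {1..n}. X j \<omega> \<in> {..a}}) - int k\<bar> \<le> card {j \<in> {1..n}. X j \<omega> \<in>
        {a - h (nat \<bar>int (card {j \<in> {1..n}. X j \<omega> \<in> {..a}}) - int k\<bar>)..a}}"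
  proof (rule tail_counts[of "{..a}" \<alpha> k "\<lambda>i. {a<..a + h i}" "\<lambda>i. {a - h i..a}"
        "\<lambda>i. measure N {a<..a + h i}" "\<lambda>i. measure N {a - h i..a}"])
    show "prob {\<omega> \<in> space M. X j \<omega> \<in> {..a}} = \<alpha>" if "j \<in> {1..n}" for j
      using prob_eq[of "{..a}" j] that a by simp
    show "real (card {1..n}) * \<alpha> = real k" using n by (simp add: \<alpha>_def)
    show "4 * ln (real k) \<le> real k" using k sqrt_le[OF k(1)] by linarith
    show "4 * (real i + 4 * ln (real k)) \<le> real (card {1..n}) * measure N {a<..a + h i}"
      "4 * (real i + 4 * ln (real k)) \<le> real (card {1..n}) * measure N {a - h i..a}"
      if "real i \<le> 2 * sqrt (real k * ln (real k))" for i
      using a_right[OF that] a_left[OF that] n by (simp_all add: divide_le_eq mult.commute)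
    show "prob {\<omega> \<in> space M. X j \<omega> \<in> {a<..a + h i}} = measure N {a<..a + h i}"
      "prob {\<omega> \<in> space M. X j \<omega> \<in> {a - h i..a}} = measure N {a - h i..a}" if "j \<in> {1..n}" for i j
      by (rule prob_eq[OF _ that], simp)+
  qed (use k in auto)
  obtain Gb where Gb: "Gb \<in> sets M" "prob (space M - Gb) \<le> 4 / real m"
    and Gb_left: "\<And>\<omega>. \<omega> \<in> Gb \<Longrightarrow> nat \<bar>int (card {j \<in> {1..n}. X j \<omega> \<in> {b..}}) - int m\<bar> \<le> card {j \<in> {1..n}. X j \<omega> \<in>
        {b - h' (nat \<bar>int (card {j \<in> {1..n}. X j \<omega> \<in> {b..}}) - int m\<bar>)..<b}}"
    and Gb_right: "\<And>\<omega>. \<omega> \<in> Gb \<Longrightarrow> nat \<bar>int (card {j \<in> {1..n}. X j \<omega> \<in> {b..}}) - int m\<bar> \<le> card {j \<in> {1..n}. X j \<omega> \<in>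
        {b..b + h' (nat \<bar>int (card {j \<in> {1..n}. X j \<omega> \<in> {b..}}) - int m\<bar>)}}"
  proof (rule tail_counts[of "{b..}" \<beta> m "\<lambda>i. {b - h' i..<b}" "\<lambda>i. {b..b + h' i}"
        "\<lambda>i. measure N {b - h' i..<b}" "\<lambda>i. measure N {b..b + h' i}"])
    show "prob {\<omega> \<in> space M. X j \<omega> \<in> {b..}} = \<beta>" if "j \<in> {1..n}" for j
      using prob_eq[of "{b..}" j] that b by simp
    show "real (card {1..n}) * \<beta> = real m" using n by (simp add: \<beta>_def)
    show "4 * ln (real m) \<le> real m" using m sqrt_le[OF m(1)] by linarith
    show "4 * (real i + 4 * ln (real m)) \<le> real (card {1..n}) * measure N {b - h' i..<b}"
      "4 * (real i + 4 * ln (real m)) \<le> real (card {1..n}) * measure N {b..b + h' i}"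
      if "real i \<le> 2 * sqrt (real m * ln (real m))" for i
      using b_right[OF that] b_left[OF that] n by (simp_all add: divide_le_eq mult.commute)
    show "prob {\<omega> \<in> space M. X j \<omega> \<in> {b - h' i..<b}} = measure N {b - h' i..<b}"
      "prob {\<omega> \<in> space M. X j \<omega> \<in> {b..b + h' i}} = measure N {b..b + h' i}" if "j \<in> {1..n}" for i j
      by (rule prob_eq[OF _ that], simp)+
  qed (use m in auto)
  \<comment> \<open>Division by \<open>sqrt k\<close> brings the total variance of the
    \<open>n\<close> summands below \<open>n * \<alpha> / k = 1\<close>, the normalisation asked for
    by \<open>quadratic_concentration\<close>.\<close>
  define p where "p y = (indicator {..a} y - \<alpha>) / sqrt k" for y :: real
  define q where "q y = (indicator {b..} y - \<beta>) / sqrt m" for y :: real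
  have pq: "p \<in> borel_measurable borel" "q \<in> borel_measurable borel"
    unfolding p_def q_def by measurable
  have unit: "\<bar>(indicator C y - u) / sqrt i\<bar> \<le> 1" if "0 < u" "u < 1" "2 \<le> i" for C :: "real set" and y u and i :: nat
  proof -
    have "\<bar>indicator C y - u\<bar> \<le> 1" using that by (auto simp: indicator_def)
    moreover have "1 \<le> sqrt (real i)" using that by simp
    ultimately have "\<bar>indicator C y - u\<bar> \<le> sqrt (real i)" by (rule order_trans)
    then show ?thesis using that by (simp add: divide_le_eq)
  qed
  have cen: "expectation (\<lambda>\<omega>. (indicator C (X j \<omega>) - u) / sqrt i) = 0"
    if "C \<in> sets borel" "measure N C = u" "j \<in> {1..n}" for C u j and i :: nat
    using centred_indicator_moments(1)[OF that(1,3), of u] prob_eq[OF that(1,3)] that(2) by simp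
  have vari: "(\<Sum>j\<in>{1..n}. expectation (\<lambda>\<omega>. ((indicator C (X j \<omega>) - u) / sqrt i)\<^sup>2)) \<le> 1"
    if "C \<in> sets borel" "measure N C = u" "real n * u = real i" "2 \<le> i" for C u and i :: nat
  proof -
    have "(\<Sum>j\<in>{1..n}. expectation (\<lambda>\<omega>. ((indicator C (X j \<omega>) - u) / sqrt i)\<^sup>2)) \<le> real (card {1..n}) * (u / i)"
    proof (rule sum_bounded_above)
      fix j assume j: "j \<in> {1..n}"
      show "expectation (\<lambda>\<omega>. ((indicator C (X j \<omega>) - u) / sqrt i)\<^sup>2) \<le> u / i"
        using centred_indicator_moments(2)[OF that(1) j, of u] prob_eq[OF that(1) j] that(2)
        by (simp add: power_divide divide_right_mono)
    qed
    also have "\<dots> = 1" using that by (simp add: field_simps)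
    finally show ?thesis .
  qed
  define A where "A \<omega> = (\<Sum>j\<in>{1..n}. p (X j \<omega>))" for \<omega>
  define B where "B \<omega> = (\<Sum>j\<in>{1..n}. q (X j \<omega>))" for \<omega>
  define D where "D \<omega> = 16 * \<alpha> * \<psi> / s * ((A \<omega>)\<^sup>2 + 1) + 16 * \<beta> * \<psi>' / s * ((B \<omega>)\<^sup>2 + 1)" for \<omega>
  have A_eq: "A \<omega> = (real (card {j \<in> {1..n}. X j \<omega> \<le> a}) - real k) / sqrt k" for \<omega>
    using sum_centred_indicator[of "{..a}" \<omega> \<alpha>] n
    by (simp add: A_def p_def sum_divide_distrib[symmetric] \<alpha>_def)
  have B_eq: "B \<omega> = (real (card {j \<in> {1..n}. b \<le> X j \<omega>}) - real m) / sqrt m" for \<omega>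
    using sum_centred_indicator[of "{b..}" \<omega> \<beta>] n
    by (simp add: B_def q_def sum_divide_distrib[symmetric] \<beta>_def)
  have [measurable]: "A \<in> borel_measurable M" "B \<in> borel_measurable M"
    unfolding A_def B_def using pq by measurable
  have conc: "prob {\<omega>\<in>space M. \<bar>Z.W \<omega> - x\<bar> \<le> D \<omega>} \<le> 6 * \<delta> + 156 * (16 * \<alpha> * \<psi> / s + 16 * \<beta> * \<psi>' / s)"
    unfolding D_def A_def B_def
  proof (rule Z.quadratic_concentration)
    show "\<bar>p y\<bar> \<le> 1" "\<bar>q y\<bar> \<le> 1" for y
      unfolding p_def q_def using unit levels k m by auto
    show "expectation (\<lambda>\<omega>. p (X j \<omega>)) = 0" "expectation (\<lambda>\<omega>. q (X j \<omega>)) = 0" if "j \<in> {1..n}" for j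
      unfolding p_def q_def by (rule cen[OF _ a that] cen[OF _ b that], simp)+
    show "(\<Sum>j\<in>{1..n}. expectation (\<lambda>\<omega>. (p (X j \<omega>))\<^sup>2)) \<le> 1"
      "(\<Sum>j\<in>{1..n}. expectation (\<lambda>\<omega>. (q (X j \<omega>))\<^sup>2)) \<le> 1"
      unfolding p_def q_def using n
      by (intro vari[OF _ a _ k(1)] vari[OF _ b _ m(1)]; simp add: \<alpha>_def \<beta>_def)+
  qed (use pq psi levels s in auto)
  define \<tau> where "\<tau> \<omega> = inverse \<sigma> * sqrt n * (trimmed_sum X n k m \<omega> - trimmed_mean (cdf N) \<alpha> (1 - \<beta>))" for \<omega>
  have "(\<lambda>\<omega>. trimmed_sum X n k m \<omega>) \<in> borel_measurable M"
    unfolding trimmed_sum_def using km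
    by (intro borel_measurable_times borel_measurable_const borel_measurable_sum order_stat_measurable X_measurable) auto
  then have \<tau>_meas [measurable]: "\<tau> \<in> borel_measurable M" unfolding \<tau>_def by measurable
  have \<tau>_W: "\<bar>\<tau> \<omega> - Z.W \<omega>\<bar> \<le> D \<omega>" if \<omega>: "\<omega> \<in> Ga" "\<omega> \<in> Gb" for \<omega>
  proof -
    let ?A = "card {j \<in> {1..n}. X j \<omega> \<le> a}" and ?B = "card {j \<in> {1..n}. b \<le> X j \<omega>}"
    let ?i = "nat \<bar>int ?A - int k\<bar>" and ?j = "nat \<bar>int ?B - int m\<bar>"
    define E where "E = (\<Sum>i=k..<n - m. sort (map (\<lambda>j. X j \<omega>) [1..<Suc n]) ! i)
        + real k * a + real m * b - (\<Sum>j=1..n. c (X j \<omega>))"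
    have hnn: "0 \<le> h i" "0 \<le> h' i" for i using lnk psi by (auto simp: h_def h'_def)
    note sets = nat_le_iff atMost_iff atLeast_iff greaterThanAtMost_iff atLeastLessThan_iff
      atLeastAtMost_iff[where 'a = real]
    have E_le: "\<bar>E\<bar> \<le> \<bar>real ?A - real k\<bar> * h ?i + \<bar>real ?B - real m\<bar> * h' ?j"
      unfolding E_def c_def
      by (rule trimmed_minus_winsorized_le[OF km ab hnn])
         (rule Ga_right[OF \<omega>(1), unfolded sets] Ga_left[OF \<omega>(1), unfolded sets]
            Gb_left[OF \<omega>(2), unfolded sets] Gb_right[OF \<omega>(2), unfolded sets])+
    \<comment> \<open>The boundary terms by which the trimmed mean differs from the Winsorized mean
      are, after multiplication by \<open>n\<close>, the terms \<open>k * a\<close> and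
      \<open>m * b\<close> in \<open>E\<close>; all centring constants cancel.\<close>
    have "\<tau> \<omega> - Z.W \<omega> = E / s"
    proof -
      have "Z.W \<omega> = ((\<Sum>j=1..n. c (X j \<omega>)) - n * \<mu>) / s"
        unfolding Z.W_def g_def by (simp add: sum_divide_distrib[symmetric] sum_subtractf)
      moreover have "\<tau> \<omega> = (n * trimmed_sum X n k m \<omega> - n * trimmed_mean (cdf N) \<alpha> (1 - \<beta>)) / s"
      proof -
        have "inverse \<sigma> * sqrt n = inverse \<sigma> * (n / sqrt n)" by (simp only: real_div_sqrt of_nat_0_le_iff)
        also have "\<dots> = n / s" by (simp add: s_def divide_inverse)
        finally show ?thesis by (simp add: \<tau>_def right_diff_distrib diff_divide_distrib)
      qed
      moreover have "n * trimmed_mean (cdf N) \<alpha> (1 - \<beta>) = n * \<mu> - k * a - m * b"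
        using n trimmed_mean_eq[OF N levels]
        by (simp add: \<mu>_def a_def b_def \<alpha>_def \<beta>_def right_diff_distrib)
      ultimately show ?thesis
        unfolding trimmed_sum_eq[OF km] E_def by (simp add: diff_divide_distrib[symmetric] add_divide_distrib[symmetric])
    qed
    then have "\<bar>\<tau> \<omega> - Z.W \<omega>\<bar> = \<bar>E\<bar> / s" using s by simp
    also have "\<dots> \<le> (\<bar>real ?A - real k\<bar> * h ?i + \<bar>real ?B - real m\<bar> * h' ?j) / s"
      using E_le s by (intro divide_right_mono) auto
    also have "\<dots> = \<bar>real ?A - real k\<bar> * h ?i / s + \<bar>real ?B - real m\<bar> * h' ?j / s"
      by (rule add_divide_distrib)
    also have "\<dots> \<le> D \<omega>"
      unfolding D_def
    proof (rule add_mono)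
      have ij: "real ?i = \<bar>real ?A - real k\<bar>" "real ?j = \<bar>real ?B - real m\<bar>" by simp_all
      show "\<bar>real ?A - real k\<bar> * h ?i / s \<le> 16 * \<alpha> * \<psi> / s * ((A \<omega>)\<^sup>2 + 1)"
        unfolding h_def ij A_eq s_def \<alpha>_def
        using tail_error_le[OF k n sd psi(1), of "\<bar>real ?A - real k\<bar>"] by (simp add: power_divide)
      show "\<bar>real ?B - real m\<bar> * h' ?j / s \<le> 16 * \<beta> * \<psi>' / s * ((B \<omega>)\<^sup>2 + 1)"
        unfolding h'_def ij B_eq s_def \<beta>_def
        using tail_error_le[OF m n sd psi(2), of "\<bar>real ?B - real m\<bar>"] by (simp add: power_divide)
    qed
    finally show ?thesis .
  qed
  have D_meas [measurable]: "D \<in> borel_measurable M" unfolding D_def by measurable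
  let ?R1 = "{\<omega>\<in>space M. \<bar>Z.W \<omega> - x\<bar> \<le> D \<omega>}"
  let ?R = "?R1 \<union> ((space M - Ga) \<union> (space M - Gb))"
  have R1: "?R1 \<in> sets M" by measurable
  have E: "{\<omega>\<in>space M. \<tau> \<omega> \<le> x} \<in> sets M" "{\<omega>\<in>space M. Z.W \<omega> \<le> x} \<in> sets M"
    by measurable
  have "\<bar>prob {\<omega>\<in>space M. \<tau> \<omega> \<le> x} - prob {\<omega>\<in>space M. Z.W \<omega> \<le> x}\<bar> \<le> prob ?R"
  proof (rule prob_diff_le)
    \<comment> \<open>If \<open>x\<close> separates \<open>\<tau> \<omega>\<close> from
      \<open>Z.W \<omega>\<close>, then \<open>Z.W \<omega>\<close> is at least as close to
      \<open>x\<close> as to \<open>\<tau> \<omega>\<close>, hence within \<open>D \<omega>\<close>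
      unless an exceptional event occurs.\<close>
    have "\<omega> \<in> ?R" if "\<omega> \<in> space M" "(\<tau> \<omega> \<le> x) \<noteq> (Z.W \<omega> \<le> x)" for \<omega>
      using \<tau>_W[of \<omega>] that by (cases "\<omega> \<in> Ga"; cases "\<omega> \<in> Gb") auto
    then show "{\<omega>\<in>space M. \<tau> \<omega> \<le> x} \<subseteq> {\<omega>\<in>space M. Z.W \<omega> \<le> x} \<union> ?R"
      "{\<omega>\<in>space M. Z.W \<omega> \<le> x} \<subseteq> {\<omega>\<in>space M. \<tau> \<omega> \<le> x} \<union> ?R" by blast+
  qed (intro sets.Un sets.Diff sets.top E R1 Ga(1) Gb(1))+
  moreover have "prob ?R \<le> prob ?R1 + prob ((space M - Ga) \<union> (space M - Gb))"
    using R1 Ga(1) Gb(1) by (intro measure_Un_le) auto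
  moreover have "prob ((space M - Ga) \<union> (space M - Gb)) \<le> prob (space M - Ga) + prob (space M - Gb)"
    using Ga(1) Gb(1) by (intro measure_Un_le) auto
  moreover have "trimmed_cdf M X (cdf N) n k m x = prob {\<omega>\<in>space M. \<tau> \<omega> \<le> x}"
    by (simp add: trimmed_cdf_def \<tau>_def \<sigma>_def \<alpha>_def \<beta>_def Let_def)
  moreover note Z.berry_esseen_bounded[of x] conc Ga(2) Gb(2)
  ultimately show ?thesis unfolding s_def by linarith
qed

section \<open>Asymptotics\<close>

text \<open>Since \<open>(ln l)\<^sup>2 \<le> l * ln l\<close>, the logarithm is dominated by
  \<open>sqrt (l * ln l)\<close>, and \<open>24 = 4 * (2 + 4)\<close>. The right side is 24 units of
  the oscillation condition, so that condition is applied with \<open>B = 24\<close>.\<close>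

lemma count_level_le:
  assumes l: "1 \<le> l" and n: "1 \<le> n" and i: "real i \<le> 2 * sqrt (real l * ln (real l))"
  shows "count_level l n i \<le> 24 * sqrt (real l / real n * ln (real l) / real n)"
proof -
  have ln: "0 \<le> ln (real l)" "ln (real l) \<le> real l" using l ln_le_minus_one[of "real l"] by auto
  have "(ln (real l))\<^sup>2 \<le> real l * ln (real l)"
    using ln by (simp add: power2_eq_square mult_right_mono)
  then have "ln (real l) \<le> sqrt (real l * ln (real l))" by (rule real_le_rsqrt)
  then have "4 * (real i + 4 * ln (real l)) \<le> 24 * sqrt (real l * ln (real l))" using i by simp
  moreover have "sqrt (real l / real n * ln (real l) / real n) = sqrt (real l * ln (real l)) / real n"
    by (simp add: real_sqrt_divide real_sqrt_mult)
  ultimately show ?thesis using n by (simp add: divide_right_mono)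
qed

text \<open>The case \<open>P u = u\<close> is the lower tail and \<open>P u = 1 - u\<close> the upper tail.\<close>

locale smooth_tail =
  fixes N :: "real measure" and U :: "real set" and P :: "real \<Rightarrow> real" and \<epsilon> :: real
    and l :: "nat \<Rightarrow> nat" and \<gamma> :: "nat \<Rightarrow> real"
  assumes N: "real_distribution N"
    and U: "open U" "U \<subseteq> {0<..<1}"
    and q_diff: "\<And>u. u \<in> U \<Longrightarrow> quantile (cdf N) differentiable at u"
    and F_diff: "\<And>u. u \<in> U \<Longrightarrow> cdf N differentiable at (quantile (cdf N) u)"
    and f_pos: "\<And>u. u \<in> U \<Longrightarrow> 0 < deriv (cdf N) (quantile (cdf N) u)"
    and eps: "0 < \<epsilon>" and P_U: "\<And>u. 0 < u \<Longrightarrow> u < \<epsilon> \<Longrightarrow> P u \<in> U"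
    and P: "P = (\<lambda>u. u) \<or> P = (\<lambda>u. 1 - u)"
    and l: "filterlim l at_top sequentially"
    and \<gamma>: "\<And>n. \<gamma> n = real (l n) / real n" and \<gamma>_lim: "\<gamma> \<longlonglongrightarrow> 0"
begin

abbreviation "Q n \<equiv> quantile (cdf N) (P (\<gamma> n))"
abbreviation "f \<equiv> deriv (cdf N)"

lemma real_l: "filterlim (\<lambda>n. real (l n)) at_top sequentially"
  using filterlim_compose[OF filterlim_real_sequentially l] .

lemma eventually_l: "eventually R at_top \<Longrightarrow> \<forall>\<^sub>F n in sequentially. R (real (l n))"
  by (rule eventually_compose_filterlim[OF _ real_l])

lemma eventually_\<gamma>: "\<forall>\<^sub>F n in sequentially. 0 < \<gamma> n \<and> \<gamma> n < x" if "0 < x"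
proof -
  have "\<forall>\<^sub>F n in sequentially. \<gamma> n < x" using \<gamma>_lim that by (rule order_tendstoD(2))
  moreover have "\<forall>\<^sub>F n in sequentially. 0 < real (l n)"
    by (rule eventually_l) (rule eventually_gt_at_top)
  moreover have "\<forall>\<^sub>F n in sequentially. 0 < n" by (rule eventually_gt_at_top)
  ultimately show ?thesis by eventually_elim (auto simp: \<gamma>)
qed

text \<open>Near the endpoint the quantile function is strictly monotone and has at most one zero,
  which the levels eventually pass. A zero value must be excluded because division by 0 yields 0, so
  the ratio condition would say nothing there.\<close>

lemma quantile_nonzero: "\<forall>\<^sub>F n in sequentially. Q n \<noteq> 0"
proof (cases "\<exists>u. 0 < u \<and> u < \<epsilon> \<and> quantile (cdf N) (P u) = 0")
  case True
  then obtain u where u: "0 < u" "u < \<epsilon>" "quantile (cdf N) (P u) = 0" by blast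
  note mono = quantile_strict_mono[OF N U q_diff F_diff f_pos]
  have "\<forall>\<^sub>F n in sequentially. 0 < \<gamma> n \<and> \<gamma> n < u" using u(1) by (rule eventually_\<gamma>)
  then show ?thesis
  proof eventually_elim
    case (elim n)
    from P show ?case
    proof
      assume P: "P = (\<lambda>u. u)"
      have "quantile (cdf N) (\<gamma> n) < quantile (cdf N) u"
        using elim u P_U by (intro mono) (auto simp: P)
      then show ?thesis using u(3) by (simp add: P)
    next
      assume P: "P = (\<lambda>u. 1 - u)"
      have "quantile (cdf N) (1 - u) < quantile (cdf N) (1 - \<gamma> n)"
      proof (intro mono subsetI)
        fix v assume "v \<in> {1 - u..1 - \<gamma> n}"
        then show "v \<in> U" using P_U[of "1 - v"] elim u by (auto simp: P)
      qed (use elim in auto)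
      then show ?thesis using u(3) by (simp add: P)
    qed
  qed
next
  case False
  then show ?thesis using eventually_\<gamma>[OF eps] by (auto elim: eventually_mono)
qed

text \<open>The small-o relation with constant 1, together with \<open>ln l \<ge> 1\<close>, gives
  the bound \<open>1 / f (Q n)\<close> on the oscillation, the form in which
  \<open>measure_near_quantile\<close> takes it.\<close>

lemma increments:
  assumes small: "ereal_smallo (\<lambda>n. Psi (cdf N) (\<lambda>x. 1 / f x) (P (\<gamma> n)) (sqrt (\<gamma> n * ln (real (l n)) / real n)) 24)
      (\<lambda>n. inverse (f (Q n) * ln (real (l n))))"
  shows "\<forall>\<^sub>F n in sequentially. 2 \<le> l n \<and> 4 * ln (real (l n)) \<le> sqrt (real (l n)) \<and> P (\<gamma> n) \<in> U \<and>
    (\<forall>i. real i \<le> 2 * sqrt (real (l n) * ln (real (l n))) \<longrightarrow>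
       count_level (l n) n i
         \<le> measure N {Q n - 2 * count_level (l n) n i * (1 / f (Q n))..<Q n} \<and>
       count_level (l n) n i
         \<le> measure N {Q n<..Q n + 2 * count_level (l n) n i * (1 / f (Q n))})"
proof -
  let ?L = "\<lambda>n. real (l n)"
  have "\<forall>\<^sub>F n in sequentially. \<bar>Psi (cdf N) (\<lambda>x. 1 / f x) (P (\<gamma> n)) (sqrt (\<gamma> n * ln (?L n) / real n)) 24\<bar>
      \<le> ereal (1 * \<bar>inverse (f (Q n) * ln (?L n))\<bar>)"
    using small unfolding ereal_smallo_def by (rule allE[of _ 1]) simp
  moreover have "\<forall>\<^sub>F n in sequentially. 2 \<le> ?L n"
    by (rule eventually_l) (rule eventually_ge_at_top)
  moreover have "\<forall>\<^sub>F n in sequentially. 4 * ln (?L n) \<le> sqrt (?L n)"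
    by (rule eventually_l) real_asymp
  moreover have "\<forall>\<^sub>F n in sequentially. 1 \<le> ln (?L n)"
    by (rule eventually_l) real_asymp
  moreover have "\<forall>\<^sub>F n in sequentially. 24 * sqrt (ln (?L n) / ?L n) \<le> 1 / 2"
    by (rule eventually_l) real_asymp
  moreover have "\<forall>\<^sub>F n in sequentially. 0 < \<gamma> n \<and> \<gamma> n < \<epsilon> / 2"
    using eps by (intro eventually_\<gamma>) auto
  moreover have "\<forall>\<^sub>F n in sequentially. 1 \<le> n" by (rule eventually_ge_at_top)
  ultimately show ?thesis
  proof eventually_elim
    case (elim n)
    let ?d = "sqrt (\<gamma> n * ln (?L n) / real n)"
    \<comment> \<open>Because \<open>\<gamma> n = l n / n\<close>, the unit is of smaller order than
      the level. Thus 24 units are eventually at most half the distance to the endpoint, and the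
      window stays inside \<open>U\<close>.\<close>
    have d_eq: "?d = \<gamma> n * sqrt (ln (?L n) / ?L n)"
    proof -
      have eq: "\<gamma> n * ln (?L n) / real n = (\<gamma> n)\<^sup>2 * (ln (?L n) / ?L n)"
        using elim by (simp add: \<gamma> power2_eq_square)
      show ?thesis unfolding eq real_sqrt_mult using elim by simp
    qed
    have d: "0 < ?d" "24 * ?d \<le> \<gamma> n / 2"
    proof -
      show "0 < ?d" using elim by simp
      have "\<gamma> n * (24 * sqrt (ln (?L n) / ?L n)) \<le> \<gamma> n * (1 / 2)"
        using elim by (intro mult_left_mono) auto
      then show "24 * ?d \<le> \<gamma> n / 2" unfolding d_eq by simp
    qed
    have sub: "{P (\<gamma> n) - 24 * ?d..P (\<gamma> n) + 24 * ?d} \<subseteq> U"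
    proof
      fix v assume "v \<in> {P (\<gamma> n) - 24 * ?d..P (\<gamma> n) + 24 * ?d}"
      then have "P (\<gamma> n) - 24 * ?d \<le> v" "v \<le> P (\<gamma> n) + 24 * ?d" by simp_all
      then have v: "\<bar>v - P (\<gamma> n)\<bar> \<le> \<gamma> n / 2" using d(2) by linarith
      have g: "0 < \<gamma> n" "\<gamma> n < \<epsilon> / 2" using elim by auto
      from P show "v \<in> U"
      proof
        assume P: "P = (\<lambda>u. u)"
        have "\<bar>v - \<gamma> n\<bar> \<le> \<gamma> n / 2" using v by (simp add: P)
        with g have "0 < v" "v < \<epsilon>" by linarith+
        then show ?thesis using P_U[of v] by (simp add: P)
      next
        assume P: "P = (\<lambda>u. 1 - u)"
        have "\<bar>v - (1 - \<gamma> n)\<bar> \<le> \<gamma> n / 2" using v by (simp add: P)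
        with g have "0 < 1 - v" "1 - v < \<epsilon>" by linarith+
        then show ?thesis using P_U[of "1 - v"] by (simp add: P)
      qed
    qed
    have PU: "P (\<gamma> n) \<in> U" using elim eps by (intro P_U) auto
    then have f: "0 < f (Q n)" by (rule f_pos)
    have "Psi (cdf N) (\<lambda>x. 1 / f x) (P (\<gamma> n)) ?d 24 \<le> \<bar>Psi (cdf N) (\<lambda>x. 1 / f x) (P (\<gamma> n)) ?d 24\<bar>"
      by (cases "Psi (cdf N) (\<lambda>x. 1 / f x) (P (\<gamma> n)) ?d 24") auto
    also have "\<dots> \<le> ereal (1 * \<bar>inverse (f (Q n) * ln (?L n))\<bar>)" using elim by simp
    also have "\<dots> \<le> ereal (1 / f (Q n))"
    proof -
      have "f (Q n) * 1 \<le> f (Q n) * ln (?L n)" using f elim by (intro mult_left_mono) auto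
      then have "inverse (f (Q n) * ln (?L n)) \<le> inverse (f (Q n))" using f by (intro le_imp_inverse_le) auto
      then show ?thesis using f elim by (simp add: inverse_eq_divide abs_mult)
    qed
    finally have Psi: "Psi (cdf N) (\<lambda>x. 1 / f x) (P (\<gamma> n)) ?d 24 \<le> ereal (1 / f (Q n))" .
    have "count_level (l n) n i
         \<le> measure N {Q n - 2 * count_level (l n) n i * (1 / f (Q n))..<Q n} \<and>
       count_level (l n) n i
         \<le> measure N {Q n<..Q n + 2 * count_level (l n) n i * (1 / f (Q n))}"
      if i: "real i \<le> 2 * sqrt (?L n * ln (?L n))" for i
    proof -
      define y where "y = count_level (l n) n i"
      have y: "0 \<le> y" "y \<le> 24 * ?d"
        using count_level_le[OF _ _ i, of n] elim by (simp_all add: y_def \<gamma>)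
      show ?thesis
        using measure_near_quantile[OF N U q_diff F_diff f_pos Psi sub d(1) y]
        unfolding y_def[symmetric] by simp
    qed
    then show ?case using elim PU by simp
  qed
qed

lemma ratio_bounded:
  assumes "limsup (\<lambda>n. ereal (\<gamma> n / (\<bar>Q n\<bar> * f (Q n)))) < \<infinity>"
  obtains C where "0 \<le> C" "\<forall>\<^sub>F n in sequentially. \<gamma> n * (1 / f (Q n)) \<le> C * \<bar>Q n\<bar>"
proof -
  obtain C :: real where C: "limsup (\<lambda>n. ereal (\<gamma> n / (\<bar>Q n\<bar> * f (Q n)))) < ereal C"
    using ereal_dense2[OF assms] by auto
  have "\<forall>\<^sub>F n in sequentially. ereal (\<gamma> n / (\<bar>Q n\<bar> * f (Q n))) < ereal C"
    using C by (rule Limsup_lessD)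
  moreover note quantile_nonzero eventually_\<gamma>[OF eps]
  ultimately have "\<forall>\<^sub>F n in sequentially. \<gamma> n * (1 / f (Q n)) \<le> \<bar>C\<bar> * \<bar>Q n\<bar>"
  proof eventually_elim
    case (elim n)
    then have f: "0 < f (Q n)" by (intro f_pos P_U) auto
    have "\<gamma> n / (\<bar>Q n\<bar> * f (Q n)) \<le> \<bar>C\<bar>" using elim by simp
    then have "\<gamma> n \<le> \<bar>C\<bar> * (\<bar>Q n\<bar> * f (Q n))" using elim f by (simp add: divide_le_eq)
    then show ?case using f by (simp add: divide_le_eq mult.assoc)
  qed
  then show thesis by (intro that[of "\<bar>C\<bar>"]) auto
qed

lemma moment_lim:
  assumes "((\<lambda>u. u * (quantile (cdf N) (P u))\<^sup>2) \<longlongrightarrow> 0) (at_right 0)"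
  shows "(\<lambda>n. sqrt (\<gamma> n) * \<bar>Q n\<bar>) \<longlonglongrightarrow> 0"
proof -
  have "filterlim \<gamma> (at_right 0) sequentially"
    using \<gamma>_lim eventually_\<gamma>[OF eps] by (auto simp: filterlim_at elim: eventually_mono)
  from filterlim_compose[OF assms this] have "(\<lambda>n. sqrt (\<gamma> n * (Q n)\<^sup>2)) \<longlonglongrightarrow> sqrt 0"
    by (rule tendsto_real_sqrt)
  then show ?thesis by (simp add: real_sqrt_mult)
qed

end

theorem theorem1p3:
  fixes M :: "'a measure"
    and X :: "nat \<Rightarrow> 'a \<Rightarrow> real"
    and F f :: "real \<Rightarrow> real"
    and k m :: "nat \<Rightarrow> nat"
    and \<alpha> \<beta> :: "nat \<Rightarrow> real"
  assumes "prob_space M"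
    and indep: "prob_space.indep_vars M (\<lambda>_. borel) X {1..}"
    and ident: "\<And>i. 1 \<le> i \<Longrightarrow> cdf (distr M borel (X i)) = F"
    and nondegenerate: "\<not> (\<exists>c. AE \<omega> in M. X 1 \<omega> = c)"
    and trimming: "\<And>n. 1 \<le> n \<Longrightarrow> k n < n - m n"
    and min_at_top: "filterlim (\<lambda>n. min (k n) (m n)) at_top sequentially"
    and alpha: "\<And>n. \<alpha> n = real (k n) / real n"
    and beta: "\<And>n. \<beta> n = real (m n) / real n"
    and standing_levels:
      "limsup (\<lambda>n. ereal (\<alpha> n)) < liminf (\<lambda>n. ereal (1 - \<beta> n))"
    and standing_scale:
      "0 < liminf (\<lambda>n. ereal (winsor_sd F (\<alpha> n) (1 - \<beta> n)))"
    and finite_sigma2: "sigma2 F 0 1 < \<infinity>"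
    and slight_trimming: "(\<lambda>n. max (\<alpha> n) (\<beta> n)) \<longlonglongrightarrow> 0"
    and smooth: "smooth_tails F"
    and density: "f = deriv F"
    and lower_tail:
      "limsup (\<lambda>n. ereal (\<alpha> n / (\<bar>quantile F (\<alpha> n)\<bar> * f (quantile F (\<alpha> n))))) < \<infinity>"
    and upper_tail:
      "limsup (\<lambda>n. ereal (\<beta> n / (\<bar>quantile F (1 - \<beta> n)\<bar> * f (quantile F (1 - \<beta> n))))) < \<infinity>"
    and lower_oscillation:
      "\<And>B. 0 < B \<Longrightarrow> ereal_smallo
         (\<lambda>n. Psi F (\<lambda>x. 1 / f x) (\<alpha> n) (sqrt (\<alpha> n * ln (real (k n)) / real n)) B)
         (\<lambda>n. inverse (f (quantile F (\<alpha> n)) * ln (real (k n))))"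
    and upper_oscillation:
      "\<And>B. 0 < B \<Longrightarrow> ereal_smallo
         (\<lambda>n. Psi F (\<lambda>x. 1 / f x) (1 - \<beta> n) (sqrt (\<beta> n * ln (real (m n)) / real n)) B)
         (\<lambda>n. inverse (f (quantile F (1 - \<beta> n)) * ln (real (m n))))"
  shows "(\<lambda>n. SUP x. \<bar>trimmed_cdf M X F n (k n) (m n) x - cdf std_normal_distribution x\<bar>)
           \<in> o(\<lambda>n. 1 / sqrt (real (k n)) + 1 / sqrt (real (m n)))"
proof -
  interpret prob_space M by (rule assms(1))
  have X: "X i \<in> borel_measurable M" if "1 \<le> i" for i
    using indep that by (simp add: indep_vars_def)
  define N where "N = distr M borel (X 1)"
  have N: "real_distribution N" unfolding N_def by (rule real_distribution_distr) (rule X, simp)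
  interpret N: real_distribution N by (rule N)
  have F: "F = cdf N" using ident[of 1] by (simp add: N_def)
  have distr: "distr M borel (X i) = N" if "1 \<le> i" for i
    using real_distribution_distr[OF X[OF that]] N by (rule cdf_unique) (simp add: ident[OF that] F)
  obtain Ua Ub \<epsilon> where U: "open Ua" "open Ub" "Ua \<subseteq> {0<..<1}" "Ub \<subseteq> {0<..<1}" "0 < \<epsilon>" "\<epsilon> < 1"
    "{0<..<\<epsilon>} \<subseteq> Ua" "{1 - \<epsilon><..<1} \<subseteq> Ub"
    "\<And>u. u \<in> Ua \<union> Ub \<Longrightarrow> quantile F differentiable at u"
    "\<And>u. u \<in> Ua \<union> Ub \<Longrightarrow> F differentiable at (quantile F u)"
    "\<And>u. u \<in> Ua \<union> Ub \<Longrightarrow> 0 < deriv F (quantile F u)"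
    using smooth unfolding smooth_tails_def by (auto; blast)
  note U_smooth = U(9-11)[unfolded F]
  have k_lim: "filterlim k at_top sequentially" and m_lim: "filterlim m at_top sequentially"
    by (rule filterlim_at_top_mono[OF min_at_top], simp)+
  have nn: "0 \<le> \<alpha> n" "0 \<le> \<beta> n" for n by (simp_all add: alpha beta)
  have \<alpha>_lim: "\<alpha> \<longlonglongrightarrow> 0" and \<beta>_lim: "\<beta> \<longlonglongrightarrow> 0"
    by (rule tendsto_sandwich[OF _ _ tendsto_const slight_trimming]; simp add: nn)+
  interpret L: smooth_tail N "Ua \<union> Ub" "\<lambda>u. u" \<epsilon> k \<alpha>
  proof
    show "u \<in> Ua \<union> Ub" if "0 < u" "u < \<epsilon>" for u using that U(7) by auto
  qed (rule N open_Un U(1) U(2) Un_least U(3) U(4) U(5) U_smooth disjI1 refl k_lim alpha \<alpha>_lim; assumption?)+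
  interpret R: smooth_tail N "Ua \<union> Ub" "\<lambda>u. 1 - u" \<epsilon> m \<beta>
  proof
    show "1 - u \<in> Ua \<union> Ub" if "0 < u" "u < \<epsilon>" for u using subsetD[OF U(8), of "1 - u"] that by simp
  qed (rule N open_Un U(1) U(2) Un_least U(3) U(4) U(5) U_smooth disjI2 refl m_lim beta \<beta>_lim; assumption?)+
  define a where "a n = quantile (cdf N) (\<alpha> n)" for n
  define b where "b n = quantile (cdf N) (1 - \<beta> n)" for n
  define \<sigma> where "\<sigma> n = winsor_sd (cdf N) (\<alpha> n) (1 - \<beta> n)" for n
  obtain s :: real where s: "0 < s" "\<forall>\<^sub>F n in sequentially. s < \<sigma> n"
  proof -
    obtain s :: real where s: "0 < ereal s" "ereal s < liminf (\<lambda>n. ereal (\<sigma> n))"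
      using ereal_dense2[OF standing_scale] unfolding F \<sigma>_def by auto
    from s(2) have "\<forall>\<^sub>F n in sequentially. ereal s < ereal (\<sigma> n)" by (rule less_LiminfD)
    with s(1) that show thesis by simp
  qed
  obtain C where C: "0 \<le> C" "\<forall>\<^sub>F n in sequentially. \<alpha> n * (1 / deriv (cdf N) (a n)) \<le> C * \<bar>a n\<bar>"
    using L.ratio_bounded lower_tail unfolding density F a_def by blast
  obtain C' where C': "0 \<le> C'" "\<forall>\<^sub>F n in sequentially. \<beta> n * (1 / deriv (cdf N) (b n)) \<le> C' * \<bar>b n\<bar>"
    using R.ratio_bounded upper_tail unfolding density F b_def by blast
  have nonzero: "\<forall>\<^sub>F n in sequentially. a n \<noteq> 0"
    unfolding a_def by (rule L.quantile_nonzero)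
  have incL: "\<forall>\<^sub>F n in sequentially. 2 \<le> k n \<and> 4 * ln (real (k n)) \<le> sqrt (real (k n)) \<and> \<alpha> n \<in> Ua \<union> Ub \<and>
    (\<forall>i. real i \<le> 2 * sqrt (real (k n) * ln (real (k n))) \<longrightarrow>
       count_level (k n) n i
         \<le> measure N {a n - 2 * count_level (k n) n i * (1 / deriv (cdf N) (a n))..<a n} \<and>
       count_level (k n) n i
         \<le> measure N {a n<..a n + 2 * count_level (k n) n i * (1 / deriv (cdf N) (a n))})"
    unfolding a_def by (rule L.increments) (use lower_oscillation[of 24] in \<open>simp only: density F zero_less_numeral\<close>)
  have incR: "\<forall>\<^sub>F n in sequentially. 2 \<le> m n \<and> 4 * ln (real (m n)) \<le> sqrt (real (m n)) \<and> 1 - \<beta> n \<in> Ua \<union> Ub \<and>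
    (\<forall>i. real i \<le> 2 * sqrt (real (m n) * ln (real (m n))) \<longrightarrow>
       count_level (m n) n i
         \<le> measure N {b n - 2 * count_level (m n) n i * (1 / deriv (cdf N) (b n))..<b n} \<and>
       count_level (m n) n i
         \<le> measure N {b n<..b n + 2 * count_level (m n) n i * (1 / deriv (cdf N) (b n))})"
    unfolding b_def by (rule R.increments) (use upper_oscillation[of 24] in \<open>simp only: density F zero_less_numeral\<close>)
  \<comment> \<open>This is the factor that tends to 0 in
    \<open>\<bar>a n\<bar> / sqrt n = r n / sqrt (k n)\<close>; \<open>r'\<close> is its counterpart
    for the upper tail.\<close>
  define r where "r n = sqrt (\<alpha> n) * \<bar>a n\<bar>" for n
  define r' where "r' n = sqrt (\<beta> n) * \<bar>b n\<bar>" for n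
  have r_lim: "r \<longlonglongrightarrow> 0"
    unfolding r_def[abs_def] a_def
    by (rule L.moment_lim) (rule quantile_lower_tail[OF N finite_sigma2[unfolded F]])
  have r'_lim: "r' \<longlonglongrightarrow> 0"
    unfolding r'_def[abs_def] b_def
    by (rule R.moment_lim) (rule quantile_upper_tail[OF N finite_sigma2[unfolded F]])
  \<comment> \<open>The collected coefficient of \<open>r n / sqrt (k n)\<close> in the final bound:
    24 from \<open>\<delta>\<close>, \<open>2496 = 156 * 16\<close> from the width, \<open>C\<close>
    from the ratio condition, and \<open>s\<close> as lower bound of the Winsorized scale.\<close>
  define K where "K = (24 + 2496 * C) / s"
  define K' where "K' = (24 + 2496 * C') / s"
  have inv_lim: "(\<lambda>n. 4 / sqrt (real (k n))) \<longlonglongrightarrow> 0" "(\<lambda>n. 4 / sqrt (real (m n))) \<longlonglongrightarrow> 0"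
    by (rule filterlim_compose[OF _ L.real_l] filterlim_compose[OF _ R.real_l], real_asymp)+
  have lim: "(\<lambda>n. K * r n + 4 / sqrt (real (k n))) \<longlonglongrightarrow> 0"
    "(\<lambda>n. K' * r' n + 4 / sqrt (real (m n))) \<longlonglongrightarrow> 0"
    using tendsto_add[OF tendsto_mult_left[OF r_lim, of K] inv_lim(1)]
      tendsto_add[OF tendsto_mult_left[OF r'_lim, of K'] inv_lim(2)] by simp_all
  show ?thesis
  proof (rule landau_o.smallI)
    fix c :: real assume c: "0 < c"
    have "\<forall>\<^sub>F n in sequentially. K * r n + 4 / sqrt (real (k n)) < c"
      "\<forall>\<^sub>F n in sequentially. K' * r' n + 4 / sqrt (real (m n)) < c"
      by (rule order_tendstoD(2)[OF lim(1) c] order_tendstoD(2)[OF lim(2) c])+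
    moreover have "\<forall>\<^sub>F n in sequentially. r n < s / 2" "\<forall>\<^sub>F n in sequentially. r' n < s / 2"
      using s(1) by - (rule order_tendstoD(2)[OF r_lim] order_tendstoD(2)[OF r'_lim], simp)+
    moreover have "\<forall>\<^sub>F n in sequentially. 1 \<le> n" by (rule eventually_ge_at_top)
    moreover note s(2) C(2) C'(2) nonzero incL incR
    ultimately show "\<forall>\<^sub>F n in sequentially.
      norm (SUP x. \<bar>trimmed_cdf M X F n (k n) (m n) x - \<Phi> x\<bar>)
        \<le> c * norm (1 / sqrt (real (k n)) + 1 / sqrt (real (m n)))"
    proof eventually_elim
      case (elim n)
      define \<psi> where "\<psi> = 1 / deriv (cdf N) (a n)"
      define \<psi>' where "\<psi>' = 1 / deriv (cdf N) (b n)"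
      define \<delta> where "\<delta> = (\<bar>a n\<bar> + \<bar>b n\<bar>) / (\<sigma> n * sqrt (real n))"
      define x where "x = 1 / sqrt (real (k n))"
      define y where "y = 1 / sqrt (real (m n))"
      have n: "1 \<le> n" and sd: "s < \<sigma> n" using elim by auto
      have k: "2 \<le> k n" "4 * ln (real (k n)) \<le> sqrt (real (k n))" "\<alpha> n \<in> Ua \<union> Ub"
        and m: "2 \<le> m n" "4 * ln (real (m n)) \<le> sqrt (real (m n))" "1 - \<beta> n \<in> Ua \<union> Ub"
        using elim by auto
      have xy: "0 < x" "x \<le> 1" "0 < y" "y \<le> 1" using k m by (simp_all add: x_def y_def)
      have psi: "0 \<le> \<psi>" "0 \<le> \<psi>'"
        using L.f_pos[OF k(3)] R.f_pos[OF m(3)] by (simp_all add: \<psi>_def \<psi>'_def a_def b_def)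
      have level: "\<bar>q\<bar> / sqrt (real n) = sqrt (real j / real n) * \<bar>q\<bar> * (1 / sqrt (real j))" if "2 \<le> j" for q and j :: nat
        using that by (simp add: real_sqrt_divide)
      have a_n: "\<bar>a n\<bar> / sqrt (real n) = r n * x" and b_n: "\<bar>b n\<bar> / sqrt (real n) = r' n * y"
        using level[OF k(1), of "a n"] level[OF m(1), of "b n"]
        by (simp_all only: r_def r'_def x_def y_def alpha beta)
      have rnn: "0 \<le> r n" "0 \<le> r' n" by (simp_all add: r_def r'_def nn)
      have \<delta>_le: "\<delta> \<le> (r n * x + r' n * y) / s"
      proof -
        have "\<delta> = (\<bar>a n\<bar> / sqrt (real n) + \<bar>b n\<bar> / sqrt (real n)) / \<sigma> n"
          by (simp add: \<delta>_def add_divide_distrib mult.commute)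
        also have "\<dots> \<le> (r n * x + r' n * y) / s"
          unfolding a_n b_n using sd s(1) rnn xy by (intro divide_left_mono) auto
        finally show ?thesis .
      qed
      have "r n * x \<le> r n" "r' n * y \<le> r' n" using rnn xy by (simp_all add: mult_left_le)
      then have "r n * x + r' n * y \<le> s" using elim by linarith
      then have "(r n * x + r' n * y) / s \<le> 1" using s(1) by simp
      with \<delta>_le have \<delta>1: "\<delta> \<le> 1" by linarith
      have \<delta>0: "0 < \<delta>" unfolding \<delta>_def using elim s(1) n
        by (intro divide_pos_pos mult_pos_pos add_pos_nonneg) auto
      have tail_term: "16 * \<gamma> * p / (\<sigma> n * sqrt (real n)) \<le> 16 * (c' * z) / s"
        if "\<gamma> * p \<le> c' * \<bar>q\<bar>" "\<bar>q\<bar> / sqrt (real n) = z" "0 \<le> c'" for \<gamma> p q c' z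
      proof -
        have z: "0 \<le> z" using that(2) by (metis abs_ge_zero divide_nonneg_nonneg real_sqrt_ge_zero of_nat_0_le_iff)
        have "16 * \<gamma> * p / (\<sigma> n * sqrt (real n)) = 16 * (\<gamma> * p / sqrt (real n)) / \<sigma> n"
          by (simp add: mult.commute mult.left_commute)
        also have "\<dots> \<le> 16 * (c' * \<bar>q\<bar> / sqrt (real n)) / \<sigma> n"
          using that(1) sd s(1) by (intro divide_right_mono mult_left_mono) auto
        also have "\<dots> = 16 * (c' * z) / \<sigma> n" by (simp add: that(2)[symmetric])
        also have "\<dots> \<le> 16 * (c' * z) / s"
          using sd s(1) that(3) z by (intro divide_left_mono) auto
        finally show ?thesis .
      qed
      have ea: "16 * \<alpha> n * \<psi> / (\<sigma> n * sqrt (real n)) \<le> 16 * (C * (r n * x)) / s"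
        and eb: "16 * \<beta> n * \<psi>' / (\<sigma> n * sqrt (real n)) \<le> 16 * (C' * (r' n * y)) / s"
        by (rule tail_term[OF _ a_n C(1)] tail_term[OF _ b_n C'(1)],
            use elim in \<open>simp only: \<psi>_def \<psi>'_def\<close>)+
      have a_level: "measure N {..a n} = \<alpha> n"
        using cdf_quantile_smooth[OF N L.U L.q_diff L.F_diff L.f_pos k(3)] by (simp add: cdf_def a_def)
      \<comment> \<open>The upper tail is counted with \<open>b n\<close> included, while the
        distribution function gives the mass strictly above it; the two agree because the point has
        no mass.\<close>
      have b_level: "measure N {b n..} = \<beta> n"
      proof -
        have "cdf N (b n) = 1 - \<beta> n"
          using cdf_quantile_smooth[OF N L.U L.q_diff L.F_diff L.f_pos m(3)] by (simp add: b_def)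
        moreover have "measure N {b n} = 0"
          using measure_quantile_singleton[OF N L.U L.q_diff L.F_diff L.f_pos m(3)] by (simp add: b_def)
        moreover have "measure N {b n<..} = 1 - cdf N (b n)"
          using N.prob_compl[of "{..b n}"] by (simp add: cdf_def Compl_eq_Diff_UNIV[symmetric])
        moreover have "measure N ({b n} \<union> {b n<..}) = measure N {b n} + measure N {b n<..}"
          by (rule N.finite_measure_Union) auto
        moreover have "{b n} \<union> {b n<..} = {b n..}" by auto
        ultimately show ?thesis by simp
      qed
      have be: "\<bar>trimmed_cdf M X (cdf N) n (k n) (m n) z - \<Phi> z\<bar>
        \<le> 24 * \<delta> + 156 * (16 * \<alpha> n * \<psi> / (\<sigma> n * sqrt (real n)) + 16 * \<beta> n * \<psi>' / (\<sigma> n * sqrt (real n)))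
          + 4 / real (k n) + 4 / real (m n)" for z
        unfolding \<delta>_def
      proof (rule trimmed_sum_berry_esseen[of X n N "k n" "m n" \<psi> \<psi>' z, folded alpha beta, folded a_def b_def \<sigma>_def])
        show "indep_vars (\<lambda>_. borel) X {1..n}"
          by (rule indep_vars_subset[OF indep]) auto
        show "distr M borel (X i) = N" if "i \<in> {1..n}" for i using that by (intro distr) auto
        show "k n < n - m n" by (rule trimming[OF n])
        show "0 < \<sigma> n" using sd s(1) by linarith
        show "0 < (\<bar>a n\<bar> + \<bar>b n\<bar>) / (\<sigma> n * sqrt (real n))" "(\<bar>a n\<bar> + \<bar>b n\<bar>) / (\<sigma> n * sqrt (real n)) \<le> 1"
          using \<delta>0 \<delta>1 by (simp_all only: \<delta>_def)
        fix i :: nat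
        show "count_level (k n) n i
            \<le> measure N {a n - 2 * count_level (k n) n i * \<psi>..a n}"
          if "real i \<le> 2 * sqrt (real (k n) * ln (real (k n)))"
        proof (rule order_trans)
          show "count_level (k n) n i
            \<le> measure N {a n - 2 * count_level (k n) n i * \<psi>..<a n}"
            using elim that unfolding \<psi>_def by blast
        qed (auto intro!: N.finite_measure_mono)
        show "count_level (k n) n i
            \<le> measure N {a n<..a n + 2 * count_level (k n) n i * \<psi>}"
          if "real i \<le> 2 * sqrt (real (k n) * ln (real (k n)))"
          using elim that unfolding \<psi>_def by blast
        show "count_level (m n) n i
            \<le> measure N {b n - 2 * count_level (m n) n i * \<psi>'..<b n}"
          if "real i \<le> 2 * sqrt (real (m n) * ln (real (m n)))"
          using elim that unfolding \<psi>'_def by blast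
        show "count_level (m n) n i
            \<le> measure N {b n..b n + 2 * count_level (m n) n i * \<psi>'}"
          if "real i \<le> 2 * sqrt (real (m n) * ln (real (m n)))"
        proof (rule order_trans)
          show "count_level (m n) n i
            \<le> measure N {b n<..b n + 2 * count_level (m n) n i * \<psi>'}"
            using elim that unfolding \<psi>'_def by blast
        qed (auto intro!: N.finite_measure_mono)
      qed (use k m psi a_level b_level in auto)
      have inv: "4 / real (k n) = 4 * x * x" "4 / real (m n) = 4 * y * y"
        using k m by (simp_all add: x_def y_def)
      have "\<bar>trimmed_cdf M X F n (k n) (m n) z - \<Phi> z\<bar> \<le> c * (x + y)" for z
      proof -
        have "24 * \<delta> + 156 * (16 * \<alpha> n * \<psi> / (\<sigma> n * sqrt (real n)) + 16 * \<beta> n * \<psi>' / (\<sigma> n * sqrt (real n)))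
          + 4 / real (k n) + 4 / real (m n)
          \<le> 24 * ((r n * x + r' n * y) / s) + 156 * (16 * (C * (r n * x)) / s + 16 * (C' * (r' n * y)) / s)
            + 4 * x * x + 4 * y * y"
          unfolding inv using \<delta>_le ea eb by (intro add_mono mult_left_mono order_refl) auto
        also have "\<dots> = (K * r n + 4 * x) * x + (K' * r' n + 4 * y) * y"
          using s(1) by (simp add: K_def K'_def field_simps)
        also have "\<dots> \<le> c * x + c * y"
          using elim xy by (intro add_mono mult_right_mono) (auto simp: x_def y_def)
        finally show ?thesis using be[of z] unfolding F by (simp add: distrib_left)
      qed
      note bound = this
      \<comment> \<open>A real supremum is meaningful only over a bounded set, and
        \<open>bound\<close> supplies this. Nonnegativity, read off at the arbitrary point 0,
        removes the norm.\<close>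
      have "0 \<le> (SUP z. \<bar>trimmed_cdf M X F n (k n) (m n) z - \<Phi> z\<bar>)"
        by (rule cSUP_upper2[where x = 0]) (auto intro!: bdd_aboveI2[OF bound])
      moreover have "(SUP z. \<bar>trimmed_cdf M X F n (k n) (m n) z - \<Phi> z\<bar>) \<le> c * (x + y)"
        by (rule cSUP_least) (auto intro: bound)
      ultimately show ?case using xy by (simp add: x_def y_def)
    qed
  qed
qed

end
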